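(* Let $N$ be a Seifert manifold with Seifert invariants $\{e;(\epsilon,g);(a_1,b_1),\ldots,(a_n,b_n)\}$, let $\pi_1(N)$ be given by the associated presentation with generators $s_1,\ldots,s_n,v_1,\ldots,v_{g'},h$, and let $\varphi:\pi_1(N)\to\mathbb{Z}_2=\mathbb{Z}/2\mathbb{Z}$ be an epimorphism with $\varphi(h)=0$. Let $m$ be the number of $s_k$'s mapped to $1$ by $\varphi$, and assume that these are the first ones, i.e. $\varphi(s_k)=1$ if and only if $k\le m$. Then $\ker(\varphi)$ is (isomorphic to) the fundamental group of the Seifert manifold given by the following invariants. (Orientation covers) If $m=0$ and - if $\epsilon=o_2$ and $\varphi$ maps all $v_j$'s to $1$: $\{0;(o_1,2g-1);F_{OC}\}$; - if $\epsilon=n_1$ and $\varphi$ maps all $v_j$'s to $1$: $\{0;(o_1,g-1);F_{OC}\}$; - if $\epsilon=n_3$ and, among the $v_j$'s, $\varphi$ sends only $v_1$ to $1$, or if $\epsilon=n_4$ and, among the $v_j$'s, $\varphi$ sends only $v_1,v_2$ to $1$: $\{0;(n_2,2g-2);F_{OC}\}$. (Exotic cases) If $m=0$, $\epsilon\in\{n_2,n_3,n_4\}$ and $\varphi$ maps all $v_j$'s to $1$: - if $\epsilon=n_2$: $\{2e;(o_1,g-1);F_0\}$; - if $\epsilon=n_3$ or $n_4$: $\{0;(o_2,g-1);F_0\}$. (Ordinary cases) In all other cases: $\{e';(\epsilon',G);F_m\}$, with $$e'=\begin{cases}2e&\text{if }\epsilon=o_1,n_2\\0&\text{if }\epsilon=o_2,n_1,n_3,n_4\end{cases}\qquad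 \epsilon'=\begin{cases}\epsilon&\text{if }\epsilon=o_1,o_2,n_1,n_2,n_4\\ n_4&\text{if }\epsilon=n_3\end{cases}$$ $$G=\begin{cases}\frac m2-1+2g&\text{if }\epsilon=o_1,o_2\\ m-2+2g&\text{if }\epsilon=n_1,n_2,n_3,n_4.\end{cases}$$
   Context: Seifert manifolds (orientable or not) are described by a list of Seifert invariants $\{e;(\epsilon,g);(a_1,b_1),\ldots,(a_n,b_n)\}$, not assumed normalized: $e$ is an integer, $g$ is the genus of the base surface, and for each $k$ the integers $a_k,b_k$ are coprime with $a_k\neq0$. The type $\epsilon$ is one of $o_1,o_2,n_1,n_2,n_3,n_4$ and determines signs $\varepsilon_1,\ldots,\varepsilon_{g'}\in\{1,-1\}$: - $o_1$: base orientable, total space orientable; all $\varepsilon_j=1$; - $o_2$: base orientable, total space non-orientable, $g\ge1$; all $\varepsilon_j=-1$; - $n_1$: base and total space non-orientable, $g\ge1$; all $\varepsilon_j=1$; - $n_2$: base non-orientable, total space orientable, $g\ge1$; all $\varepsilon_j=-1$; - $n_3$: base and total space non-orientable, $g\ge2$; $\varepsilon_1=1$ and all other $\varepsilon_j=-1$; - $n_4$: base and total space non-orientable, $g\ge3$; $\varepsilon_1=\varepsilon_2=1$ and all other $\varepsilon_j=-1$. If the base is orientable ($\epsilon=o_1,o_2$), $g'=2g$ and $V=[v_1,v_2]\cdots[v_{2g-1},v_{2g}]$, where $[x,y]=xyx^{-1}y^{-1}$. If the base is non-orientable ($\epsilon=n_1,\ldots,n_4$), $g'=g$ and $V=v_1^2\cdots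 v_g^2$. The fundamental group of the Seifert manifold with these invariants is the group with generators $s_1,\ldots,s_n,v_1,\ldots,v_{g'},h$ and relators $$[s_k,h],\quad s_k^{a_k}h^{b_k}\ (1\le k\le n);\qquad v_jhv_j^{-1}h^{-\varepsilon_j}\ (1\le j\le g');\qquad h^{-e}s_1\cdots s_nV.$$ The following lists of pairs are used: $$F_{OC}=(a_1,b_1),(a_1,-b_1),(a_2,b_2),(a_2,-b_2),\ldots,(a_n,b_n),(a_n,-b_n),$$ $$F_m=(a_1/2,b_1),\ldots,(a_m/2,b_m),(a_{m+1},b_{m+1}),(a_{m+1},b_{m+1}),\ldots,(a_n,b_n),(a_n,b_n)$$ (in $F_m$, each of the first $m$ indices contributes the single pair $(a_k/2,b_k)$ and each index $k>m$ contributes the pair $(a_k,b_k)$ twice; in particular $F_0$ consists of every pair $(a_k,b_k)$ repeated twice).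
   Formalization: In the ordinary cases, if m=0, ε is n_3 or n_4, and φ(v_j)=1 exactly for those j with ε_j=−1, the proved type is ε'=n_1 instead of n_4: h is then central in ker(φ), so the printed n_4 is wrong (for n_3, g=2 it also violates g≥3). *)

theory Defs
  imports "HOL-Algebra.Elementary_Groups"
begin

section \<open>Groups given by generators and relators\<close>

text \<open>A letter \<open>(x, True)\<close> stands for the generator \<open>x\<close>, and \<open>(x, False)\<close> for its inverse.\<close>

type_synonym 'a word = "('a \<times> bool) list"

definition words :: "'a set \<Rightarrow> 'a word set" where
  "words X = lists (X \<times> UNIV)"

inductive pres_eq :: "'a set \<Rightarrow> 'a word set \<Rightarrow> 'a word \<Rightarrow> 'a word \<Rightarrow> bool"
  for X R where
  refl: "w \<in> words X \<Longrightarrow> pres_eq X R w w"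
| sym: "pres_eq X R u v \<Longrightarrow> pres_eq X R v u"
| trans: "pres_eq X R u v \<Longrightarrow> pres_eq X R v w \<Longrightarrow> pres_eq X R u w"
| cancel: "\<lbrakk>u \<in> words X; v \<in> words X; x \<in> X\<rbrakk> \<Longrightarrow>
    pres_eq X R (u @ [(x, b), (x, \<not> b)] @ v) (u @ v)"
| relator: "\<lbrakk>u \<in> words X; v \<in> words X; r \<in> R; r \<in> words X\<rbrakk> \<Longrightarrow>
    pres_eq X R (u @ r @ v) (u @ v)"

definition pres_class :: "'a set \<Rightarrow> 'a word set \<Rightarrow> 'a word \<Rightarrow> 'a word set" where
  "pres_class X R w = {w'. pres_eq X R w w'}"

definition presented_group :: "'a set \<Rightarrow> 'a word set \<Rightarrow> 'a word set monoid" where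
  "presented_group X R =
    \<lparr>carrier = pres_class X R ` words X,
     monoid.mult = (\<lambda>A B. {w. \<exists>u\<in>A. \<exists>v\<in>B. pres_eq X R (u @ v) w}),
     one = pres_class X R []\<rparr>"

definition letter_power :: "'a \<Rightarrow> int \<Rightarrow> 'a word" where
  "letter_power x k = replicate (nat \<bar>k\<bar>) (x, 0 \<le> k)"

definition letter_commutator :: "'a \<Rightarrow> 'a \<Rightarrow> 'a word" where
  "letter_commutator x y = [(x, True), (y, True), (x, False), (y, False)]"


subsection \<open>Basic facts\<close>

lemma words_append [simp]: "u @ v \<in> words X \<longleftrightarrow> u \<in> words X \<and> v \<in> words X"
  by (auto simp: words_def)

lemma words_Nil [simp]: "[] \<in> words X"
  by (simp add: words_def)

lemma words_Cons [simp]: "(x, b) # w \<in> words X \<longleftrightarrow> x \<in> X \<and> w \<in> words X"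
  by (simp add: words_def)

lemma pres_eq_words: "pres_eq X R u v \<Longrightarrow> u \<in> words X \<and> v \<in> words X"
  by (induction rule: pres_eq.induct) auto

lemma pres_eq_context:
  assumes "pres_eq X R u v" "a \<in> words X" "b \<in> words X"
  shows "pres_eq X R (a @ u @ b) (a @ v @ b)"
  using assms
proof (induction rule: pres_eq.induct)
  case (cancel u v x c)
  then show ?case using pres_eq.cancel[of "a @ u" X "v @ b" x R c] by simp
next
  case (relator u v r)
  then show ?case using pres_eq.relator[of "a @ u" X "v @ b" r R] by simp
qed (auto intro: pres_eq.intros)

lemma pres_eq_append:
  assumes "pres_eq X R u u'" "pres_eq X R v v'"
  shows "pres_eq X R (u @ v) (u' @ v')"
proof -
  have "pres_eq X R (u @ v) (u' @ v)"
    using pres_eq_context[OF assms(1), of "[]" v] pres_eq_words[OF assms(2)] by simp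
  moreover have "pres_eq X R (u' @ v) (u' @ v')"
    using pres_eq_context[OF assms(2), of u' "[]"] pres_eq_words[OF assms(1)] by simp
  ultimately show ?thesis by (rule pres_eq.trans)
qed

lemma pres_class_eq_iff:
  assumes "u \<in> words X"
  shows "pres_class X R u = pres_class X R v \<longleftrightarrow> pres_eq X R u v"
  using assms unfolding pres_class_def
  by (auto intro: pres_eq.refl pres_eq.sym pres_eq.trans)

lemma presented_group_mult:
  assumes "u \<in> words X" "v \<in> words X"
  shows "pres_class X R u \<otimes>\<^bsub>presented_group X R\<^esub> pres_class X R v = pres_class X R (u @ v)"
  using assms unfolding presented_group_def pres_class_def
  by (auto intro: pres_eq.refl pres_eq.trans pres_eq_append)

lemma presented_group_left_inverse:
  assumes "w \<in> words X"
  shows "\<exists>w'\<in>words X. pres_eq X R (w' @ w) []"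
  using assms
proof (induction w)
  case Nil
  then show ?case using pres_eq.refl[of "[]" X R] by (intro bexI[of _ "[]"]) auto
next
  case (Cons l w)
  obtain x b where l: "l = (x, b)" by (cases l)
  with Cons obtain w' where w': "w' \<in> words X" "pres_eq X R (w' @ w) []" by auto
  have "pres_eq X R ((w' @ [(x, \<not> b)]) @ l # w) (w' @ w)"
    using pres_eq.cancel[of w' X w x R "\<not> b"] Cons.prems l w' by simp
  with w' have "pres_eq X R ((w' @ [(x, \<not> b)]) @ l # w) []"
    by (blast intro: pres_eq.trans)
  moreover have "w' @ [(x, \<not> b)] \<in> words X" using w' Cons.prems l by simp
  ultimately show ?case by blast
qed

lemma group_presented_group: "group (presented_group X R)"
proof (rule groupI)
  let ?G = "presented_group X R"
  have carr: "carrier ?G = pres_class X R ` words X" and one: "\<one>\<^bsub>?G\<^esub> = pres_class X R []"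
    by (simp_all add: presented_group_def)
  fix x assume x: "x \<in> carrier ?G"
  then obtain u where u: "u \<in> words X" "x = pres_class X R u" by (auto simp: carr)
  show "\<one>\<^bsub>?G\<^esub> \<otimes>\<^bsub>?G\<^esub> x = x"
    using u by (simp add: one presented_group_mult)
  obtain u' where "u' \<in> words X" "pres_eq X R (u' @ u) []"
    using presented_group_left_inverse u(1) by blast
  then show "\<exists>y\<in>carrier ?G. y \<otimes>\<^bsub>?G\<^esub> x = \<one>\<^bsub>?G\<^esub>"
    using u by (auto simp: carr one presented_group_mult pres_class_eq_iff)
  fix y assume "y \<in> carrier ?G"
  then obtain v where v: "v \<in> words X" "y = pres_class X R v" by (auto simp: carr)
  show "x \<otimes>\<^bsub>?G\<^esub> y \<in> carrier ?G"
    using u v by (simp add: carr presented_group_mult)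
  fix z assume "z \<in> carrier ?G"
  then obtain w where w: "w \<in> words X" "z = pres_class X R w" by (auto simp: carr)
  show "x \<otimes>\<^bsub>?G\<^esub> y \<otimes>\<^bsub>?G\<^esub> z = x \<otimes>\<^bsub>?G\<^esub> (y \<otimes>\<^bsub>?G\<^esub> z)"
    using u v w by (simp add: presented_group_mult)
qed (simp add: presented_group_def)


section \<open>Seifert invariants and the associated groups\<close>

datatype seifert_type = O1 | O2 | N1 | N2 | N3 | N4

text \<open>
  All families are indexed from 0: the mathematical \<open>(a\<^sub>k, b\<^sub>k)\<close>, \<open>s\<^sub>k\<close> and \<open>v\<^sub>j\<close> are
  entry \<open>k - 1\<close> of the list of pairs, \<open>Gs (k - 1)\<close> and \<open>Gv (j - 1)\<close>.
\<close>

datatype seifert =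
  Seifert (euler: int) (stype: seifert_type) (genus: nat) (pairs: "(int \<times> int) list")

definition base_orientable :: "seifert_type \<Rightarrow> bool" where
  "base_orientable t \<longleftrightarrow> t = O1 \<or> t = O2"

definition min_genus :: "seifert_type \<Rightarrow> nat" where
  "min_genus t = (case t of O1 \<Rightarrow> 0 | O2 \<Rightarrow> 1 | N1 \<Rightarrow> 1 | N2 \<Rightarrow> 1 | N3 \<Rightarrow> 2 | N4 \<Rightarrow> 3)"

definition seifert_invariants :: "seifert \<Rightarrow> bool" where
  "seifert_invariants N \<longleftrightarrow>
     min_genus (stype N) \<le> genus N \<and> (\<forall>(a, b)\<in>set (pairs N). coprime a b \<and> a \<noteq> 0)"

definition seifert_sign :: "seifert_type \<Rightarrow> nat \<Rightarrow> int" where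
  "seifert_sign t j = (case t of
      O1 \<Rightarrow> 1 | O2 \<Rightarrow> -1 | N1 \<Rightarrow> 1 | N2 \<Rightarrow> -1
    | N3 \<Rightarrow> (if j < 1 then 1 else -1)
    | N4 \<Rightarrow> (if j < 2 then 1 else -1))"

datatype seifert_gen = Gs nat | Gv nat | Gh

definition num_s :: "seifert \<Rightarrow> nat" where
  "num_s N = length (pairs N)"

definition num_v :: "seifert \<Rightarrow> nat" where
  "num_v N = (if base_orientable (stype N) then 2 * genus N else genus N)"

definition surface_word :: "seifert \<Rightarrow> seifert_gen word" where
  "surface_word N =
    (if base_orientable (stype N)
     then concat (map (\<lambda>i. letter_commutator (Gv (2 * i)) (Gv (2 * i + 1))) [0..<genus N])
     else concat (map (\<lambda>j. letter_power (Gv j) 2) [0..<genus N]))"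

definition seifert_gens :: "seifert \<Rightarrow> seifert_gen set" where
  "seifert_gens N = Gs ` {..<num_s N} \<union> Gv ` {..<num_v N} \<union> {Gh}"

definition seifert_rels :: "seifert \<Rightarrow> seifert_gen word set" where
  "seifert_rels N =
     {letter_commutator (Gs k) Gh | k. k < num_s N}
   \<union> {letter_power (Gs k) (fst (pairs N ! k)) @ letter_power Gh (snd (pairs N ! k)) | k. k < num_s N}
   \<union> {[(Gv j, True), (Gh, True), (Gv j, False)] @ letter_power Gh (- seifert_sign (stype N) j) | j.
        j < num_v N}
   \<union> {letter_power Gh (- euler N) @ map (\<lambda>k. (Gs k, True)) [0..<num_s N] @ surface_word N}"

definition seifert_group :: "seifert \<Rightarrow> seifert_gen word set monoid" where
  "seifert_group N = presented_group (seifert_gens N) (seifert_rels N)"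

definition seifert_elem :: "seifert \<Rightarrow> seifert_gen \<Rightarrow> seifert_gen word set" where
  "seifert_elem N x = pres_class (seifert_gens N) (seifert_rels N) [(x, True)]"


section \<open>Invariants of the double covers\<close>

definition F_OC :: "(int \<times> int) list \<Rightarrow> (int \<times> int) list" where
  "F_OC ps = concat (map (\<lambda>(a, b). [(a, b), (a, - b)]) ps)"

definition F_ord :: "nat \<Rightarrow> (int \<times> int) list \<Rightarrow> (int \<times> int) list" where
  "F_ord m ps = map (\<lambda>(a, b). (a div 2, b)) (take m ps) @ concat (map (\<lambda>p. [p, p]) (drop m ps))"

text \<open>
  Here \<open>x j\<close> is the image of \<open>v\<^sub>j\<^sub>+\<^sub>1\<close> in \<open>{0, 1}\<close>, and \<open>m\<close> is the number of \<open>s\<^sub>k\<close> mapped to 1.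
  The divisions by 2 are exact and the subtractions of naturals are not truncated for the values
  that come from an epimorphism onto the group of order 2.

  In the ordinary case the types \<open>N3\<close> and \<open>N4\<close> need care: if \<open>m = 0\<close> and \<open>x\<close> marks exactly
  the \<open>v\<^sub>j\<close> with sign \<open>-1\<close>, then every element of the kernel commutes with \<open>h\<close>, so that all
  signs of the cover are \<open>1\<close> and its type is \<open>N1\<close>, not \<open>N4\<close>.
\<close>

definition cover_type :: "seifert \<Rightarrow> nat \<Rightarrow> (nat \<Rightarrow> int) \<Rightarrow> seifert_type" where
  "cover_type N m x =
    (if stype N = N3 \<or> stype N = N4
     then (if m = 0 \<and> (\<forall>j<num_v N. x j = 1 \<longleftrightarrow> seifert_sign (stype N) j = -1) then N1 else N4)
     else stype N)"

definition double_cover :: "seifert \<Rightarrow> nat \<Rightarrow> (nat \<Rightarrow> int) \<Rightarrow> seifert" where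
  "double_cover N m x =
    (let e = euler N; t = stype N; g = genus N; ps = pairs N;
         all_v = (\<forall>j<num_v N. x j = 1);
         only_v = (\<lambda>J. \<forall>j<num_v N. x j = 1 \<longleftrightarrow> j \<in> J)
     in
       if m = 0 \<and> t = O2 \<and> all_v then Seifert 0 O1 (2 * g - 1) (F_OC ps)
       else if m = 0 \<and> t = N1 \<and> all_v then Seifert 0 O1 (g - 1) (F_OC ps)
       else if m = 0 \<and> (t = N3 \<and> only_v {0} \<or> t = N4 \<and> only_v {0, 1})
         then Seifert 0 N2 (2 * g - 2) (F_OC ps)
       else if m = 0 \<and> t = N2 \<and> all_v then Seifert (2 * e) O1 (g - 1) (F_ord 0 ps)
       else if m = 0 \<and> (t = N3 \<or> t = N4) \<and> all_v then Seifert 0 O2 (g - 1) (F_ord 0 ps)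
       else Seifert
         (if t = O1 \<or> t = N2 then 2 * e else 0)
         (cover_type N m x)
         (if base_orientable t then m div 2 + 2 * g - 1 else m + 2 * g - 2)
         (F_ord m ps))"

end

theory Submission
  imports Defs "HOL-Library.Multiset"
begin

text \<open>
  The fibre generator \<open>h\<close> of a Seifert group spans a normal cyclic subgroup on which every other
  generator acts by a sign. All relators but one concern a single exceptional fibre, crosscap or
  handle; the long relator says that a product of such blocks is trivial. The theorem is a
  classification of these block words, applied to the block word of a double cover.

  Presentations are compared through their solutions: assignments of elements of a group to the
  generators for which the relators hold. By Cayley's theorem it suffices to take values in
  bijections of one sufficiently large type (\<open>eqv_iso\<close>), and two systems of equations with
  word-definable, mutually inverse changes of variables define isomorphic groups.

  The kernel of an epimorphism to the group of order two has the presentation of Reidemeister and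
  Schreier (\<open>kernel_iso\<close>): each generator and each relator has one lift for each of the two
  sheets of the cover, and the lift of one odd generator \<open>t\<close> is trivial. The two lifts of the long
  relator are joined by eliminating one further generator. If \<open>t\<close> is an exceptional generator or
  belongs to a handle, the lifts are then read in the same direction, and if \<open>t\<close> is a crosscap
  generator in opposite directions (\<open>start_pair\<close>, \<open>start_handle_first\<close>, \<open>start_handle_second\<close>,
  \<open>start_cross\<close>). In the joined word the two lifts of a block enclose a subword \<open>c\<close> that commutes
  with \<open>h\<close>. Identities such as \<open>x y c x\<^bsup>-1\<^esup> y\<^bsup>-1\<^esup> = c [c\<^bsup>-1\<^esup> x, y c]\<close> turn them into blocks on both sides
  of \<open>c\<close>, so that one block after the other is absorbed (\<open>has_shape_parallel\<close>,
  \<open>has_shape_opposite\<close>). The result is a block word for the kernel.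

  Blocks may be permuted (\<open>eqv_perm\<close>), so only the multiset of their parameters matters. As in the
  classification of surfaces, handles next to a crosscap dissolve into crosscaps, now with a rule for
  the signs, and fibres slid along orientation-reversing paths change the sign of \<open>b\<close>. This reduces
  the block word of the kernel to the standard word of one of the types \<open>O1\<close>, \<open>O2\<close>, \<open>N1\<close>, \<open>N2\<close>, \<open>N4\<close>. A
  cover of type \<open>N3\<close> cannot occur, because every crosscap sign appears an even number of times.
\<close>

section \<open>Presented groups and their solutions\<close>

text \<open>
  Every group embeds into the bijections of some type, by letting it act on itself. As a type of
  class \<open>group_add\<close> (written additively, but not commutative) these bijections make
  word identities decidable by the simplifier: all calculations with generators below are done
  on solutions of the relators with values in such a type.
\<close>

typedef 'a symgroup = "{f :: 'a \<Rightarrow> 'a. bij f}"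
  by (rule exI[of _ id]) auto

setup_lifting type_definition_symgroup

instantiation symgroup :: (type) group_add
begin
lift_definition zero_symgroup :: "'a symgroup" is "id :: 'a \<Rightarrow> 'a" by simp
lift_definition plus_symgroup :: "'a symgroup \<Rightarrow> 'a symgroup \<Rightarrow> 'a symgroup" is "\<lambda>f g :: 'a \<Rightarrow> 'a. f \<circ> g" by (simp add: bij_comp)
lift_definition uminus_symgroup :: "'a symgroup \<Rightarrow> 'a symgroup" is "\<lambda>f. inv_into UNIV f" by (simp add: bij_imp_bij_inv)
lift_definition minus_symgroup :: "'a symgroup \<Rightarrow> 'a symgroup \<Rightarrow> 'a symgroup" is "\<lambda>f g. f \<circ> inv_into UNIV g"
  by (simp add: bij_comp bij_imp_bij_inv)
instance
  by standard (transfer; auto simp: fun_eq_iff bij_is_inj)+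
end

primrec wval :: "('a \<Rightarrow> 'p::group_add) \<Rightarrow> 'a word \<Rightarrow> 'p" where
  "wval p [] = 0"
| "wval p (l # w) = (if snd l then p (fst l) else - p (fst l)) + wval p w"

lemma wval_append [simp]: "wval p (u @ v) = wval p u + wval p v"
  by (induction u) (auto simp: add.assoc)

lemma wval_cong: "w \<in> words X \<Longrightarrow> (\<And>x. x \<in> X \<Longrightarrow> p x = q x) \<Longrightarrow> wval p w = wval q w"
  by (induction w) (auto simp: words_def)

definition sat :: "'a word set \<Rightarrow> ('a \<Rightarrow> 'p::group_add) \<Rightarrow> bool" where
  "sat R p \<longleftrightarrow> (\<forall>r\<in>R. wval p r = 0)"

lemma pres_eq_wval: "pres_eq X R u v \<Longrightarrow> sat R p \<Longrightarrow> wval p u = wval p v"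
  by (induction rule: pres_eq.induct) (auto simp: sat_def add.assoc[symmetric])

text \<open>
  The left regular representation, transported along \<open>\<iota>\<close> and extended by the
  identity. The freedom in \<open>\<iota>\<close> lets two different groups be embedded into
  bijections of one common type.
\<close>

lemma cayley_embedding:
  fixes H :: "('h, 'z) monoid_scheme" and \<iota> :: "'h \<Rightarrow> 'k"
  assumes "group H" "inj \<iota>"
  obtains \<rho> :: "'h \<Rightarrow> 'k symgroup"
    where "\<And>a b. a \<in> carrier H \<Longrightarrow> b \<in> carrier H \<Longrightarrow> \<rho> (a \<otimes>\<^bsub>H\<^esub> b) = \<rho> a + \<rho> b"
      and "inj_on \<rho> (carrier H)"
proof -
  interpret group H by fact
  define f where "f a k = (if k \<in> \<iota> ` carrier H then \<iota> (a \<otimes>\<^bsub>H\<^esub> inv_into UNIV \<iota> k) else k)" for a k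
  have f1: "f a (\<iota> c) = \<iota> (a \<otimes>\<^bsub>H\<^esub> c)" if "c \<in> carrier H" for a c
    using that by (simp add: f_def inv_f_f[OF assms(2)])
  have f2: "f a k = k" if "k \<notin> \<iota> ` carrier H" for a k
    using that by (simp add: f_def)
  have comp: "f (a \<otimes>\<^bsub>H\<^esub> b) = f a \<circ> f b" if "a \<in> carrier H" "b \<in> carrier H" for a b
  proof
    fix k
    show "f (a \<otimes>\<^bsub>H\<^esub> b) k = (f a \<circ> f b) k"
      using that by (cases "k \<in> \<iota> ` carrier H") (auto simp: f1 f2 m_assoc)
  qed
  have f_one: "f \<one>\<^bsub>H\<^esub> = id"
    by (rule ext) (metis f1 f2 id_apply imageE l_one)
  have bij: "bij (f a)" if a: "a \<in> carrier H" for a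
  proof (rule o_bij)
    show "f (inv\<^bsub>H\<^esub> a) \<circ> f a = id" "f a \<circ> f (inv\<^bsub>H\<^esub> a) = id"
      using a comp[of "inv\<^bsub>H\<^esub> a" a] comp[of a "inv\<^bsub>H\<^esub> a"] f_one by auto
  qed
  define \<rho> where "\<rho> a = Abs_symgroup (f a)" for a
  have rep: "Rep_symgroup (\<rho> a) = f a" if "a \<in> carrier H" for a
    using bij[OF that] by (simp add: \<rho>_def Abs_symgroup_inverse)
  show thesis
  proof (rule that)
    fix a b assume "a \<in> carrier H" "b \<in> carrier H"
    then show "\<rho> (a \<otimes>\<^bsub>H\<^esub> b) = \<rho> a + \<rho> b"
      by (simp add: Rep_symgroup_inject[symmetric] rep plus_symgroup.rep_eq comp)
  next
    show "inj_on \<rho> (carrier H)"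
    proof (rule inj_onI)
      fix a b assume ab: "a \<in> carrier H" "b \<in> carrier H" "\<rho> a = \<rho> b"
      then have "f a = f b" using rep by metis
      then have "f a (\<iota> \<one>\<^bsub>H\<^esub>) = f b (\<iota> \<one>\<^bsub>H\<^esub>)" by simp
      then show "a = b" using ab assms(2) by (simp add: f1 inj_eq)
    qed
  qed
qed

text \<open>
  Two words are equal in the presented group as soon as all solutions of the relators agree on
  them, because the regular representation is a faithful solution.
\<close>

lemma pres_eq_completeness:
  fixes \<iota> :: "'a word set \<Rightarrow> 'k"
  assumes "inj \<iota>" "u \<in> words X" "v \<in> words X" "R \<subseteq> words X"
    and eq: "\<And>p :: 'a \<Rightarrow> 'k symgroup. sat R p \<Longrightarrow> wval p u = wval p v"
  shows "pres_eq X R u v"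
proof -
  let ?G = "presented_group X R"
  interpret G: group ?G by (rule group_presented_group)
  have carr: "carrier ?G = pres_class X R ` words X" and one: "\<one>\<^bsub>?G\<^esub> = pres_class X R []"
    by (simp_all add: presented_group_def)
  obtain \<rho> :: "'a word set \<Rightarrow> 'k symgroup"
    where mult: "\<And>a b. a \<in> carrier ?G \<Longrightarrow> b \<in> carrier ?G \<Longrightarrow> \<rho> (a \<otimes>\<^bsub>?G\<^esub> b) = \<rho> a + \<rho> b"
      and inj: "inj_on \<rho> (carrier ?G)"
    using cayley_embedding[OF group_presented_group assms(1)] by blast
  define c where "c w = \<rho> (pres_class X R w)" for w
  have c_append: "c (w @ w') = c w + c w'" if "w \<in> words X" "w' \<in> words X" for w w'
    using mult[of "pres_class X R w" "pres_class X R w'"] that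
    by (auto simp: c_def carr presented_group_mult)
  have c_Nil: "c [] = 0"
  proof -
    have "c [] + c [] = c [] + 0" using c_append[of "[]" "[]"] by simp
    then show ?thesis by (rule add_left_imp_eq)
  qed
  define p where "p x = c [(x, True)]" for x
  have wval_c: "wval p w = c w" if "w \<in> words X" for w
    using that
  proof (induction w)
    case (Cons l w)
    obtain x b where l: "l = (x, b)" by (cases l)
    have x: "x \<in> X" and w: "w \<in> words X" using Cons.prems l by auto
    have "c [(x, True)] + c [(x, False)] = c ([(x, True)] @ [(x, False)])"
      using x by (subst c_append) auto
    also have "\<dots> = c []"
      using pres_eq.cancel[of "[]" X "[]" x R True] x pres_class_eq_iff[of "[(x, True), (x, False)]" X R "[]"]
      by (simp add: c_def)
    finally have "c [(x, False)] = - p x"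
      by (simp add: c_Nil p_def eq_neg_iff_add_eq_0 minus_unique)
    then have "c [l] = (if b then p x else - p x)" using l p_def by (cases b) auto
    moreover have "c (l # w) = c [l] + c w" using c_append[of "[l]" w] x w l by simp
    ultimately show ?case using Cons.IH w l by simp
  qed (simp add: c_Nil)
  have "sat R p"
    unfolding sat_def
  proof
    fix r assume r: "r \<in> R"
    then have "pres_eq X R r []"
      using pres_eq.relator[of "[]" X "[]" r R] assms(4) by auto
    then have "c r = 0"
      using pres_class_eq_iff[of r X R "[]"] r assms(4) c_Nil by (auto simp: c_def)
    then show "wval p r = 0" using wval_c r assms(4) by auto
  qed
  then have "c u = c v" using eq wval_c assms(2,3) by metis
  then have "pres_class X R u = pres_class X R v"
    using inj assms(2,3) unfolding c_def carr by (auto simp: inj_on_def)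
  then show ?thesis using assms(2) by (simp add: pres_class_eq_iff)
qed

text \<open>
  A rewriting map on words that respects equality in both directions gives an isomorphism. The
  set \<open>C\<close> of admissible words is all words for a change of presentation, and the
  words of even parity for the subgroup of index two.
\<close>

lemma presented_subgroup_iso:
  assumes C: "C \<subseteq> words X" "\<And>u v. u \<in> C \<Longrightarrow> v \<in> C \<Longrightarrow> u @ v \<in> C"
    and h: "h ` C \<subseteq> words Y"
    and eq: "\<And>u v. u \<in> C \<Longrightarrow> v \<in> C \<Longrightarrow> pres_eq Y Q (h u) (h v) \<longleftrightarrow> pres_eq X R u v"
    and hom: "\<And>u v. u \<in> C \<Longrightarrow> v \<in> C \<Longrightarrow> h (u @ v) = h u @ h v"
    and surj: "\<And>z. z \<in> words Y \<Longrightarrow> \<exists>u\<in>C. pres_eq Y Q (h u) z"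
  shows "(presented_group X R)\<lparr>carrier := pres_class X R ` C\<rparr> \<cong> presented_group Y Q"
proof -
  let ?K = "(presented_group X R)\<lparr>carrier := pres_class X R ` C\<rparr>"
  define \<theta> where "\<theta> A = pres_class Y Q (h (SOME u. u \<in> C \<and> A = pres_class X R u))" for A
  have \<theta>: "\<theta> (pres_class X R u) = pres_class Y Q (h u)" if u: "u \<in> C" for u
  proof -
    let ?v = "SOME v. v \<in> C \<and> pres_class X R u = pres_class X R v"
    have v: "?v \<in> C \<and> pres_class X R u = pres_class X R ?v"
      by (rule someI[of _ u]) (use u in auto)
    then have "pres_eq X R u ?v" using u C by (auto simp: pres_class_eq_iff)
    then have "pres_eq Y Q (h u) (h ?v)" using eq u v by auto
    then show ?thesis
      using u h pres_class_eq_iff[of "h u" Y Q "h ?v"] by (auto simp: \<theta>_def)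
  qed
  have "\<theta> \<in> iso ?K (presented_group Y Q)"
  proof (rule isoI)
    show "\<theta> \<in> hom ?K (presented_group Y Q)"
    proof (rule homI)
      fix A assume "A \<in> carrier ?K"
      then show "\<theta> A \<in> carrier (presented_group Y Q)"
        using h by (auto simp: \<theta> presented_group_def)
    next
      fix A B assume "A \<in> carrier ?K" "B \<in> carrier ?K"
      then obtain u v where uv: "u \<in> C" "A = pres_class X R u" "v \<in> C" "B = pres_class X R v"
        by auto
      have "A \<otimes>\<^bsub>?K\<^esub> B = pres_class X R (u @ v)"
        using uv C presented_group_mult[of u X v R] by (auto simp: presented_group_def)
      moreover have "\<theta> A \<otimes>\<^bsub>presented_group Y Q\<^esub> \<theta> B = pres_class Y Q (h (u @ v))"
        using uv h presented_group_mult[of "h u" Y "h v" Q] by (auto simp: \<theta> hom)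
      ultimately show "\<theta> (A \<otimes>\<^bsub>?K\<^esub> B) = \<theta> A \<otimes>\<^bsub>presented_group Y Q\<^esub> \<theta> B"
        using uv C(2) by (simp add: \<theta>)
    qed
    have "inj_on \<theta> (carrier ?K)"
    proof (rule inj_onI)
      fix A B assume "A \<in> carrier ?K" "B \<in> carrier ?K" and e: "\<theta> A = \<theta> B"
      then obtain u v where uv: "u \<in> C" "A = pres_class X R u" "v \<in> C" "B = pres_class X R v"
        by auto
      then have "pres_eq Y Q (h u) (h v)"
        using e h pres_class_eq_iff[of "h u" Y Q "h v"] by (auto simp: \<theta>)
      then show "A = B" using uv eq C pres_class_eq_iff[of u X R v] by auto
    qed
    moreover have "\<theta> ` carrier ?K = carrier (presented_group Y Q)"
    proof
      show "\<theta> ` carrier ?K \<subseteq> carrier (presented_group Y Q)"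
        using h by (auto simp: \<theta> presented_group_def)
      show "carrier (presented_group Y Q) \<subseteq> \<theta> ` carrier ?K"
      proof
        fix Z assume "Z \<in> carrier (presented_group Y Q)"
        then obtain z where z: "z \<in> words Y" "Z = pres_class Y Q z" by (auto simp: presented_group_def)
        obtain u where u: "u \<in> C" "pres_eq Y Q (h u) z" using surj z by blast
        then have "Z = \<theta> (pres_class X R u)"
          using z h pres_class_eq_iff[of "h u" Y Q z] by (auto simp: \<theta>)
        then show "Z \<in> \<theta> ` carrier ?K" using u by auto
      qed
    qed
    ultimately show "bij_betw \<theta> (carrier ?K) (carrier (presented_group Y Q))"
      by (simp add: bij_betw_def)
  qed
  then show ?thesis unfolding is_iso_def by blast
qed

section \<open>Word maps between systems of equations\<close>

text \<open>
  Functions of a solution that are given by one word, uniformly in the solution. They are what a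
  substitution of generators is allowed to use.
\<close>

definition wordfun :: "'a set \<Rightarrow> (('a \<Rightarrow> 'p::group_add) \<Rightarrow> 'p) \<Rightarrow> bool" where
  "wordfun X f \<longleftrightarrow> (\<exists>w\<in>words X. \<forall>p. f p = wval p w)"

lemma wordfun_gen: "x \<in> X \<Longrightarrow> wordfun X (\<lambda>p. p x)"
  unfolding wordfun_def by (rule bexI[of _ "[(x, True)]"]) auto

lemma wordfun_zero: "wordfun X (\<lambda>p. 0)"
  unfolding wordfun_def by (rule bexI[of _ "[]"]) auto

lemma wordfun_add: "wordfun X f \<Longrightarrow> wordfun X g \<Longrightarrow> wordfun X (\<lambda>p. f p + g p)"
  unfolding wordfun_def by (metis wval_append words_append)

definition winv :: "'a word \<Rightarrow> 'a word" where
  "winv w = rev (map (\<lambda>(x, b). (x, \<not> b)) w)"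

lemma wval_winv: "wval p (winv w) = - wval p w"
  by (induction w) (auto simp: winv_def minus_add)

lemma winv_words: "w \<in> words X \<Longrightarrow> winv w \<in> words X"
  by (auto simp: words_def winv_def in_lists_conv_set)

lemma wordfun_minus: "wordfun X f \<Longrightarrow> wordfun X (\<lambda>p. - f p)"
  unfolding wordfun_def by (metis wval_winv winv_words)

lemma wordfun_diff: "wordfun X f \<Longrightarrow> wordfun X g \<Longrightarrow> wordfun X (\<lambda>p. f p - g p)"
  using wordfun_add[OF _ wordfun_minus, of X f g] by simp

lemma words_mono: "X \<subseteq> Y \<Longrightarrow> words X \<subseteq> words Y"
  unfolding words_def by (rule lists_mono) auto

lemma wordfun_mono: "wordfun X f \<Longrightarrow> X \<subseteq> Y \<Longrightarrow> wordfun Y f"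
  unfolding wordfun_def by (meson subsetD words_mono)

lemma wordfun_if: "wordfun X f \<Longrightarrow> wordfun X g \<Longrightarrow> wordfun X (\<lambda>p. if b then f p else g p)"
  by (cases b) auto

lemmas wordfun_intros = wordfun_gen wordfun_zero wordfun_add wordfun_minus wordfun_diff wordfun_if

lemma wordfun_cong: "wordfun X f \<Longrightarrow> (\<And>x. x \<in> X \<Longrightarrow> p x = q x) \<Longrightarrow> f p = f q"
  unfolding wordfun_def using wval_cong[of _ X p q] by auto

lemma wordfun_wval: 
  assumes "w \<in> words Y" "\<And>y. y \<in> Y \<Longrightarrow> wordfun X (\<lambda>p. f p y)"
  shows "wordfun X (\<lambda>p. wval (f p) w)"
  using assms(1)
proof (induction w)
  case Nil
  show ?case by (simp add: wordfun_zero)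
next
  case (Cons l w)
  then have "wordfun X (\<lambda>p. f p (fst l))" "wordfun X (\<lambda>p. wval (f p) w)"
    using assms(2) by (cases l; simp)+
  then show ?case
    unfolding wval.simps by (intro wordfun_add wordfun_if wordfun_minus)
qed

lemma wordfun_comp:
  assumes "wordfun Y g" "\<And>y. y \<in> Y \<Longrightarrow> wordfun X (\<lambda>p. f p y)"
  shows "wordfun X (\<lambda>p. g (f p))"
proof -
  obtain w where w: "w \<in> words Y" "\<forall>p. g p = wval p w" using assms(1) wordfun_def by blast
  show ?thesis using wordfun_wval[OF w(1) assms(2)] w(2) by simp
qed

text \<open>
  Two systems of equations are equivalent if word substitutions map solutions to solutions and
  are inverse to each other. For presentations this is a Tietze equivalence, but stated on
  solutions it composes without any handling of relators, and the systems in between need not be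
  sets of words.
\<close>

definition eqv :: "'a set \<Rightarrow> (('a \<Rightarrow> 'p::group_add) \<Rightarrow> bool) \<Rightarrow> 'b set \<Rightarrow> (('b \<Rightarrow> 'p) \<Rightarrow> bool) \<Rightarrow> bool" where
  "eqv X S Y T \<longleftrightarrow> (\<exists>f g.
     (\<forall>y\<in>Y. wordfun X (\<lambda>p. f p y)) \<and> (\<forall>x\<in>X. wordfun Y (\<lambda>q. g q x)) \<and>
     (\<forall>p. S p \<longrightarrow> T (f p) \<and> (\<forall>x\<in>X. g (f p) x = p x)) \<and>
     (\<forall>q. T q \<longrightarrow> S (g q) \<and> (\<forall>y\<in>Y. f (g q) y = q y)))"

lemma eqvI:
  assumes "\<And>y. y \<in> Y \<Longrightarrow> wordfun X (\<lambda>p. f p y)" "\<And>x. x \<in> X \<Longrightarrow> wordfun Y (\<lambda>q. g q x)"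
    and "\<And>p. S p \<Longrightarrow> T (f p)" "\<And>p x. S p \<Longrightarrow> x \<in> X \<Longrightarrow> g (f p) x = p x"
    and "\<And>q. T q \<Longrightarrow> S (g q)" "\<And>q y. T q \<Longrightarrow> y \<in> Y \<Longrightarrow> f (g q) y = q y"
  shows "eqv X S Y T"
  unfolding eqv_def using assms by (intro exI[of _ f] exI[of _ g]) auto

lemma eqvE:
  assumes "eqv X S Y T"
  obtains f g where "\<forall>y\<in>Y. wordfun X (\<lambda>p. f p y)" "\<forall>x\<in>X. wordfun Y (\<lambda>q. g q x)"
    "\<forall>p. S p \<longrightarrow> T (f p)" "\<forall>p. S p \<longrightarrow> (\<forall>x\<in>X. g (f p) x = p x)"
    "\<forall>q. T q \<longrightarrow> S (g q)" "\<forall>q. T q \<longrightarrow> (\<forall>y\<in>Y. f (g q) y = q y)"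
proof -
  from assms obtain f g where
    fg: "\<forall>y\<in>Y. wordfun X (\<lambda>p. f p y)" "\<forall>x\<in>X. wordfun Y (\<lambda>q. g q x)"
     "\<forall>p. S p \<longrightarrow> T (f p) \<and> (\<forall>x\<in>X. g (f p) x = p x)"
     "\<forall>q. T q \<longrightarrow> S (g q) \<and> (\<forall>y\<in>Y. f (g q) y = q y)"
    unfolding eqv_def by (elim exE conjE)
  show thesis by (rule that[of f g]) (use fg in simp_all)
qed

lemma eqv_refl: "eqv X S X S"
  by (rule eqvI[where f = "\<lambda>p. p" and g = "\<lambda>p. p"]) (auto intro: wordfun_gen)

lemma eqv_trans:
  assumes "eqv X S Y T" "eqv Y T Z U"
  shows "eqv X S Z U"
proof -
  from assms(1) obtain f g where 1: "\<forall>y\<in>Y. wordfun X (\<lambda>p. f p y)" "\<forall>x\<in>X. wordfun Y (\<lambda>q. g q x)"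
    "\<forall>p. S p \<longrightarrow> T (f p)" "\<forall>p. S p \<longrightarrow> (\<forall>x\<in>X. g (f p) x = p x)"
    "\<forall>q. T q \<longrightarrow> S (g q)" "\<forall>q. T q \<longrightarrow> (\<forall>y\<in>Y. f (g q) y = q y)"
    by (rule eqvE)
  note f = 1(1)[rule_format] and g = 1(2)[rule_format] and fT = 1(3)[rule_format]
    and gf = 1(4)[rule_format] and gS = 1(5)[rule_format] and fg = 1(6)[rule_format]
  from assms(2) obtain f' g' where 2: "\<forall>z\<in>Z. wordfun Y (\<lambda>p. f' p z)" "\<forall>y\<in>Y. wordfun Z (\<lambda>q. g' q y)"
    "\<forall>p. T p \<longrightarrow> U (f' p)" "\<forall>p. T p \<longrightarrow> (\<forall>y\<in>Y. g' (f' p) y = p y)"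
    "\<forall>q. U q \<longrightarrow> T (g' q)" "\<forall>q. U q \<longrightarrow> (\<forall>z\<in>Z. f' (g' q) z = q z)"
    by (rule eqvE)
  note f' = 2(1)[rule_format] and g' = 2(2)[rule_format] and f'U = 2(3)[rule_format]
    and gf' = 2(4)[rule_format] and gT = 2(5)[rule_format] and fg' = 2(6)[rule_format]
  show ?thesis
  proof (rule eqvI[where f = "\<lambda>p. f' (f p)" and g = "\<lambda>q. g (g' q)"])
    show "wordfun X (\<lambda>p. f' (f p) y)" if "y \<in> Z" for y
      by (rule wordfun_comp[OF f'[OF that]]) (rule f)
    show "wordfun Z (\<lambda>p. g (g' p) y)" if "y \<in> X" for y
      by (rule wordfun_comp[OF g[OF that]]) (rule g')
    show "U (f' (f p))" if "S p" for p using f'U[OF fT[OF that]] .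
    show "S (g (g' p))" if "U p" for p using gS[OF gT[OF that]] .
    show "g (g' (f' (f p))) x = p x" if "S p" "x \<in> X" for p x
    proof -
      have "g (g' (f' (f p))) x = g (f p) x"
        by (rule wordfun_cong[OF g[OF that(2)]]) (rule gf'[OF fT[OF that(1)]])
      then show ?thesis using gf[OF that] by simp
    qed
    show "f' (f (g (g' q))) x = q x" if "U q" "x \<in> Z" for q x
    proof -
      have "f' (f (g (g' q))) x = f' (g' q) x"
        by (rule wordfun_cong[OF f'[OF that(2)]]) (rule fg[OF gT[OF that(1)]])
      then show ?thesis using fg'[OF that] by simp
    qed
  qed
qed

lemma eqv_cong: "(\<And>p. S p \<longleftrightarrow> T p) \<Longrightarrow> eqv X S X T"
  by (rule eqvI[where f = "\<lambda>p. p" and g = "\<lambda>p. p"]) (auto intro: wordfun_gen)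

primrec wsubst :: "('a \<Rightarrow> 'b word) \<Rightarrow> 'a word \<Rightarrow> 'b word" where
  "wsubst F [] = []"
| "wsubst F (l # w) = (if snd l then F (fst l) else winv (F (fst l))) @ wsubst F w"

lemma wsubst_append [simp]: "wsubst F (u @ v) = wsubst F u @ wsubst F v"
  by (induction u) auto

lemma wval_wsubst: "wval p (wsubst F w) = wval (\<lambda>x. wval p (F x)) w"
  by (induction w) (auto simp: wval_winv)

lemma wsubst_words: "w \<in> words X \<Longrightarrow> (\<And>x. x \<in> X \<Longrightarrow> F x \<in> words Y) \<Longrightarrow> wsubst F w \<in> words Y"
proof (induction w)
  case (Cons l w)
  then show ?case by (cases l) (auto simp: winv_words)
qed simp

text \<open>
  The target type of the solutions is large enough for regular representations of both groups,
  which is why equivalence over this one type suffices for an isomorphism.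
\<close>

lemma eqv_iso:
  fixes R :: "'a word set" and Q :: "'b word set"
  assumes RX: "R \<subseteq> words X" and QY: "Q \<subseteq> words Y"
    and e: "eqv X (sat R :: ('a \<Rightarrow> ('a word set + 'b word set) symgroup) \<Rightarrow> bool) Y (sat Q)"
  shows "presented_group X R \<cong> presented_group Y Q"
proof -
  from e obtain f g where "\<forall>y\<in>Y. wordfun X (\<lambda>p. f p y)" "\<forall>x\<in>X. wordfun Y (\<lambda>q. g q x)"
     "\<forall>p :: 'a \<Rightarrow> ('a word set + 'b word set) symgroup. sat R p \<longrightarrow> sat Q (f p)"
     "\<forall>p. sat R p \<longrightarrow> (\<forall>x\<in>X. g (f p) x = p x)"
     "\<forall>q. sat Q q \<longrightarrow> sat R (g q)" "\<forall>q. sat Q q \<longrightarrow> (\<forall>y\<in>Y. f (g q) y = q y)"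
    by (rule eqvE)
  note fg = this[rule_format]
  define G where "G x = (SOME w. w \<in> words Y \<and> (\<forall>q. g q x = wval q w))" for x
  have G: "G x \<in> words Y \<and> (\<forall>q. g q x = wval q (G x))" if "x \<in> X" for x
    unfolding G_def by (rule someI_ex) (use fg(2)[OF that] in \<open>auto simp: wordfun_def\<close>)
  define F where "F y = (SOME w. w \<in> words X \<and> (\<forall>p. f p y = wval p w))" for y
  have F: "F y \<in> words X \<and> (\<forall>p. f p y = wval p (F y))" if "y \<in> Y" for y
    unfolding F_def by (rule someI_ex) (use fg(1)[OF that] in \<open>auto simp: wordfun_def\<close>)
  have Gw: "wval q (wsubst G w) = wval (g q) w" if "w \<in> words X" for q w
    unfolding wval_wsubst by (rule wval_cong[OF that]) (simp add: G)
  have Fw: "wval p (wsubst F w) = wval (f p) w" if "w \<in> words Y" for p w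
    unfolding wval_wsubst by (rule wval_cong[OF that]) (simp add: F)
  have Gwords: "wsubst G w \<in> words Y" if "w \<in> words X" for w
    by (rule wsubst_words[OF that]) (simp add: G)
  have Fwords: "wsubst F w \<in> words X" if "w \<in> words Y" for w
    by (rule wsubst_words[OF that]) (simp add: F)
  have "(presented_group X R)\<lparr>carrier := pres_class X R ` words X\<rparr> \<cong> presented_group Y Q"
  proof (rule presented_subgroup_iso[where h = "wsubst G"])
    show "wsubst G ` words X \<subseteq> words Y" using Gwords by auto
    fix u v assume uv: "u \<in> words X" "v \<in> words X"
    show "pres_eq Y Q (wsubst G u) (wsubst G v) \<longleftrightarrow> pres_eq X R u v"
    proof
      assume a: "pres_eq X R u v"
      show "pres_eq Y Q (wsubst G u) (wsubst G v)"
      proof (rule pres_eq_completeness[where \<iota> = "Inr :: 'b word set \<Rightarrow> 'a word set + 'b word set"])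
        fix q :: "'b \<Rightarrow> ('a word set + 'b word set) symgroup" assume "sat Q q"
        then show "wval q (wsubst G u) = wval q (wsubst G v)"
          using pres_eq_wval[OF a, of "g q"] fg(5)[of q] uv by (simp add: Gw)
      qed (use uv Gwords QY in auto)
    next
      assume a: "pres_eq Y Q (wsubst G u) (wsubst G v)"
      show "pres_eq X R u v"
      proof (rule pres_eq_completeness[where \<iota> = "Inl :: 'a word set \<Rightarrow> 'a word set + 'b word set"])
        fix p :: "'a \<Rightarrow> ('a word set + 'b word set) symgroup" assume p: "sat R p"
        then have "wval (g (f p)) u = wval (g (f p)) v"
          using pres_eq_wval[OF a, of "f p"] fg(3)[of p] uv by (simp add: Gw)
        moreover have "wval (g (f p)) w = wval p w" if "w \<in> words X" for w
          by (rule wval_cong[OF that]) (use fg(4) p in auto)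
        ultimately show "wval p u = wval p v" using uv by auto
      qed (use uv RX in auto)
    qed
  next
    fix z assume z: "z \<in> words Y"
    have "pres_eq Y Q (wsubst G (wsubst F z)) z"
    proof (rule pres_eq_completeness[where \<iota> = "Inr :: 'b word set \<Rightarrow> 'a word set + 'b word set"])
      fix q :: "'b \<Rightarrow> ('a word set + 'b word set) symgroup" assume q: "sat Q q"
      have "wval q (wsubst G (wsubst F z)) = wval (f (g q)) z"
        using z by (simp add: Gw Fw Fwords)
      also have "\<dots> = wval q z" by (rule wval_cong[OF z]) (use fg(6) q in auto)
      finally show "wval q (wsubst G (wsubst F z)) = wval q z" .
    qed (use z Gwords Fwords QY in auto)
    then show "\<exists>u\<in>words X. pres_eq Y Q (wsubst G u) z" using Fwords z by blast
  qed auto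
  moreover have "(presented_group X R)\<lparr>carrier := pres_class X R ` words X\<rparr> = presented_group X R"
    by (simp add: presented_group_def)
  ultimately show ?thesis by simp
qed

section \<open>Generators and relators for a subgroup of index two\<close>

primrec odd_word :: "('a \<Rightarrow> bool) \<Rightarrow> 'a word \<Rightarrow> bool" where
  "odd_word f [] \<longleftrightarrow> False"
| "odd_word f (l # w) \<longleftrightarrow> f (fst l) \<noteq> odd_word f w"

text \<open>
  A word is read while walking between the two cosets of the even subgroup, the sheets of the
  double cover: \<open>i\<close> is the current sheet and a letter \<open>x\<close> with
  \<open>f x\<close> changes it. The generator \<open>(x, i)\<close> stands for \<open>t\<^sup>i
  x t\<^bsup>-j\<^esup>\<close>, where \<open>j\<close> is the sheet reached by \<open>x\<close>
  from \<open>i\<close> and \<open>t\<close> is a fixed odd generator; hence \<open>(t,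
  False)\<close> is trivial.
\<close>

primrec lift_word :: "('a \<Rightarrow> bool) \<Rightarrow> bool \<Rightarrow> 'a word \<Rightarrow> ('a \<times> bool) word" where
  "lift_word f i [] = []"
| "lift_word f i (l # w) =
    ((fst l, if snd l then i else i \<noteq> f (fst l)), snd l) # lift_word f (i \<noteq> f (fst l)) w"

definition lift_rels :: "('a \<Rightarrow> bool) \<Rightarrow> 'a \<Rightarrow> 'a word set \<Rightarrow> ('a \<times> bool) word set" where
  "lift_rels f t R = {lift_word f i r | i r. r \<in> R} \<union> {[((t, False), True)]}"

lemma odd_word_append [simp]: "odd_word f (u @ v) \<longleftrightarrow> odd_word f u \<noteq> odd_word f v"
  by (induction u) auto

lemma lift_word_append [simp]: "lift_word f i (u @ v) = lift_word f i u @ lift_word f (i \<noteq> odd_word f u) v"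
proof (induction u arbitrary: i)
  case (Cons l u)
  have "(i \<noteq> f (fst l)) \<noteq> odd_word f u \<longleftrightarrow> i \<noteq> (f (fst l) \<noteq> odd_word f u)" by auto
  then show ?case using Cons by simp
qed simp

lemma lift_word_words [simp]: "lift_word f i w \<in> words (X \<times> UNIV) \<longleftrightarrow> w \<in> words X"
  by (induction w arbitrary: i) (auto simp: words_def)

lemma pres_eq_lift:
  assumes "pres_eq X R u v" "\<And>r. r \<in> R \<Longrightarrow> \<not> odd_word f r"
  shows "odd_word f u = odd_word f v \<and> pres_eq (X \<times> UNIV) (lift_rels f t R) (lift_word f i u) (lift_word f i v)"
  using assms(1)
proof (induction arbitrary: i rule: pres_eq.induct)
  case (trans u v w)
  then show ?case by (metis pres_eq.trans)
next
  case (cancel u v x b)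
  let ?j = "i \<noteq> odd_word f u"
  have "(?j \<noteq> f x) \<noteq> f x \<longleftrightarrow> ?j" by auto
  then show ?case
    using cancel pres_eq.cancel[of "lift_word f i u" "X \<times> UNIV" "lift_word f ?j v" "(x, if b then ?j else ?j \<noteq> f x)" "lift_rels f t R" b]
    by (cases b) auto
next
  case (relator u v r)
  let ?j = "i \<noteq> odd_word f u"
  have "lift_word f ?j r \<in> lift_rels f t R" using relator by (auto simp: lift_rels_def)
  then show ?case
    using relator assms(2)[of r] pres_eq.relator[of "lift_word f i u" "X \<times> UNIV" "lift_word f ?j v" "lift_word f ?j r" "lift_rels f t R"]
    by auto
qed (auto intro: pres_eq.intros)

lemma wval_lift_word:
  assumes "\<And>x i. q (x, i) = (if i then c else 0) + p x - (if i \<noteq> f x then c else 0)"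
  shows "wval q (lift_word f i w) = (if i then c else 0) + wval p w - (if i \<noteq> odd_word f w then c else (0::'p::group_add))"
proof (induction w arbitrary: i)
  case Nil
  then show ?case by simp
next
  case (Cons l w)
  show ?case
    by (auto simp: Cons assms add.assoc minus_add diff_conv_add_uminus simp del: add_uminus_conv_diff)
qed

text \<open>
  The Reidemeister-Schreier presentation for the transversal \<open>{1, t}\<close>. Reading a
  word on sheet 0 respects the relators; sending \<open>(x, i)\<close> to \<open>t\<^sup>i x
  t\<^bsup>-j\<^esup>\<close> recovers the word, so nothing is lost.
\<close>

lemma even_words_iso:
  fixes R :: "'a word set"
  assumes RX: "R \<subseteq> words X" and even: "\<And>r. r \<in> R \<Longrightarrow> \<not> odd_word f r"
    and t: "t \<in> X" "f t"
  shows "(presented_group X R)\<lparr>carrier := pres_class X R ` {w \<in> words X. \<not> odd_word f w}\<rparr>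
    \<cong> presented_group (X \<times> UNIV) (lift_rels f t R)"
proof (rule presented_subgroup_iso[where h = "lift_word f False"])
  let ?Q = "lift_rels f t R"
  have QY: "?Q \<subseteq> words (X \<times> UNIV)" using RX t by (auto simp: lift_rels_def)
  fix u v assume uv: "u \<in> {w \<in> words X. \<not> odd_word f w}" "v \<in> {w \<in> words X. \<not> odd_word f w}"
  show "pres_eq (X \<times> UNIV) ?Q (lift_word f False u) (lift_word f False v) \<longleftrightarrow> pres_eq X R u v"
  proof
    assume "pres_eq X R u v"
    then show "pres_eq (X \<times> UNIV) ?Q (lift_word f False u) (lift_word f False v)"
      using pres_eq_lift even by metis
  next
    assume a: "pres_eq (X \<times> UNIV) ?Q (lift_word f False u) (lift_word f False v)"
    show "pres_eq X R u v"
    proof (rule pres_eq_completeness[where \<iota> = "\<lambda>A. A"])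
      fix p :: "'a \<Rightarrow> 'a word set symgroup" assume p: "sat R p"
      define q where "q = (\<lambda>(x, i). (if i then p t else 0) + p x - (if i \<noteq> f x then p t else 0))"
      have qx: "q (x, i) = (if i then p t else 0) + p x - (if i \<noteq> f x then p t else 0)" for x i
        by (simp add: q_def)
      note lw = wval_lift_word[where q = q and p = p and c = "p t" and f = f, OF qx]
      have "sat ?Q q"
        unfolding sat_def lift_rels_def using p even t(2)
        by (auto simp: lw sat_def) (auto simp: qx)
      then have "wval q (lift_word f False u) = wval q (lift_word f False v)"
        using pres_eq_wval[OF a] by blast
      then show "wval p u = wval p v" using uv by (simp add: lw)
    qed (use uv RX in auto)
  qed
  show "lift_word f False (u @ v) = lift_word f False u @ lift_word f False v" using uv by simp
next
  let ?Q = "lift_rels f t R"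
  have QY: "?Q \<subseteq> words (X \<times> UNIV)" using RX t by (auto simp: lift_rels_def)
  fix z :: "('a \<times> bool) word"
  assume "z \<in> words (X \<times> UNIV)"
  then show "\<exists>u\<in>{w \<in> words X. \<not> odd_word f w}. pres_eq (X \<times> UNIV) ?Q (lift_word f False u) z"
  proof (induction z)
    case Nil
    show ?case by (rule bexI[of _ "[]"]) (auto intro: pres_eq.refl)
  next
    case (Cons l z)
    obtain x i b where l: "l = ((x, i), b)" by (cases l) auto
    have x: "x \<in> X" and z: "z \<in> words (X \<times> UNIV)" using Cons.prems l by auto
    obtain u where u: "u \<in> {w \<in> words X. \<not> odd_word f w}" "pres_eq (X \<times> UNIV) ?Q (lift_word f False u) z"
      using Cons.IH z by blast
    define c where "c j d = (if j then [(t, d)] else [])" for j d :: bool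
    define w where "w = (if b then c i True @ [(x, True)] @ c (i \<noteq> f x) False
      else c (i \<noteq> f x) True @ [(x, False)] @ c i False)"
    have w: "w \<in> words X" "\<not> odd_word f w" using x t by (auto simp: w_def c_def)
    have "pres_eq (X \<times> UNIV) ?Q (lift_word f False w) [l]"
    proof (rule pres_eq_completeness[where \<iota> = "\<lambda>A. A"])
      fix q :: "'a \<times> bool \<Rightarrow> ('a \<times> bool) word set symgroup" assume "sat ?Q q"
      then have "q (t, False) = 0" by (auto simp: sat_def lift_rels_def)
      then show "wval q (lift_word f False w) = wval q [l]"
        using t(2) by (auto simp: w_def c_def l)
    qed (use w x l QY in auto)
    then have "pres_eq (X \<times> UNIV) ?Q (lift_word f False (w @ u)) (l # z)"
      using pres_eq_append[of _ _ _ "[l]" "lift_word f False u" z] u(2) w by fastforce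
    then show ?case using w u(1) by (intro bexI[of _ "w @ u"]) auto
  qed
qed auto

text \<open>
  A homomorphism to the group of order two counts odd letters.
\<close>

lemma hom_odd_word:
  fixes R :: "'a word set" and \<phi> :: "'a word set \<Rightarrow> int"
  assumes \<phi>: "\<phi> \<in> hom (presented_group X R) (integer_mod_group 2)" and w: "w \<in> words X"
  shows "\<phi> (pres_class X R w) = (if odd_word (\<lambda>x. \<phi> (pres_class X R [(x, True)]) = 1) w then 1 else 0)"
proof -
  let ?G = "presented_group X R"
  let ?f = "\<lambda>x. \<phi> (pres_class X R [(x, True)]) = 1"
  have carr: "carrier ?G = pres_class X R ` words X"
    by (simp add: presented_group_def)
  define c where "c w = \<phi> (pres_class X R w)" for w
  have range: "c w \<in> {0, 1}" if "w \<in> words X" for w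
    using \<phi> that by (auto simp: hom_def carr c_def Pi_iff carrier_integer_mod_group split: if_splits)
  have app: "c (u @ v) = (c u + c v) mod 2" if "u \<in> words X" "v \<in> words X" for u v
    using hom_mult[OF \<phi>, of "pres_class X R u" "pres_class X R v"] that
    by (simp add: presented_group_mult carr c_def)
  have c_Nil: "c [] = 0" using app[of "[]" "[]"] range[of "[]"] by auto
  have "c w = (if odd_word ?f w then 1 else 0)"
    using w
  proof (induction w)
    case (Cons l w)
    obtain x b where l: "l = (x, b)" by (cases l)
    have x: "x \<in> X" and w: "w \<in> words X" using Cons.prems l by auto
    have "c [(x, True)] = (if ?f x then 1 else 0)" 
      using range[of "[(x, True)]"] x by (auto simp: c_def)
    moreover have "c ([(x, True)] @ [(x, False)]) = c []"
      using pres_eq.cancel[of "[]" X "[]" x R True] x pres_class_eq_iff[of "[(x, True), (x, False)]" X R "[]"]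
      by (simp add: c_def)
    then have "c [(x, False)] = c [(x, True)]" 
      using app[of "[(x, True)]" "[(x, False)]"] x range[of "[(x, True)]"] range[of "[(x, False)]"] c_Nil by auto
    ultimately have "c [l] = (if ?f x then 1 else 0)" using l by (cases b) auto
    then show ?case using app[of "[l]" w] Cons.IH w x l by auto
  qed (simp add: c_Nil)
  then show ?thesis by (simp add: c_def)
qed

lemma kernel_iso:
  fixes R :: "'a word set" and \<phi> :: "'a word set \<Rightarrow> int"
  assumes RX: "R \<subseteq> words X"
    and \<phi>: "\<phi> \<in> hom (presented_group X R) (integer_mod_group 2)"
    and t: "t \<in> X" "\<phi> (pres_class X R [(t, True)]) = 1"
  defines "f \<equiv> \<lambda>x. \<phi> (pres_class X R [(x, True)]) = 1"
  shows "(\<forall>r\<in>R. \<not> odd_word f r) \<and>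
    (presented_group X R)\<lparr>carrier := kernel (presented_group X R) (integer_mod_group 2) \<phi>\<rparr>
      \<cong> presented_group (X \<times> UNIV) (lift_rels f t R)"
proof -
  note odd = hom_odd_word[OF \<phi>, folded f_def]
  have even: "\<not> odd_word f r" if r: "r \<in> R" for r
  proof -
    have "pres_eq X R r []" using pres_eq.relator[of "[]" X "[]" r R] RX r by auto
    then have "pres_class X R r = pres_class X R []" using pres_class_eq_iff[of r X R "[]"] r RX by auto
    then show ?thesis using odd[of r] odd[of "[]"] r RX by (auto split: if_splits)
  qed
  have "kernel (presented_group X R) (integer_mod_group 2) \<phi> = pres_class X R ` {w \<in> words X. \<not> odd_word f w}"
    using odd by (auto simp: kernel_def presented_group_def image_iff split: if_splits)
  moreover have "f t" using t(2) by (simp add: f_def)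
  ultimately show ?thesis using even_words_iso[OF RX even t(1)] even by auto
qed

section \<open>Integer multiples and sign actions\<close>

definition zmul :: "int \<Rightarrow> 'p::group_add \<Rightarrow> 'p" where
  "zmul k x = (if 0 \<le> k then ((+) x ^^ nat k) 0 else ((+) (- x) ^^ nat (- k)) 0)"

lemmas group_norm = add.assoc minus_add diff_conv_add_uminus

lemma zmul_0 [simp]: "zmul 0 x = 0" by (simp add: zmul_def)

lemma zmul_succ: "zmul (k + 1) x = x + zmul k x"
proof (cases "0 \<le> k")
  case True
  then have "nat (k + 1) = Suc (nat k)" by simp
  then show ?thesis using True by (simp add: zmul_def)
next
  case False
  define m where "m = nat (- k - 1)"
  have "nat (- k) = Suc m" "nat (- (k + 1)) = m" using False by (auto simp: m_def)
  then show ?thesis using False by (cases "k = -1") (auto simp: zmul_def add.assoc[symmetric] m_def)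
qed

lemma zmul_pred: "zmul (k - 1) x = - x + zmul k x"
  using zmul_succ[of "k - 1" x] by (simp add: add.assoc[symmetric])

lemma zmul_1 [simp]: "zmul 1 x = x"
  using zmul_succ[of 0 x] by simp

lemma zmul_add: "zmul (j + k) (x :: 'p::group_add) = zmul j x + zmul k x"
proof (induction j rule: int_induct[where k = 0])
  case (step1 i)
  have "i + 1 + k = (i + k) + 1" by simp
  then show ?case using step1 by (simp only: zmul_succ add.assoc[where 'a = 'p])
next
  case (step2 i)
  have "i - 1 + k = (i + k) - 1" by simp
  then show ?case using step2 by (simp only: zmul_pred add.assoc[where 'a = 'p])
qed simp

lemma zmul_minus [simp]: "zmul (- k) x = - zmul k x"
  using zmul_add[of k "- k" x] by (simp add: minus_unique)

lemma zmul_uminus [simp]: "zmul k (- x) = - zmul k x"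
proof (induction k rule: int_induct[where k = 0])
  case (step1 i)
  then show ?case using zmul_add[of i 1 x] by (simp only: zmul_succ minus_add zmul_1)
next
  case (step2 i)
  have "zmul (i - 1) x = zmul i x + - x"
    using zmul_add[of i "- 1" x] zmul_minus[of 1 x] by simp
  then have "- zmul (i - 1) x = x + - zmul i x" by (simp only: minus_add minus_minus)
  then show ?case using step2 by (simp only: zmul_pred minus_minus)
qed simp

lemma zmul_conj: "zmul k (a + x - a) = a + zmul k x - (a :: 'p::group_add)"
proof (induction k rule: int_induct[where k = 0])
  case (step1 i)
  then show ?case unfolding zmul_succ step1 by (simp add: group_norm del: add_uminus_conv_diff)
next
  case (step2 i)
  then show ?case unfolding zmul_pred step2 by (simp add: group_norm del: add_uminus_conv_diff)
qed simp

lemma zmul_double: "zmul (2 * k) (x :: 'p::group_add) = zmul k (x + x)"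
proof (induction k rule: int_induct[where k = 0])
  case (step1 i)
  have "2 * (i + 1) = 2 * i + 1 + 1" by simp
  then show ?case using step1 by (simp only: zmul_succ add.assoc[where 'a = 'p])
next
  case (step2 i)
  have "2 * (i - 1) = 2 * i - 1 - 1" by simp
  then show ?case using step2 by (simp only: zmul_pred add.assoc[where 'a = 'p] minus_add)
qed simp

lemma wval_letter_power [simp]: "wval p (letter_power x k) = zmul k (p x)"
proof (cases "0 \<le> k")
  case True
  have "wval p (replicate n (x, True)) = ((+) (p x) ^^ n) 0" for n
    by (induction n) auto
  then show ?thesis using True by (simp add: letter_power_def zmul_def)
next
  case False
  have "wval p (replicate n (x, False)) = ((+) (- p x) ^^ n) 0" for n
    by (induction n) auto
  then show ?thesis using False by (simp add: letter_power_def zmul_def)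
qed

lemma wordfun_zmul: "wordfun X f \<Longrightarrow> wordfun X (\<lambda>p. zmul k (f p))"
proof (induction k rule: int_induct[where k = 0])
  case (step1 i)
  then show ?case unfolding zmul_succ by (intro wordfun_intros)
next
  case (step2 i)
  then show ?case unfolding zmul_pred by (intro wordfun_intros)
qed (simp add: wordfun_zero)

definition flip :: "bool \<Rightarrow> 'p::group_add \<Rightarrow> 'p" where
  "flip \<sigma> h = (if \<sigma> then h else - h)"

text \<open>
  The generator \<open>h\<close> spans a normal cyclic subgroup on which each element acts by a
  sign; \<open>True\<close> stands for the sign 1. Products of signs are equivalences of truth
  values.
\<close>

definition acts :: "'p::group_add \<Rightarrow> bool \<Rightarrow> 'p \<Rightarrow> bool" where
  "acts h \<sigma> g \<longleftrightarrow> g + h - g = flip \<sigma> h"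

lemma flip_simps [simp]: "flip True h = h" "flip False h = - h"
  by (simp_all add: flip_def)


lemma acts_0 [simp]: "acts h True 0" by (simp add: acts_def)
lemma acts_self [simp]: "acts h True h" by (simp add: acts_def)

lemma acts_uminus [simp]: "acts h \<sigma> (- g) \<longleftrightarrow> acts h \<sigma> g"
proof -
  have *: "acts h \<sigma> (- g)" if "acts h \<sigma> g" for g :: 'a
  proof -
    have "h = - g + flip \<sigma> h + g"
      using that unfolding acts_def by (metis add.assoc diff_add_cancel minus_add_cancel)
    then have "flip \<sigma> h = - g + h + g"
      by (cases \<sigma>) (auto simp: group_norm simp del: add_uminus_conv_diff dest: arg_cong[where f = uminus])
    then show ?thesis by (simp add: acts_def)
  qed
  show ?thesis using *[of g] *[of "- g"] by auto
qed

lemma acts_add: "acts h \<sigma> g \<Longrightarrow> acts h \<tau> k \<Longrightarrow> acts h (\<sigma> = \<tau>) (g + k)"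
proof -
  assume g: "acts h \<sigma> g" and k: "acts h \<tau> k"
  have "g + k + h - (g + k) = g + (k + h - k) - g" by (simp add: group_norm del: add_uminus_conv_diff)
  also have "\<dots> = g + flip \<tau> h - g" using k by (simp add: acts_def)
  also have "\<dots> = flip \<tau> (g + h - g)"
    by (cases \<tau>) (auto simp: group_norm simp del: add_uminus_conv_diff)
  also have "\<dots> = flip (\<sigma> = \<tau>) h" using g by (cases \<tau>; cases \<sigma>) (auto simp: acts_def)
  finally show ?thesis by (simp add: acts_def)
qed

lemma acts_add_iff: "acts h \<sigma> g \<Longrightarrow> acts h \<tau> (g + k) \<longleftrightarrow> acts h (\<sigma> = \<tau>) k"
proof
  assume g: "acts h \<sigma> g" 
  show "acts h (\<sigma> = \<tau>) k" if "acts h \<tau> (g + k)"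
    using acts_add[of h \<sigma> "- g" \<tau> "g + k"] g that by (simp add: add.assoc[symmetric])
  show "acts h \<tau> (g + k)" if "acts h (\<sigma> = \<tau>) k"
    using acts_add[OF g that] by (cases \<sigma>; cases \<tau>) auto
qed

lemma acts_zmul: "acts h True g \<Longrightarrow> acts h True (zmul k g)"
proof (induction k rule: int_induct[where k = 0])
  case (step1 i)
  then show ?case using acts_add[of h True g True "zmul i g"] by (simp add: zmul_succ)
next
  case (step2 i)
  then show ?case using acts_add[of h True "- g" True "zmul i g"] by (simp add: zmul_pred)
qed simp

lemma acts_flip [simp]: "acts (flip \<theta> h) \<sigma> g \<longleftrightarrow> acts h \<sigma> g"
proof -
  have "g + - h - g = - (g + h - g)" by (simp add: group_norm del: add_uminus_conv_diff)
  then show ?thesis unfolding acts_def by (cases \<theta>; cases \<sigma>) (auto simp: equation_minus_iff minus_equation_iff)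
qed

lemma acts_zmul_conj: "acts h \<sigma> g \<Longrightarrow> g + zmul k h - g = zmul k (flip \<sigma> h)"
  by (simp add: zmul_conj[symmetric] acts_def)

lemma acts_comm: "acts h \<sigma> g \<Longrightarrow> g + zmul k h = zmul k (flip \<sigma> h) + g"
  by (simp add: acts_zmul_conj[symmetric])

lemma zmul_flip: "zmul k (flip \<sigma> h) = zmul (if \<sigma> then k else - k) h"
  by (cases \<sigma>) auto

section \<open>Words made of Seifert blocks\<close>

text \<open>
  The long relator of a Seifert group is a product of blocks: a power of the fibre (\<open>Fib
  e\<close> for the factor with exponent \<open>-e\<close>), a generator around an exceptional
  fibre, the square of a crosscap generator, and the commutator of a handle. The generators of a
  block are named in it, and a truth value is the sign by which the preceding generator acts on
  \<open>h\<close>. All other relators concern a single block.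
\<close>

datatype 'n block = Fib int | Cone 'n int int | Cross 'n bool | Handle 'n bool 'n bool

primrec bval :: "'p::group_add \<Rightarrow> ('n \<Rightarrow> 'p) \<Rightarrow> 'n block \<Rightarrow> 'p" where
  "bval h p (Fib e) = - zmul e h"
| "bval h p (Cone s a b) = p s"
| "bval h p (Cross v \<sigma>) = p v + p v"
| "bval h p (Handle x \<sigma> y \<tau>) = p x + p y - p x - p y"

primrec bok :: "'p::group_add \<Rightarrow> ('n \<Rightarrow> 'p) \<Rightarrow> 'n block \<Rightarrow> bool" where
  "bok h p (Fib e) \<longleftrightarrow> True"
| "bok h p (Cone s a b) \<longleftrightarrow> acts h True (p s) \<and> zmul a (p s) + zmul b h = 0"
| "bok h p (Cross v \<sigma>) \<longleftrightarrow> acts h \<sigma> (p v)"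
| "bok h p (Handle x \<sigma> y \<tau>) \<longleftrightarrow> acts h \<sigma> (p x) \<and> acts h \<tau> (p y)"

primrec bnames :: "'n block \<Rightarrow> 'n list" where
  "bnames (Fib e) = []"
| "bnames (Cone s a b) = [s]"
| "bnames (Cross v \<sigma>) = [v]"
| "bnames (Handle x \<sigma> y \<tau>) = [x, y]"

abbreviation bsum :: "'p::group_add \<Rightarrow> ('n \<Rightarrow> 'p) \<Rightarrow> 'n block list \<Rightarrow> 'p" where
  "bsum h p D \<equiv> sum_list (map (bval h p) D)"

abbreviation names :: "'n block list \<Rightarrow> 'n list" where
  "names D \<equiv> concat (map bnames D)"

definition block_system :: "'n \<Rightarrow> 'n block list \<Rightarrow> ('n \<Rightarrow> 'p::group_add) \<Rightarrow> bool" where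
  "block_system hn D p \<longleftrightarrow> (\<forall>B\<in>set D. bok (p hn) p B) \<and> bsum (p hn) p D = 0"

abbreviation gens :: "'n \<Rightarrow> 'n block list \<Rightarrow> 'n set" where
  "gens hn D \<equiv> insert hn (set (names D))"

abbreviation good :: "'n \<Rightarrow> 'n block list \<Rightarrow> bool" where
  "good hn D \<equiv> distinct (hn # names D)"

lemma bval_cong: "(\<And>z. z \<in> set (bnames B) \<Longrightarrow> p z = q z) \<Longrightarrow> bval h p B = bval h q B"
  by (cases B) auto

lemma bok_cong: "(\<And>z. z \<in> set (bnames B) \<Longrightarrow> p z = q z) \<Longrightarrow> bok h p B \<longleftrightarrow> bok h q B"
  by (cases B) auto

lemma bsum_cong: "(\<And>z. z \<in> set (names D) \<Longrightarrow> p z = q z) \<Longrightarrow> bsum h p D = bsum h q D"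
  by (rule arg_cong[where f = sum_list], rule map_cong[OF HOL.refl], rule bval_cong) auto

lemma boks_cong: "(\<And>z. z \<in> set (names D) \<Longrightarrow> p z = q z) \<Longrightarrow> (\<forall>B\<in>set D. bok h p B) \<longleftrightarrow> (\<forall>B\<in>set D. bok h q B)"
  by (rule ball_cong[OF HOL.refl], rule bok_cong) auto

text \<open>
  A block commutes with \<open>h\<close>: its value is a commutator or a square up to central
  factors, so all signs cancel. This makes it possible to move blocks past each other without
  changing their parameters.
\<close>

lemma bok_acts: "bok h p B \<Longrightarrow> acts h True (bval h p B)"
proof (cases B)
  case (Cross v \<sigma>)
  then show "bok h p B \<Longrightarrow> ?thesis" using acts_add[of h \<sigma> "p v" \<sigma> "p v"] by simp
next
  case (Handle x \<sigma> y \<tau>)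
  then show "bok h p B \<Longrightarrow> ?thesis"
    by (cases \<sigma>; cases \<tau>) (auto simp: group_norm acts_add_iff simp del: add_uminus_conv_diff)
qed (auto simp: acts_zmul)

lemma boks_acts: "\<forall>B\<in>set D. bok h p B \<Longrightarrow> acts h True (bsum h p D)"
proof (induction D)
  case (Cons B D)
  then show ?case using acts_add[of h True "bval h p B" True "bsum h p D"] bok_acts[of h p B] by auto
qed auto

lemma wordfun_bval: "set (bnames B) \<subseteq> X \<Longrightarrow> hn \<in> X \<Longrightarrow> wordfun X (\<lambda>p. bval (p hn) p B)"
  by (cases B) (auto intro!: wordfun_intros wordfun_zmul simp only: bval.simps bnames.simps set_simps insert_subset)

lemma wordfun_bsum: "set (names D) \<subseteq> X \<Longrightarrow> hn \<in> X \<Longrightarrow> wordfun X (\<lambda>p. bsum (p hn) p D)"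
proof (induction D)
  case Nil
  show ?case by (simp add: wordfun_zero)
next
  case (Cons B D)
  then show ?case
    unfolding list.map sum_list.Cons by (intro wordfun_add wordfun_bval) auto
qed

lemma bval_conj:
  assumes "acts h True a" "\<And>z. z \<in> set (bnames B) \<Longrightarrow> q z = a + p z - a"
  shows "bval h q B = a + bval h p B - a"
proof -
  have "a + (- zmul k h + - a) = - zmul k h" for k
    using acts_zmul_conj[OF assms(1), of "- k"] by (simp add: group_norm del: add_uminus_conv_diff)
  then show ?thesis
    using assms(2) by (cases B) (auto simp: group_norm simp del: add_uminus_conv_diff)
qed

lemma bok_conj:
  assumes "acts h True a" "\<And>z. z \<in> set (bnames B) \<Longrightarrow> q z = a + p z - a"
  shows "bok h p B \<Longrightarrow> bok h q B"
proof -
  have *: "acts h \<sigma> (a + x - a)" if "acts h \<sigma> x" for \<sigma> x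
    using assms(1) that by (cases \<sigma>) (auto simp: group_norm acts_add_iff simp del: add_uminus_conv_diff)
  have **: "zmul n (a + x - a) + zmul b h = 0" if "zmul n x + zmul b h = 0" for n x b
  proof -
    have "zmul n (a + x - a) + zmul b h = a + zmul n x - a + (a + zmul b h - a)"
      using acts_zmul_conj[OF assms(1), of b] by (simp add: zmul_conj)
    also have "\<dots> = a + (zmul n x + zmul b h) - a" by (simp add: group_norm del: add_uminus_conv_diff)
    finally show ?thesis using that by simp
  qed
  show "bok h p B \<Longrightarrow> bok h q B"
    using assms(2) by (cases B) (auto simp: * **)
qed

subsection \<open>Reordering\<close>

text \<open>
  A product \<open>a + b\<close> equals \<open>(a + b - a) + a\<close>; conjugating the
  generators of one block by the value \<open>a\<close> of the blocks before it is therefore a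
  change of variables that moves the block to the front. It preserves all parameters, as
  \<open>a\<close> commutes with \<open>h\<close>.
\<close>

lemma eqv_swap:
  assumes "good hn (Z @ A @ [B] @ C)"
  shows "eqv (gens hn (Z @ A @ [B] @ C)) (block_system hn (Z @ A @ [B] @ C))
    (gens hn (Z @ [B] @ A @ C)) (block_system hn (Z @ [B] @ A @ C) :: ('n \<Rightarrow> 'p::group_add) \<Rightarrow> bool)"
proof -
  define cj :: "'p \<Rightarrow> ('n \<Rightarrow> 'p) \<Rightarrow> 'n \<Rightarrow> 'p"
    where "cj a p z = (if z \<in> set (bnames B) then a + p z - a else p z)" for a p z
  let ?a = "\<lambda>p. bsum (p hn) p A"
  have hn: "cj a p hn = p hn" for a p using assms by (auto simp: cj_def)
  have bs: "bsum h (cj a p) D = bsum h p D" "(\<forall>E\<in>set D. bok h (cj a p) E) \<longleftrightarrow> (\<forall>E\<in>set D. bok h p E)"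
    if "D = Z \<or> D = A \<or> D = C" for h a p D
  proof -
    have disj: "set (bnames B) \<inter> set (names D) = {}" using that assms by fastforce
    then have eq: "cj a p z = p z" if "z \<in> set (names D)" for z
      using that unfolding cj_def by (metis disjoint_iff)
    show "bsum h (cj a p) D = bsum h p D" by (rule bsum_cong) (rule eq)
    show "(\<forall>E\<in>set D. bok h (cj a p) E) \<longleftrightarrow> (\<forall>E\<in>set D. bok h p E)"
      by (rule boks_cong) (rule eq)
  qed
  have b: "bval h (cj a p) B = a + bval h p B - a" if "acts h True a" for h a p
    by (rule bval_conj[OF that]) (simp add: cj_def)
  have ok: "bok h p B \<Longrightarrow> bok h (cj a p) B" if "acts h True a" for h a p
    by (rule bok_conj[OF that, of _ _ p]) (simp add: cj_def)
  show ?thesis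
  proof (rule eqvI[where f = "\<lambda>p. cj (?a p) p" and g = "\<lambda>p. cj (- ?a p) p"])
    fix z assume z: "z \<in> gens hn (Z @ [B] @ A @ C)"
    show "wordfun (gens hn (Z @ A @ [B] @ C)) (\<lambda>p. cj (?a p) p z)"
      unfolding cj_def by (intro wordfun_intros wordfun_bsum) (use z in auto)
  next
    fix z assume z: "z \<in> gens hn (Z @ A @ [B] @ C)"
    show "wordfun (gens hn (Z @ [B] @ A @ C)) (\<lambda>p. cj (- ?a p) p z)"
      unfolding cj_def by (intro wordfun_intros wordfun_bsum) (use z in auto)
  next
    fix p :: "'n \<Rightarrow> 'p" assume S: "block_system hn (Z @ A @ [B] @ C) p"
    then have a: "acts (p hn) True (?a p)" using boks_acts[of A "p hn" p] by (auto simp: block_system_def)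
    have "(\<forall>E\<in>set Z. bok (p hn) p E) \<and> (\<forall>E\<in>set A. bok (p hn) p E) \<and> (\<forall>E\<in>set C. bok (p hn) p E) \<and> bok (p hn) p B"
      using S by (auto simp: block_system_def)
    moreover have "bsum (p hn) p Z + ((?a p + bval (p hn) p B - ?a p) + (?a p + bsum (p hn) p C)) = 0"
      using S by (simp add: block_system_def group_norm del: add_uminus_conv_diff)
    ultimately show "block_system hn (Z @ [B] @ A @ C) (cj (?a p) p)"
      using ok[OF a, of p] unfolding block_system_def hn by (simp add: bs b[OF a] ball_Un)
  next
    fix p :: "'n \<Rightarrow> 'p" assume S: "block_system hn (Z @ [B] @ A @ C) p"
    then have a: "acts (p hn) True (- ?a p)" using boks_acts[of A "p hn" p] by (auto simp: block_system_def)
    have "(\<forall>E\<in>set Z. bok (p hn) p E) \<and> (\<forall>E\<in>set A. bok (p hn) p E) \<and> (\<forall>E\<in>set C. bok (p hn) p E) \<and> bok (p hn) p B"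
      using S by (auto simp: block_system_def)
    moreover have "bsum (p hn) p Z + (?a p + ((- ?a p + bval (p hn) p B - (- ?a p)) + bsum (p hn) p C)) = 0"
      using S by (simp add: block_system_def group_norm del: add_uminus_conv_diff)
    ultimately show "block_system hn (Z @ A @ [B] @ C) (cj (- ?a p) p)"
      using ok[OF a, of p] unfolding block_system_def hn by (simp add: bs b[OF a] ball_Un)
  next
    fix p :: "'n \<Rightarrow> 'p" and z
    have "cj (- ?a p) (cj (?a p) p) z = p z" "cj (?a p) (cj (- ?a p) p) z = p z"
      by (auto simp: cj_def group_norm simp del: add_uminus_conv_diff)
    then show "cj (- ?a (cj (?a p) p)) (cj (?a p) p) z = p z" 
       "cj (?a (cj (- ?a p) p)) (cj (- ?a p) p) z = p z"
      by (simp_all add: hn bs)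
  qed
qed

lemma mset_names: "mset D = mset E \<Longrightarrow> mset (names D) = mset (names E)"
proof -
  assume "mset D = mset E"
  then have "sum_mset (image_mset (mset \<circ> bnames) (mset D)) = sum_mset (image_mset (mset \<circ> bnames) (mset E))"
    by (rule arg_cong)
  then show ?thesis by (simp only: mset_map[symmetric] sum_mset_sum_list mset_concat map_map)
qed

lemma good_perm:
  assumes "mset D = mset E"
  shows "good hn D \<longleftrightarrow> good hn E"
proof -
  have "mset (hn # names D) = mset (hn # names E)" using mset_names[OF assms] by simp
  then show ?thesis by (rule mset_eq_imp_distinct_iff)
qed

lemma eqv_perm:
  assumes "good hn (Z @ E)" "mset E = mset E'"
  shows "eqv (gens hn (Z @ E)) (block_system hn (Z @ E))
    (gens hn (Z @ E')) (block_system hn (Z @ E') :: ('n \<Rightarrow> 'p::group_add) \<Rightarrow> bool)"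
  using assms
proof (induction E' arbitrary: Z E)
  case (Cons B E')
  then have "B \<in> set E" by (metis list.set_intros(1) mset_eq_setD)
  then obtain A C where E: "E = A @ [B] @ C" by (metis append_Cons append_Nil split_list)
  have m: "mset (A @ C) = mset E'" using Cons.prems(2) E by simp
  have "good hn ((Z @ [B]) @ (A @ C))"
    using Cons.prems(1) good_perm[of "Z @ E" "(Z @ [B]) @ (A @ C)" hn] E by simp
  note IH = Cons.IH[OF this m]
  have "good hn (Z @ A @ [B] @ C)" using Cons.prems(1) E by simp
  note swap = eqv_swap[OF this]
  show ?case using eqv_trans[OF swap] IH E by simp
qed (simp add: eqv_refl)

subsection \<open>Local moves\<close>

text \<open>
  A change of variables that only concerns the generators of some blocks and preserves the value
  of their product.
\<close>

lemma eqv_local: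
  fixes f g :: "('n \<Rightarrow> 'p::group_add) \<Rightarrow> 'n \<Rightarrow> 'p"
  assumes good: "good hn (L @ C)"
    and N: "set (names L') = set (names L)"
    and f: "\<And>z. z \<in> set (names L) \<Longrightarrow> wordfun (gens hn L) (\<lambda>p. f p z)" "\<And>p z. z \<notin> set (names L) \<Longrightarrow> f p z = p z"
    and g: "\<And>z. z \<in> set (names L) \<Longrightarrow> wordfun (gens hn L) (\<lambda>p. g p z)" "\<And>p z. z \<notin> set (names L) \<Longrightarrow> g p z = p z"
    and fL: "\<And>p. \<forall>B\<in>set L. bok (p hn) p B \<Longrightarrow> (\<forall>B\<in>set L'. bok (p hn) (f p) B) \<and>
      bsum (p hn) (f p) L' = bsum (p hn) p L \<and> (\<forall>z\<in>set (names L). g (f p) z = p z)"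
    and gL: "\<And>p. \<forall>B\<in>set L'. bok (p hn) p B \<Longrightarrow> (\<forall>B\<in>set L. bok (p hn) (g p) B) \<and>
      bsum (p hn) (g p) L = bsum (p hn) p L' \<and> (\<forall>z\<in>set (names L). f (g p) z = p z)"
  shows "eqv (gens hn (L @ C)) (block_system hn (L @ C) :: ('n \<Rightarrow> 'p) \<Rightarrow> bool) (gens hn (L' @ C)) (block_system hn (L' @ C))"
proof -
  have hn: "f p hn = p hn" "g p hn = p hn" for p using good f(2) g(2) by auto
  have bs: "bsum h (f p) C = bsum h p C" "bsum h (g p) C = bsum h p C"
    "(\<forall>B\<in>set C. bok h (f p) B) \<longleftrightarrow> (\<forall>B\<in>set C. bok h p B)" 
    "(\<forall>B\<in>set C. bok h (g p) B) \<longleftrightarrow> (\<forall>B\<in>set C. bok h p B)" for h p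
  proof -
    have disj: "z \<notin> set (names L)" if "z \<in> set (names C)" for z using good that by fastforce
    have fz: "f p z = p z" and gz: "g p z = p z" if "z \<in> set (names C)" for z
      using disj[OF that] f(2) g(2) by blast+
    show "bsum h (f p) C = bsum h p C" by (rule bsum_cong) (rule fz)
    show "bsum h (g p) C = bsum h p C" by (rule bsum_cong) (rule gz)
    show "(\<forall>B\<in>set C. bok h (f p) B) \<longleftrightarrow> (\<forall>B\<in>set C. bok h p B)" by (rule boks_cong) (rule fz)
    show "(\<forall>B\<in>set C. bok h (g p) B) \<longleftrightarrow> (\<forall>B\<in>set C. bok h p B)" by (rule boks_cong) (rule gz)
  qed
  show ?thesis
  proof (rule eqvI[where f = f and g = g])
    fix z assume z: "z \<in> gens hn (L' @ C)"
    show "wordfun (gens hn (L @ C)) (\<lambda>p. f p z)"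
    proof (cases "z \<in> set (names L)")
      case True
      then show ?thesis by (rule wordfun_mono[OF f(1)]) auto
    qed (use z N in \<open>auto simp: f(2) intro: wordfun_gen\<close>)
  next
    fix z assume z: "z \<in> gens hn (L @ C)"
    show "wordfun (gens hn (L' @ C)) (\<lambda>p. g p z)"
    proof (cases "z \<in> set (names L)")
      case True
      then show ?thesis by (rule wordfun_mono[OF g(1)]) (use N in auto)
    qed (use z N in \<open>auto simp: g(2) intro: wordfun_gen\<close>)
  next
    fix p :: "'n \<Rightarrow> 'p" assume S: "block_system hn (L @ C) p"
    then show "block_system hn (L' @ C) (f p)" using fL[of p] by (auto simp: block_system_def hn bs ball_Un)
    show "g (f p) z = p z" if "z \<in> gens hn (L @ C)" for z
      using fL[of p] S f(2) g(2) that by (cases "z \<in> set (names L)") (auto simp: block_system_def)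
  next
    fix p :: "'n \<Rightarrow> 'p" assume S: "block_system hn (L' @ C) p"
    then show "block_system hn (L @ C) (g p)" using gL[of p] by (auto simp: block_system_def hn bs ball_Un)
    show "f (g p) z = p z" if "z \<in> gens hn (L' @ C)" for z
      using gL[of p] S f(2) g(2) that by (cases "z \<in> set (names L)") (auto simp: block_system_def)
  qed
qed

subsection \<open>Shapes\<close>

text \<open>
  Since blocks can be permuted and renamed, a block word matters only through the multiset of
  its blocks with the names forgotten.
\<close>

type_synonym shape = "unit block"

abbreviation shape_of :: "'n block \<Rightarrow> shape" where
  "shape_of \<equiv> map_block (\<lambda>_. ())"

definition has_shape :: "'n \<Rightarrow> 'x set \<Rightarrow> (('x \<Rightarrow> 'p::group_add) \<Rightarrow> bool) \<Rightarrow> shape multiset \<Rightarrow> bool" where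
  "has_shape hn X S U \<longleftrightarrow> (\<exists>E. good hn E \<and> image_mset shape_of (mset E) = U \<and> eqv X S (gens hn E) (block_system hn E))"

lemma image_mset_split_list:
  assumes "image_mset f (mset E) = mset L + U"
  shows "\<exists>L' C. mset E = mset (L' @ C) \<and> map f L' = L \<and> image_mset f (mset C) = U"
  using assms
proof (induction L arbitrary: E)
  case Nil
  then show ?case by (intro exI[of _ "[]"] exI[of _ E]) auto
next
  case (Cons a L)
  then have "a \<in># image_mset f (mset E)" by simp
  then obtain e where e: "e \<in># mset E" "f e = a" by auto
  then have E: "mset E = add_mset e (mset (remove1 e E))" by simp
  have "image_mset f (add_mset e (mset (remove1 e E))) = add_mset a (mset L + U)"
    unfolding E[symmetric] using Cons.prems by simp
  then have "image_mset f (mset (remove1 e E)) = mset L + U" using e(2) by simp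
  from Cons.IH[OF this] obtain L' C where L': "mset (remove1 e E) = mset (L' @ C)" "map f L' = L" "image_mset f (mset C) = U"
    by blast
  have "mset E = mset ((e # L') @ C)" by (subst E, subst L'(1)) simp
  then show ?case by (intro exI[of _ "e # L'"] exI[of _ C]) (use L' e in simp)
qed

lemma has_shapeE:
  assumes "has_shape hn X S (mset L0 + U)"
  obtains L C where "map shape_of L = L0" "image_mset shape_of (mset C) = U" "good hn (L @ C)"
    "eqv X S (gens hn (L @ C)) (block_system hn (L @ C))"
proof -
  from assms obtain E where E: "good hn E" "image_mset shape_of (mset E) = mset L0 + U"
    "eqv X S (gens hn E) (block_system hn E)" unfolding has_shape_def by auto
  from image_mset_split_list[OF E(2)] obtain L C where L: "mset E = mset (L @ C)" "map shape_of L = L0" "image_mset shape_of (mset C) = U"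
    by blast
  have "good hn (L @ C)" using good_perm[OF L(1)] E(1) by blast
  moreover have "eqv X S (gens hn (L @ C)) (block_system hn (L @ C))"
    using eqv_trans[OF E(3)] eqv_perm[of hn "[]" E "L @ C"] E(1) L(1) by simp
  ultimately show thesis using that L by blast
qed

text \<open>
  The two type arguments fix the type of names and the type of the solutions.
\<close>

definition block_move :: "'n itself \<Rightarrow> 'p::group_add itself \<Rightarrow> shape list \<Rightarrow> shape list \<Rightarrow> bool" where
  "block_move _ _ U V \<longleftrightarrow> (\<forall>(hn :: 'n) L C. map shape_of L = U \<longrightarrow> good hn (L @ C) \<longrightarrow>
     (\<exists>L'. map shape_of L' = V \<and> good hn (L' @ C) \<and>
       eqv (gens hn (L @ C)) (block_system hn (L @ C) :: ('n \<Rightarrow> 'p) \<Rightarrow> bool) (gens hn (L' @ C)) (block_system hn (L' @ C))))"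

lemma block_moveI:
  assumes "\<And>(hn :: 'n) L C. map shape_of L = U \<Longrightarrow> good hn (L @ C) \<Longrightarrow> 
     \<exists>L'. map shape_of L' = V \<and> mset (names L') = mset (names L) \<and>
     eqv (gens hn (L @ C)) (block_system hn (L @ C) :: ('n \<Rightarrow> 'p) \<Rightarrow> bool) (gens hn (L' @ C)) (block_system hn (L' @ C))"
  shows "block_move TYPE('n) TYPE('p::group_add) U V"
  unfolding block_move_def
proof (intro allI impI)
  fix hn :: 'n and L C assume *: "map shape_of L = U" "good hn (L @ C)"
  then obtain L' where L': "map shape_of L' = V" "mset (names L') = mset (names L)"
    "eqv (gens hn (L @ C)) (block_system hn (L @ C) :: ('n \<Rightarrow> 'p) \<Rightarrow> bool) (gens hn (L' @ C)) (block_system hn (L' @ C))"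
    using assms by blast
  have "mset (hn # names (L' @ C)) = mset (hn # names (L @ C))" using L'(2) by simp
  from mset_eq_imp_distinct_iff[OF this] have "good hn (L' @ C)" using *(2) by blast
  then show "\<exists>L'. map shape_of L' = V \<and> good hn (L' @ C) \<and>
       eqv (gens hn (L @ C)) (block_system hn (L @ C) :: ('n \<Rightarrow> 'p) \<Rightarrow> bool) (gens hn (L' @ C)) (block_system hn (L' @ C))"
    using L' by blast
qed

lemma has_shape_move:
  assumes "block_move TYPE('n) TYPE('p) L0 L1" "has_shape (hn :: 'n) X (S :: ('x \<Rightarrow> 'p::group_add) \<Rightarrow> bool) (mset L0 + U)"
  shows "has_shape hn X S (mset L1 + U)"
proof -
  from assms(2) obtain L C where L: "map shape_of L = L0" "image_mset shape_of (mset C) = U" "good hn (L @ C)"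
    "eqv X S (gens hn (L @ C)) (block_system hn (L @ C))" by (rule has_shapeE)
  from assms(1) L(1,3) obtain L' where L': "map shape_of L' = L1" "good hn (L' @ C)"
    "eqv (gens hn (L @ C)) (block_system hn (L @ C) :: ('n \<Rightarrow> 'p) \<Rightarrow> bool) (gens hn (L' @ C)) (block_system hn (L' @ C))"
    unfolding block_move_def by blast
  show ?thesis unfolding has_shape_def
    by (rule exI[of _ "L' @ C"]) (use L' L eqv_trans[OF L(4) L'(3)] in \<open>auto simp flip: mset_map\<close>)
qed

subsection \<open>The moves\<close>

lemma shape_of_iff [simp]:
  "shape_of B = Fib e \<longleftrightarrow> B = Fib e"
  "shape_of B = Cone u a b \<longleftrightarrow> (\<exists>s. B = Cone s a b)"
  "shape_of B = Cross u \<sigma> \<longleftrightarrow> (\<exists>v. B = Cross v \<sigma>)"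
  "shape_of B = Handle u \<sigma> u' \<tau> \<longleftrightarrow> (\<exists>x y. B = Handle x \<sigma> y \<tau>)"
  by (cases B; auto)+

definition local_iso :: "'n \<Rightarrow> 'n block list \<Rightarrow> 'n block list \<Rightarrow>
    (('n \<Rightarrow> 'p::group_add) \<Rightarrow> 'n \<Rightarrow> 'p) \<Rightarrow> (('n \<Rightarrow> 'p) \<Rightarrow> 'n \<Rightarrow> 'p) \<Rightarrow> bool" where
  "local_iso hn L L' f g \<longleftrightarrow> mset (names L') = mset (names L) \<and>
    (\<forall>z\<in>set (names L). wordfun (gens hn L) (\<lambda>p. f p z) \<and> wordfun (gens hn L) (\<lambda>p. g p z)) \<and>
    (\<forall>p z. z \<notin> set (names L) \<longrightarrow> f p z = p z \<and> g p z = p z) \<and>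
    (\<forall>p. (\<forall>B\<in>set L. bok (p hn) p B) \<longrightarrow> (\<forall>B\<in>set L'. bok (p hn) (f p) B) \<and>
      bsum (p hn) (f p) L' = bsum (p hn) p L \<and> (\<forall>z\<in>set (names L). g (f p) z = p z)) \<and>
    (\<forall>p. (\<forall>B\<in>set L'. bok (p hn) p B) \<longrightarrow> (\<forall>B\<in>set L. bok (p hn) (g p) B) \<and>
      bsum (p hn) (g p) L = bsum (p hn) p L' \<and> (\<forall>z\<in>set (names L). f (g p) z = p z))"

lemma block_move_local:
  fixes U V :: "shape list"
  assumes "\<And>(hn :: 'n) L. map shape_of L = U \<Longrightarrow> good hn L \<Longrightarrow>
    \<exists>L' (f :: ('n \<Rightarrow> 'p) \<Rightarrow> 'n \<Rightarrow> 'p) g. map shape_of L' = V \<and> local_iso hn L L' f g"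
  shows "block_move TYPE('n) TYPE('p::group_add) U V"
proof (rule block_moveI)
  fix hn :: 'n and L C assume L: "map shape_of L = U" "good hn (L @ C)"
  then have "good hn L" by auto
  from assms[OF L(1) this] obtain L' and f g :: "('n \<Rightarrow> 'p) \<Rightarrow> 'n \<Rightarrow> 'p"
    where V: "map shape_of L' = V" and li: "local_iso hn L L' f g" by blast
  note * = li[unfolded local_iso_def]
  note ms = *[THEN conjunct1] and w = *[THEN conjunct2, THEN conjunct1]
    and out = *[THEN conjunct2, THEN conjunct2, THEN conjunct1]
    and fL = *[THEN conjunct2, THEN conjunct2, THEN conjunct2, THEN conjunct1, rule_format]
    and gL = *[THEN conjunct2, THEN conjunct2, THEN conjunct2, THEN conjunct2, rule_format]
  have "eqv (gens hn (L @ C)) (block_system hn (L @ C) :: ('n \<Rightarrow> 'p) \<Rightarrow> bool) (gens hn (L' @ C)) (block_system hn (L' @ C))"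
  proof (rule eqv_local[OF L(2), where f = f and g = g])
    show "set (names L') = set (names L)" by (rule mset_eq_setD[OF ms])
    show "\<And>z. z \<in> set (names L) \<Longrightarrow> wordfun (gens hn L) (\<lambda>p. f p z)"
      "\<And>z. z \<in> set (names L) \<Longrightarrow> wordfun (gens hn L) (\<lambda>p. g p z)" using w by blast+
    show "\<And>p z. z \<notin> set (names L) \<Longrightarrow> f p z = p z" "\<And>p z. z \<notin> set (names L) \<Longrightarrow> g p z = p z"
      using out by blast+
  qed (use fL gL in blast)+
  then show "\<exists>L'. map shape_of L' = V \<and> mset (names L') = mset (names L) \<and>
     eqv (gens hn (L @ C)) (block_system hn (L @ C) :: ('n \<Rightarrow> 'p) \<Rightarrow> bool) (gens hn (L' @ C)) (block_system hn (L' @ C))"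
    using V ms by blast
qed

lemma acts_zmul_self: "acts h \<tau> (zmul e h + k) \<longleftrightarrow> acts h \<tau> k" "acts h \<tau> (- zmul e h + k) \<longleftrightarrow> acts h \<tau> k"
  using acts_add_iff[of h True "zmul e h" \<tau> k] acts_add_iff[of h True "- zmul e h" \<tau> k] acts_zmul[of h h e]
  by simp_all

lemma zmul_comm_True:
  assumes "acts h True x"
  shows "x + (zmul e h + z) = zmul e h + (x + z)" "x + zmul e h = zmul e h + x"
  using acts_comm[OF assms, of e] by (simp_all add: add.assoc[symmetric])

lemma zmul_comm_False:
  assumes "acts h False x"
  shows "- zmul e h + - x = - x + zmul e h" "zmul e h + (- x + z) = - x + (- zmul e h + z)"
  using acts_comm[of h False "- x" e] acts_comm[of h False "- x" "- e"] assms
  by (simp_all add: add.assoc[symmetric] del: add_uminus_conv_diff)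

lemmas local_simps = group_norm acts_add_iff

lemma move_merge: "block_move TYPE('n) TYPE('p::group_add) [Fib e, Fib f] [Fib (e + f)]"
proof (rule block_move_local)
  fix hn :: 'n and L :: "'n block list" assume "map shape_of L = [Fib e, Fib f]" "good hn L"
  then have L: "L = [Fib e, Fib f]" by (auto simp: map_eq_Cons_conv)
  have "- zmul e h + - zmul f h = - zmul (e + f) h" for h :: 'p
    using zmul_add[of f e h] by (simp only: minus_add add.commute[of e f])
  then have "local_iso hn L [Fib (e + f)] (\<lambda>p :: 'n \<Rightarrow> 'p. p) (\<lambda>p. p)"
    by (simp add: local_iso_def L)
  then show "\<exists>L' (f' :: ('n \<Rightarrow> 'p) \<Rightarrow> 'n \<Rightarrow> 'p) g. map shape_of L' = [Fib (e + f)] \<and> local_iso hn L L' f' g"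
    by (intro exI[of _ "[Fib (e + f)]"] exI[of _ "\<lambda>p. p"]) auto
qed

lemma zmul_neg_rel: "zmul a s + zmul b h = 0 \<Longrightarrow> - zmul a s + - zmul b h = (0 :: 'p::group_add)"
  by (metis add.inverse_neutral minus_unique neg_eq_iff_add_eq_0)

text \<open>
  An exceptional fibre carried around a generator of sign \<open>\<sigma>\<close>, without or
  with reversal of its orientation in the base.
\<close>

lemma zmul_conj_inv:
  assumes "zmul a s + zmul b h = 0" "acts h \<sigma> g"
  shows "zmul a (g + (s + - g)) + zmul (if \<sigma> then b else - b) h = 0"
    "zmul a (g + (- s + - g)) + zmul (if \<sigma> then - b else b) h = 0"
proof -
  have "zmul a (g + s - g) + zmul (if \<sigma> then b else - b) h = (g + zmul a s - g) + (g + zmul b h - g)"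
    using acts_zmul_conj[OF assms(2), of b] by (simp add: zmul_conj zmul_flip)
  also have "\<dots> = g + (zmul a s + zmul b h) - g" by (simp add: group_norm del: add_uminus_conv_diff)
  finally show *: "zmul a (g + (s + - g)) + zmul (if \<sigma> then b else - b) h = 0"
    using assms(1) by (simp add: group_norm del: add_uminus_conv_diff)
  have "g + (- s + - g) = - (g + (s + - g))" by (simp only: group_norm minus_minus)
  then show "zmul a (g + (- s + - g)) + zmul (if \<sigma> then - b else b) h = 0"
    using zmul_neg_rel[OF *] by (cases \<sigma>) (simp_all)
qed

lemma zmul_conj_True:
  assumes "acts h True g"
  shows "zmul a s + zmul b h = 0 \<Longrightarrow> zmul a (g + (- s + - g)) + - zmul b h = 0"
    "zmul a s + - zmul b h = 0 \<Longrightarrow> zmul a (g + (- s + - g)) + zmul b h = 0"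
    "zmul a s + zmul b h = 0 \<Longrightarrow> zmul a (- g + (- s + g)) + - zmul b h = 0"
    "zmul a s + - zmul b h = 0 \<Longrightarrow> zmul a (- g + (- s + g)) + zmul b h = 0"
  using zmul_conj_inv(2)[of a s b h True g] zmul_conj_inv(2)[of a s "- b" h True g]
    zmul_conj_inv(2)[of a s b h True "- g"] zmul_conj_inv(2)[of a s "- b" h True "- g"] assms
  by (simp_all del: add_uminus_conv_diff)

lemma zmul_conj_False:
  assumes "acts h False k"
  shows "zmul a s + zmul b h = 0 \<Longrightarrow> zmul a (k + (s + - k)) + - zmul b h = 0"
    "zmul a s + - zmul b h = 0 \<Longrightarrow> zmul a (k + (s + - k)) + zmul b h = 0"
    "zmul a s + zmul b h = 0 \<Longrightarrow> zmul a (- k + (s + k)) + - zmul b h = 0"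
    "zmul a s + - zmul b h = 0 \<Longrightarrow> zmul a (- k + (s + k)) + zmul b h = 0"
  using zmul_conj_inv(1)[of a s b h False k] zmul_conj_inv(1)[of a s "- b" h False k]
    zmul_conj_inv(1)[of a s b h False "- k"] zmul_conj_inv(1)[of a s "- b" h False "- k"] assms
  by (simp_all del: add_uminus_conv_diff)

lemmas zmul_conj_rules = zmul_conj_True zmul_conj_False

text \<open>
  An exceptional fibre that is slid through a crosscap comes back inverted, since the base is
  reversed; if the crosscap generator commutes with \<open>h\<close>, the total space is
  reversed along this path and \<open>b\<close> changes sign: \<open>s v v = y y
  (y\<^bsup>-1\<^esup> s\<^bsup>-1\<^esup> y)\<close> for \<open>y = s v\<close>.
\<close>

lemma move_cone_cross: "block_move TYPE('n) TYPE('p::group_add) [Cone () a b, Cross () True] [Cross () True, Cone () a (- b)]"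
proof (rule block_move_local)
  fix hn :: 'n and L :: "'n block list" assume *: "map shape_of L = [Cone () a b, Cross () True]" "good hn L"
  then obtain s v where L: "L = [Cone s a b, Cross v True]" by (auto simp: map_eq_Cons_conv)
  let ?L' = "[Cross v True, Cone s a (- b)]"
  let ?f = "\<lambda>p :: 'n \<Rightarrow> 'p. p(v := p s + p v, s := - p v + (- p s + p v))"
  let ?g = "\<lambda>p. p(s := p v + (- p s + - p v), v := p v + p s)"
  have "local_iso hn L ?L' ?f ?g"
    unfolding local_iso_def L
    using *(2) by (auto simp: L local_simps zmul_conj_rules simp del: add_uminus_conv_diff intro!: wordfun_intros)
  then show "\<exists>L' (f :: ('n \<Rightarrow> 'p) \<Rightarrow> 'n \<Rightarrow> 'p) g. map shape_of L' = [Cross () True, Cone () a (- b)] \<and> local_iso hn L L' f g"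
    by (intro exI[of _ ?L'] exI[of _ ?f] exI[of _ ?g]) auto
qed

text \<open>
  Sliding an exceptional fibre around the handle conjugates it by \<open>y\<close>: \<open>s [x,
  y] = [s x, y] (y s y\<^bsup>-1\<^esup>)\<close>.
\<close>

lemma move_cone_handle: "block_move TYPE('n) TYPE('p::group_add) [Cone () a b, Handle () \<sigma> () False] [Handle () \<sigma> () False, Cone () a (- b)]"
proof (rule block_move_local)
  fix hn :: 'n and L :: "'n block list" assume *: "map shape_of L = [Cone () a b, Handle () \<sigma> () False]" "good hn L"
  then obtain s x y where L: "L = [Cone s a b, Handle x \<sigma> y False]" by (auto simp: map_eq_Cons_conv)
  let ?L' = "[Handle x \<sigma> y False, Cone s a (- b)]"
  let ?f = "\<lambda>p :: 'n \<Rightarrow> 'p. p(x := p s + p x, s := p y + (p s + - p y))"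
  let ?g = "\<lambda>p. p(s := - p y + (p s + p y), x := - p y + (- p s + (p y + p x)))"
  have "local_iso hn L ?L' ?f ?g"
    unfolding local_iso_def L
    using *(2) by (cases \<sigma>) (auto simp: L local_simps zmul_conj_rules simp del: add_uminus_conv_diff intro!: wordfun_intros)
  then show "\<exists>L' (f :: ('n \<Rightarrow> 'p) \<Rightarrow> 'n \<Rightarrow> 'p) g. map shape_of L' = [Handle () \<sigma> () False, Cone () a (- b)] \<and> local_iso hn L L' f g"
    by (intro exI[of _ ?L'] exI[of _ ?f] exI[of _ ?g]) auto
qed

lemma move_fib_cross: "block_move TYPE('n) TYPE('p::group_add) [Fib e, Cross () True] [Cross () True, Fib (- e)]"
proof (rule block_move_local)
  fix hn :: 'n and L :: "'n block list" assume *: "map shape_of L = [Fib e, Cross () True]" "good hn L"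
  then obtain v where L: "L = [Fib e, Cross v True]" by (auto simp: map_eq_Cons_conv)
  let ?L' = "[Cross v True, Fib (- e)]"
  let ?f = "\<lambda>p :: 'n \<Rightarrow> 'p. p(v := - zmul e (p hn) + p v)"
  let ?g = "\<lambda>p :: 'n \<Rightarrow> 'p. p(v := zmul e (p hn) + p v)"
  have "local_iso hn L ?L' ?f ?g"
    unfolding local_iso_def L
    using *(2) by (auto simp: L local_simps acts_zmul_self zmul_comm_True zmul_comm_False simp del: add_uminus_conv_diff intro!: wordfun_intros wordfun_zmul)
  then show "\<exists>L' (f :: ('n \<Rightarrow> 'p) \<Rightarrow> 'n \<Rightarrow> 'p) g. map shape_of L' = [Cross () True, Fib (- e)] \<and> local_iso hn L L' f g"
    by (intro exI[of _ ?L'] exI[of _ ?f] exI[of _ ?g]) auto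
qed

lemma move_fib_handle: "block_move TYPE('n) TYPE('p::group_add) [Fib e, Handle () \<sigma> () False] [Handle () \<sigma> () False, Fib (- e)]"
proof (rule block_move_local)
  fix hn :: 'n and L :: "'n block list" assume *: "map shape_of L = [Fib e, Handle () \<sigma> () False]" "good hn L"
  then obtain x y where L: "L = [Fib e, Handle x \<sigma> y False]" by (auto simp: map_eq_Cons_conv)
  let ?L' = "[Handle x \<sigma> y False, Fib (- e)]"
  let ?f = "\<lambda>p :: 'n \<Rightarrow> 'p. p(x := - zmul e (p hn) + p x)"
  let ?g = "\<lambda>p :: 'n \<Rightarrow> 'p. p(x := zmul e (p hn) + p x)"
  have "local_iso hn L ?L' ?f ?g"
    unfolding local_iso_def L
    using *(2) by (cases \<sigma>) (auto simp: L local_simps acts_zmul_self zmul_comm_False simp del: add_uminus_conv_diff intro!: wordfun_intros wordfun_zmul)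
  then show "\<exists>L' (f :: ('n \<Rightarrow> 'p) \<Rightarrow> 'n \<Rightarrow> 'p) g. map shape_of L' = [Handle () \<sigma> () False, Fib (- e)] \<and> local_iso hn L L' f g"
    by (intro exI[of _ ?L'] exI[of _ ?f] exI[of _ ?g]) auto
qed

lemma move_handle_swap: "block_move TYPE('n) TYPE('p::group_add) [Handle () \<sigma> () \<tau>] [Handle () \<tau> () \<sigma>]"
proof (rule block_move_local)
  fix hn :: 'n and L :: "'n block list" assume *: "map shape_of L = [Handle () \<sigma> () \<tau>]" "good hn L"
  then obtain x y where L: "L = [Handle x \<sigma> y \<tau>]" by (auto simp: map_eq_Cons_conv)
  let ?L' = "[Handle x \<tau> y \<sigma>]"
  let ?f = "\<lambda>p :: 'n \<Rightarrow> 'p. p(x := p x + (p y + - p x), y := - p x)"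
  let ?g = "\<lambda>p :: 'n \<Rightarrow> 'p. p(x := - p y, y := p y + (p x + - p y))"
  have "local_iso hn L ?L' ?f ?g"
    unfolding local_iso_def L
    using *(2) by (cases \<sigma>; cases \<tau>) (auto simp: L local_simps  simp del: add_uminus_conv_diff intro!: wordfun_intros wordfun_zmul)
  then show "\<exists>L' (f :: ('n \<Rightarrow> 'p) \<Rightarrow> 'n \<Rightarrow> 'p) g. map shape_of L' = [Handle () \<tau> () \<sigma>] \<and> local_iso hn L L' f g"
    by (intro exI[of _ ?L'] exI[of _ ?f] exI[of _ ?g]) auto
qed

lemma move_handle_add: "block_move TYPE('n) TYPE('p::group_add) [Handle () \<sigma> () \<tau>] [Handle () (\<sigma> = \<tau>) () \<tau>]"
proof (rule block_move_local)
  fix hn :: 'n and L :: "'n block list" assume *: "map shape_of L = [Handle () \<sigma> () \<tau>]" "good hn L"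
  then obtain x y where L: "L = [Handle x \<sigma> y \<tau>]" by (auto simp: map_eq_Cons_conv)
  let ?L' = "[Handle x (\<sigma> = \<tau>) y \<tau>]"
  let ?f = "\<lambda>p :: 'n \<Rightarrow> 'p. p(x := p x + p y)"
  let ?g = "\<lambda>p :: 'n \<Rightarrow> 'p. p(x := p x + - p y)"
  have "local_iso hn L ?L' ?f ?g"
    unfolding local_iso_def L
    using *(2) by (cases \<sigma>; cases \<tau>) (auto simp: L local_simps  simp del: add_uminus_conv_diff intro!: wordfun_intros wordfun_zmul)
  then show "\<exists>L' (f :: ('n \<Rightarrow> 'p) \<Rightarrow> 'n \<Rightarrow> 'p) g. map shape_of L' = [Handle () (\<sigma> = \<tau>) () \<tau>] \<and> local_iso hn L L' f g"
    by (intro exI[of _ ?L'] exI[of _ ?f] exI[of _ ?g]) auto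
qed

text \<open>
  The signs on a handle can be transferred to another one by the rewriting \<open>[p, q] = p q
  p\<^bsup>-1\<^esup> d q\<^bsup>-1\<^esup>\<close> with \<open>d\<close> trivial, where
  \<open>p q p\<^bsup>-1\<^esup> d q\<^bsup>-1\<^esup> = d [d\<^bsup>-1\<^esup> p, q]\<close>,
  applied twice after the substitution \<open>u = y r\<close>.
\<close>

lemma move_handle_slide: "block_move TYPE('n) TYPE('p::group_add) [Handle () \<xi> () \<eta>, Handle () \<mu> () \<nu>] [Handle () (\<xi> = \<nu>) () \<eta>, Handle () (\<mu> = \<eta>) () \<nu>]"
proof (rule block_move_local)
  fix hn :: 'n and L :: "'n block list" assume *: "map shape_of L = [Handle () \<xi> () \<eta>, Handle () \<mu> () \<nu>]" "good hn L"
  then obtain x y u v where L: "L = [Handle x \<xi> y \<eta>, Handle u \<mu> v \<nu>]" by (auto simp: map_eq_Cons_conv)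
  let ?L' = "[Handle x (\<xi> = \<nu>) y \<eta>, Handle u (\<mu> = \<eta>) v \<nu>]"
  let ?f = "\<lambda>p :: 'n \<Rightarrow> 'p. p(x := (- p y + (p u + (- p v + (- p u + (p y + p x))))), u := - ((- p y + (p u + (- p v + (- p u + (p y + p x))))) + (p y + (- (- p y + (p u + (- p v + (- p u + (p y + p x))))) + - p y))) + (- p y + p u))"
  let ?g = "\<lambda>p :: 'n \<Rightarrow> 'p. p(u := p y + ((p x + (p y + (- p x + - p y))) + p u), x := ((p x + (p y + (- p x + - p y))) + p u) + (p v + (- ((p x + (p y + (- p x + - p y))) + p u) + p x)))"
  have "local_iso hn L ?L' ?f ?g"
    unfolding local_iso_def L
    using *(2) by (cases \<xi>; cases \<eta>; cases \<mu>; cases \<nu>) (auto simp: L local_simps  simp del: add_uminus_conv_diff intro!: wordfun_intros wordfun_zmul)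
  then show "\<exists>L' (f :: ('n \<Rightarrow> 'p) \<Rightarrow> 'n \<Rightarrow> 'p) g. map shape_of L' = [Handle () (\<xi> = \<nu>) () \<eta>, Handle () (\<mu> = \<eta>) () \<nu>] \<and> local_iso hn L L' f g"
    by (intro exI[of _ ?L'] exI[of _ ?f] exI[of _ ?g]) auto
qed

text \<open>
  A handle next to a crosscap is worth three crosscaps. With \<open>c = z x\<close>, \<open>d =
  x\<^bsup>-1\<^esup> c y\<close> and \<open>k = y\<^bsup>-1\<^esup>
  c\<^bsup>-1\<^esup>\<close>, the word \<open>[x, y] z z\<close> is the conjugate of \<open>d d
  k k c c\<close> by \<open>z\<^bsup>-1\<^esup> x\<close>; the new generators are these three
  elements after conjugation, and \<open>z\<^bsup>-1\<^esup> x\<close> is the inverse of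
  \<open>d k c d k\<close>.
\<close>

lemma local_iso_handle_cross:
  assumes "good hn [Handle x \<xi> y \<eta>, Cross z \<zeta>]"
  defines "f \<equiv> \<lambda>p :: 'n \<Rightarrow> 'p::group_add. p(x := p x + (p y + (- p x + p z)), y := - p z + (p x + (- p y + (- p x + (- p z + (- p x + p z))))), z := - p z + (p x + (p z + p z)))" and "g \<equiv> \<lambda>p :: 'n \<Rightarrow> 'p. p(x := (p x + (p y + (p z + (p x + p y)))) + (- p y + (- p x + - (p x + (p y + (p z + (p x + p y)))))), y := (p x + (p y + (p z + (p x + p y)))) + (- p z + (- p y + - (p x + (p y + (p z + (p x + p y)))))), z := (p x + (p y + (p z + (p x + p y)))) + (p z + (p x + (p y + - (p x + (p y + (p z + (p x + p y))))))))"
  shows "local_iso hn [Handle x \<xi> y \<eta>, Cross z \<zeta>] [Cross x (\<zeta> = \<eta>), Cross y ((\<zeta> = \<xi>) = \<eta>), Cross z (\<zeta> = \<xi>)] f g"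
  unfolding local_iso_def f_def g_def
  using assms(1) by (cases \<xi>; cases \<eta>; cases \<zeta>) (auto simp: local_simps simp del: add_uminus_conv_diff intro!: wordfun_intros)

lemma local_iso_sym:
  assumes "local_iso hn L L' f g"
  shows "local_iso hn L' L g f"
proof -
  have "mset (names L') = mset (names L)" using assms unfolding local_iso_def by (rule conjunct1)
  from this mset_eq_setD[OF this] show ?thesis
    using assms unfolding local_iso_def by simp
qed

lemma move_handle_cross: "block_move TYPE('n) TYPE('p::group_add) [Handle () \<xi> () \<eta>, Cross () \<zeta>]
    [Cross () (\<zeta> = \<eta>), Cross () ((\<zeta> = \<xi>) = \<eta>), Cross () (\<zeta> = \<xi>)]"
proof (rule block_move_local)
  fix hn :: 'n and L :: "'n block list" assume *: "map shape_of L = [Handle () \<xi> () \<eta>, Cross () \<zeta>]" "good hn L"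
  then obtain x y z where L: "L = [Handle x \<xi> y \<eta>, Cross z \<zeta>]" by (auto simp: map_eq_Cons_conv)
  show "\<exists>L' (f :: ('n \<Rightarrow> 'p) \<Rightarrow> 'n \<Rightarrow> 'p) g. map shape_of L' = [Cross () (\<zeta> = \<eta>), Cross () ((\<zeta> = \<xi>) = \<eta>), Cross () (\<zeta> = \<xi>)] \<and> local_iso hn L L' f g"
  proof -
    have "good hn [Handle x \<xi> y \<eta>, Cross z \<zeta>]" using *(2) L by simp
    from local_iso_handle_cross[OF this] obtain f g :: "('n \<Rightarrow> 'p) \<Rightarrow> 'n \<Rightarrow> 'p"
      where "local_iso hn L [Cross x (\<zeta> = \<eta>), Cross y ((\<zeta> = \<xi>) = \<eta>), Cross z (\<zeta> = \<xi>)] f g"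
      unfolding L by blast
    then show ?thesis
      by (intro exI[of _ "[Cross x (\<zeta> = \<eta>), Cross y ((\<zeta> = \<xi>) = \<eta>), Cross z (\<zeta> = \<xi>)]"] exI[of _ f] exI[of _ g]) auto
  qed
qed

lemma move_cross_handle: "block_move TYPE('n) TYPE('p::group_add)
    [Cross () (\<zeta> = \<eta>), Cross () ((\<zeta> = \<xi>) = \<eta>), Cross () (\<zeta> = \<xi>)] [Handle () \<xi> () \<eta>, Cross () \<zeta>]"
proof (rule block_move_local)
  fix hn :: 'n and L :: "'n block list"
  assume *: "map shape_of L = [Cross () (\<zeta> = \<eta>), Cross () ((\<zeta> = \<xi>) = \<eta>), Cross () (\<zeta> = \<xi>)]" "good hn L"
  then obtain x y z where L: "L = [Cross x (\<zeta> = \<eta>), Cross y ((\<zeta> = \<xi>) = \<eta>), Cross z (\<zeta> = \<xi>)]"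
    by (auto simp: map_eq_Cons_conv)
  have "good hn [Handle x \<xi> y \<eta>, Cross z \<zeta>]" using *(2) L by simp
  from local_iso_sym[OF local_iso_handle_cross[OF this]] obtain f g :: "('n \<Rightarrow> 'p) \<Rightarrow> 'n \<Rightarrow> 'p"
    where "local_iso hn L [Handle x \<xi> y \<eta>, Cross z \<zeta>] f g"
    unfolding L by blast
  then show "\<exists>L' (f :: ('n \<Rightarrow> 'p) \<Rightarrow> 'n \<Rightarrow> 'p) g. map shape_of L' = [Handle () \<xi> () \<eta>, Cross () \<zeta>] \<and> local_iso hn L L' f g"
    by (intro exI[of _ "[Handle x \<xi> y \<eta>, Cross z \<zeta>]"] exI[of _ f] exI[of _ g]) auto
qed

section \<open>The standard presentation\<close>

text \<open>
  The defining word of a Seifert group as a block word.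
\<close>

definition std_blocks :: "seifert \<Rightarrow> seifert_gen block list" where
  "std_blocks N = Fib (euler N) # map (\<lambda>k. Cone (Gs k) (fst (pairs N ! k)) (snd (pairs N ! k))) [0..<num_s N] @
    (if base_orientable (stype N)
     then map (\<lambda>i. Handle (Gv (2 * i)) (seifert_sign (stype N) (2 * i) = 1) (Gv (2 * i + 1)) (seifert_sign (stype N) (2 * i + 1) = 1)) [0..<genus N]
     else map (\<lambda>j. Cross (Gv j) (seifert_sign (stype N) j = 1)) [0..<genus N])"

lemma seifert_sign_cases: "seifert_sign t j = 1 \<or> seifert_sign t j = -1"
  by (auto simp: seifert_sign_def split: seifert_type.split)

lemma wval_concat: "wval p (concat ws) = sum_list (map (wval p) ws)"
  by (induction ws) auto

lemma words_concat: "concat ws \<in> words X \<longleftrightarrow> (\<forall>w\<in>set ws. w \<in> words X)"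
  by (induction ws) auto

lemma letter_power_words [simp]: "x \<in> X \<Longrightarrow> letter_power x k \<in> words X"
  by (auto simp: letter_power_def words_def)

lemma seifert_rels_words: "seifert_rels N \<subseteq> words (seifert_gens N)"
proof -
  have "map (\<lambda>k. (Gs k, True)) [0..<num_s N] \<in> words (seifert_gens N)"
    by (auto simp: words_def seifert_gens_def)
  moreover have "surface_word N \<in> words (seifert_gens N)"
    by (auto simp: surface_word_def words_concat letter_commutator_def seifert_gens_def num_v_def)
  ultimately show ?thesis
    by (auto simp: seifert_rels_def letter_commutator_def seifert_gens_def)
qed

lemma acts_iff: "acts h \<sigma> g \<longleftrightarrow> g + (h + (- g + - flip \<sigma> h)) = 0"
  by (simp only: acts_def eq_iff_diff_eq_0[of _ "flip \<sigma> h"] group_norm)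

lemma wval_sign_rel: 
  "wval p ([(v, True), (h, True), (v, False)] @ letter_power h (- seifert_sign t j)) = 0 \<longleftrightarrow>
   acts (p h) (seifert_sign t j = 1) (p v)"
  using seifert_sign_cases[of t j]
  by (auto simp: acts_iff group_norm simp del: add_uminus_conv_diff)

lemma sat_seifert_rels:
  "sat (seifert_rels N) p \<longleftrightarrow>
    (\<forall>k<num_s N. acts (p Gh) True (p (Gs k)) \<and> zmul (fst (pairs N ! k)) (p (Gs k)) + zmul (snd (pairs N ! k)) (p Gh) = 0) \<and>
    (\<forall>j<num_v N. acts (p Gh) (seifert_sign (stype N) j = 1) (p (Gv j))) \<and>
    - zmul (euler N) (p Gh) + (sum_list (map (\<lambda>k. p (Gs k)) [0..<num_s N]) + wval p (surface_word N)) = 0"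
proof -
  have "wval p (map (\<lambda>k. (Gs k, True)) ks) = sum_list (map (\<lambda>k. p (Gs k)) ks)" for ks
    by (induction ks) auto
  then show ?thesis
    unfolding sat_def seifert_rels_def ball_Un wval_sign_rel[symmetric]
    by (auto simp: acts_iff[where \<sigma> = True] letter_commutator_def group_norm simp del: add_uminus_conv_diff)
qed

lemma all_less_double: "(\<forall>j<2 * g. P j) \<longleftrightarrow> (\<forall>i<g. P (2 * i) \<and> P (2 * i + 1))" for g :: nat
proof
  assume a: "\<forall>i<g. P (2 * i) \<and> P (2 * i + 1)"
  show "\<forall>j<2 * g. P j"
  proof (intro allI impI)
    fix j assume "j < 2 * g"
    then have "P (2 * (j div 2)) \<and> P (2 * (j div 2) + 1)" using a by auto
    then show "P j" by (cases "even j") (auto elim!: evenE oddE)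
  qed
qed auto

text \<open>
  The standard presentation and its block word have the same solutions, so classifying block
  words classifies the groups.
\<close>

lemma sat_seifert_iff: "sat (seifert_rels N) p \<longleftrightarrow> block_system Gh (std_blocks N) p"
proof -
  have s: "wval p (surface_word N) = bsum (p Gh) p (if base_orientable (stype N)
     then map (\<lambda>i. Handle (Gv (2 * i)) (seifert_sign (stype N) (2 * i) = 1) (Gv (2 * i + 1)) (seifert_sign (stype N) (2 * i + 1) = 1)) [0..<genus N]
     else map (\<lambda>j. Cross (Gv j) (seifert_sign (stype N) j = 1)) [0..<genus N])"
    by (simp add: surface_word_def wval_concat o_def letter_commutator_def zmul_double[of 1, simplified] add.assoc diff_conv_add_uminus del: add_uminus_conv_diff)
  have v: "(\<forall>j<num_v N. P j) \<longleftrightarrow> (if base_orientable (stype N) then (\<forall>i<genus N. P (2 * i) \<and> P (2 * i + 1)) else (\<forall>j<genus N. P j))" for P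
  proof -
    show ?thesis by (simp add: num_v_def all_less_double)
  qed
  show ?thesis
    unfolding sat_seifert_rels s v block_system_def std_blocks_def
    by (cases "base_orientable (stype N)") (simp_all add: o_def ball_Un, auto)
qed

lemma names_std_blocks: "names (std_blocks N) = map Gs [0..<num_s N] @ map Gv [0..<num_v N]"
proof -
  have "concat (map (\<lambda>i. [Gv (2 * i), Gv (2 * i + 1)]) [0..<g]) = map Gv [0..<2 * g]" for g
    by (induction g) auto
  then show ?thesis
    by (auto simp: std_blocks_def num_v_def o_def)
qed

lemma good_std_blocks: "good Gh (std_blocks N)"
  unfolding names_std_blocks by (auto simp: distinct_map inj_on_def)

lemma gens_std_blocks: "gens Gh (std_blocks N) = seifert_gens N"
  unfolding names_std_blocks by (auto simp: seifert_gens_def)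

lemma blocks_rename:
  "map shape_of E = map shape_of E' \<Longrightarrow> map r (names E') = names E \<Longrightarrow> E = map (map_block r) E'"
proof (induction E' arbitrary: E)
  case (Cons B' E')
  then obtain B F where E: "E = B # F" "shape_of B = shape_of B'" "map shape_of F = map shape_of E'"
    by (auto simp: map_eq_Cons_conv)
  have "length (bnames B) = length (bnames B')" using E(2) by (cases B'; auto)
  then have "map r (bnames B') = bnames B" "map r (names E') = names F"
    using Cons.prems(2) E(1) by auto
  then show ?case using Cons.IH[OF E(3)] E by (cases B'; auto)
qed simp

lemma exists_renaming:
  assumes "distinct xs" "length xs = length ys"
  obtains r where "map r xs = ys"
proof
  show "map (\<lambda>x. the (map_of (zip xs ys) x)) xs = ys"
    using assms by (intro nth_equalityI) (auto simp: map_of_zip_nth)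
qed

lemma length_names: "map shape_of E = map shape_of E' \<Longrightarrow> length (names E) = length (names E')"
proof (induction E' arbitrary: E)
  case (Cons B' E')
  then obtain B F where E: "E = B # F" "shape_of B = shape_of B'" "map shape_of F = map shape_of E'"
    by (auto simp: map_eq_Cons_conv)
  have "length (bnames B) = length (bnames B')" using E(2) by (cases B'; auto)
  then show ?case using Cons.IH[OF E(3)] E(1) by simp
qed simp

lemma bval_map_block: "bval h p (map_block r B) = bval h (p \<circ> r) B" "bok h p (map_block r B) \<longleftrightarrow> bok h (p \<circ> r) B"
  by (cases B; simp)+

lemma block_system_map: "block_system (r hn) (map (map_block r) E) p \<longleftrightarrow> block_system hn E (p \<circ> r)"
  by (simp add: block_system_def bval_map_block o_def)

lemma eqv_rename:
  fixes hn :: 'n and hn' :: 'm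
  assumes sh: "map shape_of E = map shape_of E'" and good: "good hn E" "good hn' E'"
  shows "eqv (gens hn E) (block_system hn E :: ('n \<Rightarrow> 'p::group_add) \<Rightarrow> bool) (gens hn' E') (block_system hn' E')"
proof -
  obtain r where r: "map r (hn' # names E') = hn # names E"
    using exists_renaming[of "hn' # names E'" "hn # names E"] good(2) length_names[OF sh] by auto
  obtain r' where r': "map r' (hn # names E) = hn' # names E'"
    using exists_renaming[of "hn # names E" "hn' # names E'"] good(1) length_names[OF sh] by auto
  have E: "E = map (map_block r) E'" and E': "E' = map (map_block r') E"
    using blocks_rename[OF sh, of r] blocks_rename[OF sh[symmetric], of r'] r r' by auto
  have g: "gens hn E = set (hn # names E)" "gens hn' E' = set (hn' # names E')" by auto
  have "map r' (map r (hn' # names E')) = hn' # names E'" unfolding r r' by (rule HOL.refl)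
  then have "map (r' \<circ> r) (hn' # names E') = map id (hn' # names E')" by (simp only: map_map list.map_id)
  then have inv: "r' (r z) = z" if "z \<in> gens hn' E'" for z
    unfolding map_eq_conv using that g(2) by (metis comp_apply id_apply)
  have "map r (map r' (hn # names E)) = hn # names E" unfolding r r' by (rule HOL.refl)
  then have "map (r \<circ> r') (hn # names E) = map id (hn # names E)" by (simp only: map_map list.map_id)
  then have inv': "r (r' z) = z" if "z \<in> gens hn E" for z
    unfolding map_eq_conv using that g(1) by (metis comp_apply id_apply)
  have im: "r z \<in> gens hn E" if "z \<in> gens hn' E'" for z
    using that unfolding g r[symmetric] by (metis image_eqI list.set_map)
  have im': "r' z \<in> gens hn' E'" if "z \<in> gens hn E" for z
    using that unfolding g r'[symmetric] by (metis image_eqI list.set_map)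
  have hn: "hn = r hn'" "hn' = r' hn" using r r' by auto
  show ?thesis
  proof (rule eqvI[where f = "\<lambda>p. p \<circ> r" and g = "\<lambda>q. q \<circ> r'"])
    fix p :: "'n \<Rightarrow> 'p" assume "block_system hn E p"
    then have "block_system (r hn') (map (map_block r) E') p" using E hn(1) by simp
    then show "block_system hn' E' (p \<circ> r)" unfolding block_system_map .
  next
    fix q :: "'m \<Rightarrow> 'p" assume "block_system hn' E' q"
    then have "block_system (r' hn) (map (map_block r') E) q" using E' hn(2) by simp
    then show "block_system hn E (q \<circ> r')" unfolding block_system_map .
  next
    show "wordfun (gens hn E) (\<lambda>p :: 'n \<Rightarrow> 'p. (p \<circ> r) z)" if "z \<in> gens hn' E'" for z
      unfolding o_apply by (rule wordfun_gen) (rule im[OF that])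
    show "wordfun (gens hn' E') (\<lambda>p :: 'm \<Rightarrow> 'p. (p \<circ> r') z)" if "z \<in> gens hn E" for z
      unfolding o_apply by (rule wordfun_gen) (rule im'[OF that])
  qed (simp_all only: o_apply inv inv')
qed

lemma has_shape_std:
  fixes S :: "('x \<Rightarrow> 'p::group_add) \<Rightarrow> bool"
  assumes "has_shape hn X S (image_mset shape_of (mset (std_blocks N)))"
  shows "eqv X S (seifert_gens N) (sat (seifert_rels N))"
proof -
  have "has_shape hn X S (mset (map shape_of (std_blocks N)) + {#})" using assms by simp
  then obtain L C where L: "map shape_of L = map shape_of (std_blocks N)" "image_mset shape_of (mset C) = {#}" "good hn (L @ C)"
    "eqv X S (gens hn (L @ C)) (block_system hn (L @ C))" by (rule has_shapeE)
  have C: "C = []" using L(2) by simp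
  have "eqv X S (gens Gh (std_blocks N)) (block_system Gh (std_blocks N))"
    using eqv_trans[OF L(4) eqv_rename[OF _ L(3) good_std_blocks, of N]] L(1) C by simp
  then have e: "eqv X S (seifert_gens N) (block_system Gh (std_blocks N))" by (simp only: gens_std_blocks)
  show ?thesis by (rule eqv_trans[OF e]) (rule eqv_cong, simp add: sat_seifert_iff)
qed

section \<open>Double covers of words made of blocks\<close>

text \<open>
  Blocks of the word whose double cover is taken. The truth value after a sign tells whether the
  generator changes the sheet. Two exceptional generators that both change the sheet are treated
  together in \<open>LPair\<close>, so that reading any block leads back to the sheet where it
  began.
\<close>

datatype 'a lblock = LFib int | LCone 'a int int | LPair 'a int int 'a int int
  | LCross 'a bool bool | LHandle 'a bool bool 'a bool bool

text \<open>
  The sign of a lifted generator. Here \<open>\<theta>\<close> is the sign of the odd generator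
  \<open>t\<close>; a generator that changes the sheet is lifted to a product with
  \<open>t\<close> or its inverse.
\<close>

definition eff :: "bool \<Rightarrow> bool \<Rightarrow> bool \<Rightarrow> bool" where
  "eff \<theta> f \<sigma> = (if f then \<sigma> = \<theta> else \<sigma>)"

abbreviation sgn_mul :: "bool \<Rightarrow> int \<Rightarrow> int" where
  "sgn_mul \<theta> b \<equiv> (if \<theta> then b else - b)"

primrec llift :: "'a lblock \<Rightarrow> ('a \<times> bool) list" where
  "llift (LFib e) = []"
| "llift (LCone s a b) = [(s, False), (s, True)]"
| "llift (LPair s a b s' a' b') = [(s, False), (s, True), (s', False), (s', True)]"
| "llift (LCross v \<sigma> f) = [(v, False), (v, True)]"
| "llift (LHandle x \<sigma> f y \<tau> g) = [(x, False), (x, True), (y, False), (y, True)]"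

text \<open>
  The value of a block read on sheet \<open>i\<close>. The fibre on sheet 1 is the conjugate of
  \<open>h\<close> by \<open>t\<close>, that is \<open>h\<close> or its inverse.
\<close>

primrec lval :: "bool \<Rightarrow> bool \<Rightarrow> 'p::group_add \<Rightarrow> ('a \<times> bool \<Rightarrow> 'p) \<Rightarrow> 'a lblock \<Rightarrow> 'p" where
  "lval i \<theta> h p (LFib e) = - zmul (if i then sgn_mul \<theta> e else e) h"
| "lval i \<theta> h p (LCone s a b) = p (s, i)"
| "lval i \<theta> h p (LPair s a b s' a' b') = p (s, i) + p (s', \<not> i)"
| "lval i \<theta> h p (LCross v \<sigma> f) = p (v, i) + p (v, i \<noteq> f)"
| "lval i \<theta> h p (LHandle x \<sigma> f y \<tau> g) = p (x, i) + p (y, i \<noteq> f) - p (x, i \<noteq> g) - p (y, i)"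

text \<open>
  The lifts of the local relators. For a pair of cones that change the sheet, only the product
  of the two lifts of each is a loop around an exceptional fibre of the cover, which halves the
  multiplicity.
\<close>

primrec lok :: "bool \<Rightarrow> 'p::group_add \<Rightarrow> ('a \<times> bool \<Rightarrow> 'p) \<Rightarrow> 'a lblock \<Rightarrow> bool" where
  "lok \<theta> h p (LFib e) \<longleftrightarrow> True"
| "lok \<theta> h p (LCone s a b) \<longleftrightarrow> acts h True (p (s, False)) \<and> acts h True (p (s, True)) \<and>
     zmul a (p (s, False)) + zmul b h = 0 \<and> zmul a (p (s, True)) + zmul (sgn_mul \<theta> b) h = 0"
| "lok \<theta> h p (LPair s a b s' a' b') \<longleftrightarrow> acts h True (p (s, False)) \<and> acts h True (p (s, True)) \<and>
     acts h True (p (s', False)) \<and> acts h True (p (s', True)) \<and>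
     zmul (a div 2) (p (s, False) + p (s, True)) + zmul b h = 0 \<and>
     zmul (a' div 2) (p (s', False) + p (s', True)) + zmul b' h = 0"
| "lok \<theta> h p (LCross v \<sigma> f) \<longleftrightarrow> acts h (eff \<theta> f \<sigma>) (p (v, False)) \<and> acts h (eff \<theta> f \<sigma>) (p (v, True))"
| "lok \<theta> h p (LHandle x \<sigma> f y \<tau> g) \<longleftrightarrow> acts h (eff \<theta> f \<sigma>) (p (x, False)) \<and> acts h (eff \<theta> f \<sigma>) (p (x, True)) \<and>
     acts h (eff \<theta> g \<tau>) (p (y, False)) \<and> acts h (eff \<theta> g \<tau>) (p (y, True))"

abbreviation lsum :: "bool \<Rightarrow> bool \<Rightarrow> 'p::group_add \<Rightarrow> ('a \<times> bool \<Rightarrow> 'p) \<Rightarrow> 'a lblock list \<Rightarrow> 'p" where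
  "lsum i \<theta> h p D \<equiv> sum_list (map (lval i \<theta> h p) D)"

abbreviation lnames :: "'a lblock list \<Rightarrow> ('a \<times> bool) list" where
  "lnames D \<equiv> concat (map llift D)"

text \<open>
  The two lifts of a block \<open>B\<close> stand at the two ends of a subword with value
  \<open>c\<close>, the second one inverted if \<open>\<delta>\<close> is false. The property
  says that a change of variables, which may involve \<open>c\<close>, turns them into honest
  blocks \<open>L\<close> before and \<open>R\<close> after \<open>c\<close>. Blocks that change
  the sheet have their generators spread over both ends, so this is where the topology of the
  cover is found.
\<close>

definition absorbs :: "'p::group_add itself \<Rightarrow> bool \<Rightarrow> bool \<Rightarrow> 'a lblock \<Rightarrow> ('a \<times> bool) block list \<Rightarrow> ('a \<times> bool) block list \<Rightarrow> bool" where
  "absorbs _ \<delta> \<theta> B L R \<longleftrightarrow> mset (names (L @ R)) = mset (llift B) \<and> (\<exists>f g :: 'p \<Rightarrow> ('a \<times> bool \<Rightarrow> 'p) \<Rightarrow> 'a \<times> bool \<Rightarrow> 'p.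
    (\<forall>c p z. z \<notin> set (llift B) \<longrightarrow> f c p z = p z \<and> g c p z = p z) \<and>
    (\<forall>X c. wordfun X c \<and> set (llift B) \<subseteq> X \<longrightarrow>
       (\<forall>z\<in>set (llift B). wordfun X (\<lambda>p. f (c p) p z) \<and> wordfun X (\<lambda>p. g (c p) p z))) \<and>
    (\<forall>h c p. acts h True c \<and> lok \<theta> h p B \<longrightarrow> (\<forall>E\<in>set (L @ R). bok h (f c p) E) \<and>
       bsum h (f c p) L + (c + bsum h (f c p) R) = lval False \<theta> h p B + (c + flip \<delta> (lval True \<theta> h p B)) \<and>
       (\<forall>z\<in>set (llift B). g c (f c p) z = p z)) \<and>
    (\<forall>h c p. acts h True c \<and> (\<forall>E\<in>set (L @ R). bok h p E) \<longrightarrow> lok \<theta> h (g c p) B \<and>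
       lval False \<theta> h (g c p) B + (c + flip \<delta> (lval True \<theta> h (g c p) B)) = bsum h p L + (c + bsum h p R) \<and>
       (\<forall>z\<in>set (llift B). f c (g c p) z = p z)))"

lemma absorbsI:
  fixes f g :: "'p::group_add \<Rightarrow> ('a \<times> bool \<Rightarrow> 'p) \<Rightarrow> 'a \<times> bool \<Rightarrow> 'p"
  assumes "mset (names (L @ R)) = mset (llift B)"
    and "\<And>c p z. z \<notin> set (llift B) \<Longrightarrow> f c p z = p z \<and> g c p z = p z"
    and "\<And>X c. wordfun X c \<Longrightarrow> set (llift B) \<subseteq> X \<Longrightarrow>
       (\<forall>z\<in>set (llift B). wordfun X (\<lambda>p. f (c p) p z) \<and> wordfun X (\<lambda>p. g (c p) p z))"
    and "\<And>h c p. acts h True c \<Longrightarrow> lok \<theta> h p B \<Longrightarrow> (\<forall>E\<in>set (L @ R). bok h (f c p) E) \<and>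
       bsum h (f c p) L + (c + bsum h (f c p) R) = lval False \<theta> h p B + (c + flip \<delta> (lval True \<theta> h p B)) \<and>
       (\<forall>z\<in>set (llift B). g c (f c p) z = p z)"
    and "\<And>h c p. acts h True c \<Longrightarrow> \<forall>E\<in>set (L @ R). bok h p E \<Longrightarrow> lok \<theta> h (g c p) B \<and>
       lval False \<theta> h (g c p) B + (c + flip \<delta> (lval True \<theta> h (g c p) B)) = bsum h p L + (c + bsum h p R) \<and>
       (\<forall>z\<in>set (llift B). f c (g c p) z = p z)"
  shows "absorbs TYPE('p) \<delta> \<theta> B L R"
  unfolding absorbs_def
proof (rule conjI[OF assms(1)], rule exI[of _ f], rule exI[of _ g], intro conjI)
  show "\<forall>c p z. z \<notin> set (llift B) \<longrightarrow> f c p z = p z \<and> g c p z = p z"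
    by (intro allI impI) (rule assms(2))
qed (intro allI impI, elim conjE, rule assms(3-5), assumption+)+

subsection \<open>Joining the two sheets in the same direction\<close>

text \<open>
  The blocks \<open>L\<close> and \<open>R\<close> when both lifts are read in the same
  direction.
\<close>

fun parallel_lifts :: "bool \<Rightarrow> 'a lblock \<Rightarrow> ('a \<times> bool) block list \<times> ('a \<times> bool) block list" where
  "parallel_lifts \<theta> (LFib e) = ([Fib e], [Fib (sgn_mul \<theta> e)])"
| "parallel_lifts \<theta> (LCone s a b) = ([Cone (s, False) a b], [Cone (s, True) a (sgn_mul \<theta> b)])"
| "parallel_lifts \<theta> (LPair s a b s' a' b') = ([], [Handle (s, False) True (s', True) True,
      Cone (s, True) (a div 2) b, Cone (s', False) (a' div 2) b'])"
| "parallel_lifts \<theta> (LCross v \<sigma> f) = ([Cross (v, False) (eff \<theta> f \<sigma>)], [Cross (v, True) (eff \<theta> f \<sigma>)])"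
| "parallel_lifts \<theta> (LHandle x \<sigma> f y \<tau> g) =
    (if \<not> f \<and> \<not> g then ([Handle (x, False) \<sigma> (y, False) \<tau>], [Handle (x, True) \<sigma> (y, True) \<tau>])
     else if f \<and> g then ([], [Handle (x, True) (eff \<theta> f \<sigma>) (y, False) (eff \<theta> g \<tau>), Handle (x, False) (eff \<theta> f \<sigma>) (y, True) (eff \<theta> g \<tau>)])
     else ([], [Handle (y, False) (eff \<theta> g \<tau>) (x, True) (eff \<theta> f \<sigma>), Handle (x, False) (eff \<theta> f \<sigma>) (y, True) (eff \<theta> g \<tau>)]))"

lemma absorbs_trivial:
  assumes "mset (names (L @ R)) = mset (llift B)"
    and "\<And>h p :: 'a \<times> bool \<Rightarrow> 'p::group_add. lok \<theta> h p B \<longleftrightarrow> (\<forall>E\<in>set (L @ R). bok h p E)"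
    and "\<And>h p :: 'a \<times> bool \<Rightarrow> 'p. bsum h p L = lval False \<theta> h p B"
    and "\<And>h p :: 'a \<times> bool \<Rightarrow> 'p. bsum h p R = flip \<delta> (lval True \<theta> h p B)"
  shows "absorbs TYPE('p) \<delta> \<theta> B L R"
  by (rule absorbsI[where f = "\<lambda>_ p. p" and g = "\<lambda>_ p. p"])
    (use assms in \<open>auto intro: wordfun_gen\<close>)

lemma zmul_conj_same:
  assumes "acts h True g" "zmul a s + zmul b h = 0"
  shows "zmul a (g + (s + - g)) + zmul b h = 0" "zmul a (- g + (s + g)) + zmul b h = 0"
  using zmul_conj_inv(1)[of a s b h True g] zmul_conj_inv(1)[of a s b h True "- g"] assms by simp_all

text \<open>
  With \<open>x\<close> and \<open>y\<close> for the two letters read on sheet 0 and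
  \<open>c\<^sub>1\<close>, \<open>c\<^sub>2\<close> for the loops around the exceptional
  fibres, the lifts are \<open>x y\<close> and \<open>x\<^bsup>-1\<^esup> c\<^sub>1 c\<^sub>2
  y\<^bsup>-1\<^esup>\<close>. The identity \<open>x y c x\<^bsup>-1\<^esup> y\<^bsup>-1\<^esup>
  = c [c\<^bsup>-1\<^esup> x, y c]\<close> produces a handle: the cover of a disc branched over
  two points is an annulus that joins the sheets.
\<close>

lemma absorbs_pair:
  assumes "s \<noteq> s'"
  shows "absorbs TYPE('p::group_add) True \<theta> (LPair s a b s' a' b') [] [Handle (s, False) True (s', True) True,
      Cone (s, True) (a div 2) b, Cone (s', False) (a' div 2) b']"
proof -
  let ?f = "\<lambda>c (p :: _ \<Rightarrow> 'p). p((s, False) := - c + p (s, False), (s', True) := p (s', True) + c,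
    (s, True) := p (s', True) + ((p (s, False) + p (s, True)) + - p (s', True)),
    (s', False) := p (s', True) + p (s', False))"
  let ?y = "\<lambda>c (q :: _ \<Rightarrow> 'p). q (s', True) + - c"
  let ?g = "\<lambda>c (q :: _ \<Rightarrow> 'p). q((s, False) := c + q (s, False), (s', True) := ?y c q,
    (s, True) := - (c + q (s, False)) + (- ?y c q + (q (s, True) + ?y c q)),
    (s', False) := - ?y c q + q (s', False))"
  show ?thesis
  proof (rule absorbsI[where f = ?f and g = ?g])
    fix X and c :: "(_ \<Rightarrow> 'p) \<Rightarrow> 'p" assume c: "wordfun X c" "set (llift (LPair s a b s' a' b')) \<subseteq> X"
    then show "\<forall>z\<in>set (llift (LPair s a b s' a' b')). wordfun X (\<lambda>p. ?f (c p) p z) \<and> wordfun X (\<lambda>p. ?g (c p) p z)"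
      using assms by (auto simp del: add_uminus_conv_diff intro!: wordfun_intros c(1))
  next
    fix h c and p :: "_ \<Rightarrow> 'p" assume a: "acts h True c" "lok \<theta> h p (LPair s a b s' a' b')"
    have "zmul (a' div 2) (p (s', True) + p (s', False)) + zmul b' h = 0"
      using zmul_conj_same(1)[of h "p (s', True)" "a' div 2" "p (s', False) + p (s', True)" b'] a(2)
      by (simp add: group_norm del: add_uminus_conv_diff)
    moreover have "zmul (a div 2) (p (s', True) + (p (s, False) + (p (s, True) + - p (s', True)))) + zmul b h = 0"
      using zmul_conj_same(1)[of h "p (s', True)" "a div 2" "p (s, False) + p (s, True)" b] a(2)
      by (simp add: group_norm del: add_uminus_conv_diff)
    ultimately show "(\<forall>E\<in>set ([] @ [Handle (s, False) True (s', True) True, Cone (s, True) (a div 2) b, Cone (s', False) (a' div 2) b']). bok h (?f c p) E) \<and>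
       bsum h (?f c p) [] + (c + bsum h (?f c p) [Handle (s, False) True (s', True) True, Cone (s, True) (a div 2) b, Cone (s', False) (a' div 2) b']) =
         lval False \<theta> h p (LPair s a b s' a' b') + (c + flip True (lval True \<theta> h p (LPair s a b s' a' b'))) \<and>
       (\<forall>z\<in>set (llift (LPair s a b s' a' b')). ?g c (?f c p) z = p z)"
      using a assms by (auto simp: local_simps simp del: add_uminus_conv_diff)
  next
    fix h c and p :: "_ \<Rightarrow> 'p" assume a: "acts h True c" "\<forall>E\<in>set ([] @ [Handle (s, False) True (s', True) True, Cone (s, True) (a div 2) b, Cone (s', False) (a' div 2) b']). bok h p E"
    have y: "acts h True (?y c p)" using a by (auto simp: local_simps simp del: add_uminus_conv_diff)
    have "zmul (a' div 2) (- ?y c p + (p (s', False) + ?y c p)) + zmul b' h = 0"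
      by (rule zmul_conj_same(2)[OF y]) (use a in simp)
    moreover have "zmul (a div 2) (- ?y c p + (p (s, True) + ?y c p)) + zmul b h = 0"
      by (rule zmul_conj_same(2)[OF y]) (use a in simp)
    ultimately show "lok \<theta> h (?g c p) (LPair s a b s' a' b') \<and>
       lval False \<theta> h (?g c p) (LPair s a b s' a' b') + (c + flip True (lval True \<theta> h (?g c p) (LPair s a b s' a' b'))) =
        bsum h p [] + (c + bsum h p [Handle (s, False) True (s', True) True, Cone (s, True) (a div 2) b, Cone (s', False) (a' div 2) b']) \<and>
       (\<forall>z\<in>set (llift (LPair s a b s' a' b')). ?f c (?g c p) z = p z)"
      using a assms by (auto simp: local_simps simp del: add_uminus_conv_diff)
  qed (use assms in auto)
qed

text \<open>
  The identity behind this is \<open>y x c x y = y\<^sub>1 y\<^sub>1 c z z\<close> with \<open>z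
  = (x c)\<^bsup>-1\<^esup>\<close> and \<open>y\<^sub>1 = y x c x\<close>.
\<close>

lemma absorbs_cross:
  "absorbs TYPE('p::group_add) True \<theta> (LCross v \<sigma> True) [Cross (v, False) (eff \<theta> True \<sigma>)] [Cross (v, True) (eff \<theta> True \<sigma>)]"
  by (rule absorbsI[where f = "\<lambda>c (p :: _ \<Rightarrow> 'p). p((v, False) := p (v, False) + (p (v, True) + (c + p (v, True))), (v, True) := - c + - p (v, True))"
      and g = "\<lambda>c (q :: _ \<Rightarrow> 'p). q((v, False) := q (v, False) + (c + (q (v, True) + q (v, True))), (v, True) := - q (v, True) + - c)"])
    (auto simp: local_simps simp del: add_uminus_conv_diff intro!: wordfun_intros)

text \<open>
  The inner letters form \<open>x\<^bsup>-1\<^esup> y\<^bsup>-1\<^esup> c x y\<close>, which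
  equals \<open>c\<close> times a commutator; the outer ones then make a second commutator in
  the same way around this element \<open>E\<close>. The same two steps, with other letters
  inverted, give the next two lemmas.
\<close>

lemma absorbs_handle_TT:
  assumes "x \<noteq> y"
  shows "absorbs TYPE('p::group_add) True \<theta> (LHandle x \<sigma> True y \<tau> True) []
    [Handle (x, True) (eff \<theta> True \<sigma>) (y, False) (eff \<theta> True \<tau>), Handle (x, False) (eff \<theta> True \<sigma>) (y, True) (eff \<theta> True \<tau>)]"
proof -
  define E where "E c p = - p (x, True) + (- p (y, False) + (c + (p (x, True) + p (y, False))))" for c and p :: "_ \<Rightarrow> 'p"
  define E' where "E' c p = c + (p (x, True) + (p (y, False) + (- p (x, True) + - p (y, False))))" for c and p :: "_ \<Rightarrow> 'p"
  show ?thesis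
  by (rule absorbsI[where f = "\<lambda>c (p :: _ \<Rightarrow> 'p). p((x, True) := - c + - p (x, True), (y, False) := - p (y, False) + c,
        (x, False) := - E c p + p (x, False), (y, True) := p (y, True) + E c p)"
      and g = "\<lambda>c (p :: _ \<Rightarrow> 'p). p((x, True) := - p (x, True) + - c, (y, False) := c + - p (y, False),
        (x, False) := E' c p + p (x, False), (y, True) := p (y, True) + - E' c p)"])
    (use assms in \<open>cases "eff \<theta> True \<sigma>"; cases "eff \<theta> True \<tau>"; auto simp: E_def E'_def local_simps simp del: add_uminus_conv_diff intro!: wordfun_intros\<close>)+
qed

lemma absorbs_handle_TF:
  assumes "x \<noteq> y"
  shows "absorbs TYPE('p::group_add) True \<theta> (LHandle x \<sigma> True y \<tau> False) []
    [Handle (y, False) (eff \<theta> False \<tau>) (x, True) (eff \<theta> True \<sigma>), Handle (x, False) (eff \<theta> True \<sigma>) (y, True) (eff \<theta> False \<tau>)]"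
proof -
  define E where "E c p = - p (y, False) + (c + (p (x, True) + (p (y, False) + - p (x, True))))" for c and p :: "_ \<Rightarrow> 'p"
  define E' where "E' c p = c + (p (y, False) + (p (x, True) + (- p (y, False) + - p (x, True))))" for c and p :: "_ \<Rightarrow> 'p"
  show ?thesis
  by (rule absorbsI[where f = "\<lambda>c (p :: _ \<Rightarrow> 'p). p((y, False) := - c + (- p (y, False) + c), (x, True) := p (x, True) + c,
        (x, False) := - E c p + p (x, False))"
      and g = "\<lambda>c (p :: _ \<Rightarrow> 'p). p((y, False) := c + (- p (y, False) + - c), (x, True) := p (x, True) + - c,
        (x, False) := E' c p + p (x, False))"])
    (use assms in \<open>cases "eff \<theta> True \<sigma>"; cases "eff \<theta> False \<tau>"; auto simp: E_def E'_def local_simps simp del: add_uminus_conv_diff intro!: wordfun_intros\<close>)+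
qed

lemma absorbs_handle_FT:
  assumes "x \<noteq> y"
  shows "absorbs TYPE('p::group_add) True \<theta> (LHandle x \<sigma> False y \<tau> True) []
    [Handle (y, False) (eff \<theta> True \<tau>) (x, True) (eff \<theta> False \<sigma>), Handle (x, False) (eff \<theta> False \<sigma>) (y, True) (eff \<theta> True \<tau>)]"
proof -
  define E where "E c p = p (y, False) + (- p (x, True) + (- p (y, False) + (c + p (x, True))))" for c and p :: "_ \<Rightarrow> 'p"
  define E' where "E' c p = c + (p (y, False) + (p (x, True) + (- p (y, False) + - p (x, True))))" for c and p :: "_ \<Rightarrow> 'p"
  show ?thesis
  by (rule absorbsI[where f = "\<lambda>c (p :: _ \<Rightarrow> 'p). p((y, False) := - c + p (y, False), (x, True) := - p (x, True),
        (x, False) := - E c p + (p (x, False) + E c p), (y, True) := p (y, True) + E c p)"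
      and g = "\<lambda>c (p :: _ \<Rightarrow> 'p). p((y, False) := c + p (y, False), (x, True) := - p (x, True),
        (x, False) := E' c p + (p (x, False) + - E' c p), (y, True) := p (y, True) + - E' c p)"])
    (use assms in \<open>cases "eff \<theta> False \<sigma>"; cases "eff \<theta> True \<tau>"; auto simp: E_def E'_def local_simps simp del: add_uminus_conv_diff intro!: wordfun_intros\<close>)+
qed

lemma absorbs_parallel:
  assumes "distinct (llift B)"
  shows "absorbs TYPE('p::group_add) True \<theta> B (fst (parallel_lifts \<theta> B)) (snd (parallel_lifts \<theta> B))"
proof (cases B)
  case (LCross v \<sigma> f)
  have "absorbs TYPE('p) True \<theta> (LCross v \<sigma> False) [Cross (v, False) \<sigma>] [Cross (v, True) \<sigma>]"
    by (rule absorbs_trivial) (auto simp: eff_def)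
  then show ?thesis
    using LCross absorbs_cross by (cases f) (simp_all add: eff_def)
next
  case (LHandle x \<sigma> f y \<tau> g)
  then have "x \<noteq> y" using assms by auto
  note handles = absorbs_handle_TT[OF this] absorbs_handle_TF[OF this] absorbs_handle_FT[OF this]
  have "absorbs TYPE('p) True \<theta> (LHandle x \<sigma> False y \<tau> False) [Handle (x, False) \<sigma> (y, False) \<tau>] [Handle (x, True) \<sigma> (y, True) \<tau>]"
    by (rule absorbs_trivial) (auto simp: eff_def)
  then show ?thesis
    unfolding LHandle by (cases f; cases g) (simp_all add: handles)
next
  case (LPair s a b s' a' b')
  then show ?thesis using absorbs_pair[of s s'] assms by auto
qed (auto intro!: absorbs_trivial)

subsection \<open>Joining the two sheets in opposite directions\<close>

text \<open>
  The blocks \<open>L\<close> and \<open>R\<close> when the lift on sheet 1 is read backwards: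
  neutral blocks are inverted, and a crosscap that changes the sheet becomes the commutator of
  its two lifts, because \<open>x y c x\<^bsup>-1\<^esup> y\<^bsup>-1\<^esup> = c
  [c\<^bsup>-1\<^esup> x, y c]\<close>.
\<close>

fun opposite_lifts :: "bool \<Rightarrow> 'a lblock \<Rightarrow> ('a \<times> bool) block list \<times> ('a \<times> bool) block list" where
  "opposite_lifts \<theta> (LFib e) = ([Fib e], [Fib (- sgn_mul \<theta> e)])"
| "opposite_lifts \<theta> (LCone s a b) = ([Cone (s, False) a b], [Cone (s, True) a (- sgn_mul \<theta> b)])"
| "opposite_lifts \<theta> (LCross v \<sigma> f) = (if f then ([], [Handle (v, False) (eff \<theta> f \<sigma>) (v, True) (eff \<theta> f \<sigma>)])
     else ([Cross (v, False) \<sigma>], [Cross (v, True) \<sigma>]))"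
| "opposite_lifts \<theta> _ = ([], [])"

definition only_crosses :: "'a lblock \<Rightarrow> bool" where
  "only_crosses B \<longleftrightarrow> (case B of LPair _ _ _ _ _ _ \<Rightarrow> False | LHandle _ _ _ _ _ _ \<Rightarrow> False | _ \<Rightarrow> True)"

lemma neg_rel_iff: "- zmul a s + - zmul b h = (0 :: 'p::group_add) \<longleftrightarrow> zmul a s + zmul b h = 0"
  unfolding add_eq_0_iff by (metis minus_minus)

lemma absorbs_opposite:
  assumes "only_crosses B"
  shows "absorbs TYPE('p::group_add) False \<theta> B (fst (opposite_lifts \<theta> B)) (snd (opposite_lifts \<theta> B))"
proof (cases B)
  case (LCone s a b)
  show ?thesis
    unfolding LCone
    by (rule absorbsI[where f = "\<lambda>c (p :: _ \<Rightarrow> 'p). p((s, True) := - p (s, True))" and g = "\<lambda>c (p :: _ \<Rightarrow> 'p). p((s, True) := - p (s, True))"])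
      (auto simp: neg_rel_iff neg_rel_iff[of _ _ "- _", simplified] eq_neg_iff_add_eq_0 simp del: add_uminus_conv_diff intro!: wordfun_intros
        dest: eq_neg_iff_add_eq_0[THEN iffD2])
next
  case (LCross v \<sigma> f)
  show ?thesis
  proof (cases f)
    case True
    show ?thesis
      unfolding LCross
      by (rule absorbsI[where f = "\<lambda>c (p :: _ \<Rightarrow> 'p). p((v, False) := - c + p (v, False), (v, True) := p (v, True) + c)"
        and g = "\<lambda>c (p :: _ \<Rightarrow> 'p). p((v, False) := c + p (v, False), (v, True) := p (v, True) + - c)"])
       (use True in \<open>cases "eff \<theta> f \<sigma>"; auto simp: local_simps simp del: add_uminus_conv_diff intro!: wordfun_intros\<close>)+
  next
    case False
    show ?thesis
      unfolding LCross
      by (rule absorbsI[where f = "\<lambda>c (p :: _ \<Rightarrow> 'p). p((v, True) := - p (v, True))" and g = "\<lambda>c (p :: _ \<Rightarrow> 'p). p((v, True) := - p (v, True))"])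
       (use False in \<open>auto simp: eff_def local_simps simp del: add_uminus_conv_diff intro!: wordfun_intros\<close>)
  qed
qed (use assms in \<open>auto simp: only_crosses_def intro!: absorbs_trivial\<close>)


subsection \<open>Absorbing all blocks\<close>

lemma lval_cong: "(\<And>z. z \<in> set (llift B) \<Longrightarrow> p z = q z) \<Longrightarrow> lval i \<theta> h p B = lval i \<theta> h q B"
  by (cases i; cases B; auto; metis)

lemma lok_cong: "(\<And>z. z \<in> set (llift B) \<Longrightarrow> p z = q z) \<Longrightarrow> lok \<theta> h p B \<longleftrightarrow> lok \<theta> h q B"
  by (cases B) auto

lemma lsum_cong: "(\<And>z. z \<in> set (lnames D) \<Longrightarrow> p z = q z) \<Longrightarrow> lsum i \<theta> h p D = lsum i \<theta> h q D"
  by (rule arg_cong[where f = sum_list], rule map_cong[OF HOL.refl], rule lval_cong) auto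

lemma loks_cong: "(\<And>z. z \<in> set (lnames D) \<Longrightarrow> p z = q z) \<Longrightarrow> (\<forall>B\<in>set D. lok \<theta> h p B) \<longleftrightarrow> (\<forall>B\<in>set D. lok \<theta> h q B)"
  by (rule ball_cong[OF HOL.refl], rule lok_cong) auto

lemma lok_acts: "lok \<theta> h p B \<Longrightarrow> acts h True (lval i \<theta> h p B)"
proof (cases B)
  case (LFib e)
  then show ?thesis using acts_zmul[of h h] by simp
next
  case (LCone s a b)
  then show "lok \<theta> h p B \<Longrightarrow> ?thesis" by (cases i) auto
next
  case (LPair s a b s' a' b')
  then show "lok \<theta> h p B \<Longrightarrow> ?thesis" by (cases i) (auto simp: acts_add_iff)
next
  case (LCross v \<sigma> f)
  then show "lok \<theta> h p B \<Longrightarrow> ?thesis" by (cases i; cases f) (auto simp: acts_add_iff)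
next
  case (LHandle x \<sigma> f y \<tau> g)
  then show "lok \<theta> h p B \<Longrightarrow> ?thesis"
    by (cases i; cases f; cases g; cases "eff \<theta> f \<sigma>"; cases "eff \<theta> g \<tau>") (auto simp: local_simps simp del: add_uminus_conv_diff)
qed

lemma loks_acts: "\<forall>B\<in>set D. lok \<theta> h p B \<Longrightarrow> acts h True (lsum i \<theta> h p D)"
proof (induction D)
  case (Cons B D)
  then show ?case using acts_add[of h True "lval i \<theta> h p B" True "lsum i \<theta> h p D"] lok_acts[of \<theta> h p B i] by auto
qed auto

lemma both_sheets: "(x, False) \<in> X \<Longrightarrow> (x, True) \<in> X \<Longrightarrow> (x, b) \<in> X"
  by (cases b) auto

lemma wordfun_lval: "set (llift B) \<subseteq> X \<Longrightarrow> hn \<in> X \<Longrightarrow> wordfun X (\<lambda>p. lval i \<theta> (p hn) p B)"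
  by (cases i; cases B) (auto intro!: wordfun_intros wordfun_zmul both_sheets simp only: lval.simps llift.simps set_simps insert_subset simp_thms)

lemma wordfun_lsum: "set (lnames D) \<subseteq> X \<Longrightarrow> hn \<in> X \<Longrightarrow> wordfun X (\<lambda>p. lsum i \<theta> (p hn) p D)"
proof (induction D)
  case Nil
  show ?case by (simp add: wordfun_zero)
next
  case (Cons B D)
  then show ?case
    unfolding list.map sum_list.Cons by (intro wordfun_add wordfun_lval) auto
qed

text \<open>
  The change of variables of one block carried out inside a longer word;
  \<open>\<alpha>\<close>, \<open>\<beta>\<close>, \<open>c\<close> and the side conditions
  \<open>\<Phi>\<close> do not involve its generators.
\<close>

lemma eqv_absorb:
  fixes c \<alpha> \<beta> :: "('a \<times> bool \<Rightarrow> 'p::group_add) \<Rightarrow> 'p" and hn :: "'a \<times> bool"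
  assumes ab: "absorbs TYPE('p) \<delta> \<theta> B L R"
    and X: "set (llift B) \<subseteq> X" "hn \<notin> set (llift B)"
    and c: "wordfun X c"
    and indep: "\<And>p q. (\<And>z. z \<notin> set (llift B) \<Longrightarrow> p z = q z) \<Longrightarrow> c p = c q \<and> \<alpha> p = \<alpha> q \<and> \<beta> p = \<beta> q \<and> \<Phi> p = \<Phi> q"
    and acts: "\<And>p. \<Phi> p \<Longrightarrow> acts (p hn) True (c p)"
  shows "eqv X (\<lambda>p. \<Phi> p \<and> lok \<theta> (p hn) p B \<and>
        \<alpha> p + ((lval False \<theta> (p hn) p B + (c p + flip \<delta> (lval True \<theta> (p hn) p B))) + \<beta> p) = 0)
    X (\<lambda>p. \<Phi> p \<and> (\<forall>E\<in>set (L @ R). bok (p hn) p E) \<and>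
        \<alpha> p + ((bsum (p hn) p L + (c p + bsum (p hn) p R)) + \<beta> p) = 0)"
proof -
  from ab[unfolded absorbs_def, THEN conjunct2] obtain f g :: "'p \<Rightarrow> ('a \<times> bool \<Rightarrow> 'p) \<Rightarrow> 'a \<times> bool \<Rightarrow> 'p"
    where out: "\<forall>c p z. z \<notin> set (llift B) \<longrightarrow> f c p z = p z \<and> g c p z = p z"
    and w: "\<forall>X c. wordfun X c \<and> set (llift B) \<subseteq> X \<longrightarrow>
       (\<forall>z\<in>set (llift B). wordfun X (\<lambda>p. f (c p) p z) \<and> wordfun X (\<lambda>p. g (c p) p z))"
    and fL: "\<forall>h c p. acts h True c \<and> lok \<theta> h p B \<longrightarrow> (\<forall>E\<in>set (L @ R). bok h (f c p) E) \<and>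
       bsum h (f c p) L + (c + bsum h (f c p) R) = lval False \<theta> h p B + (c + flip \<delta> (lval True \<theta> h p B)) \<and>
       (\<forall>z\<in>set (llift B). g c (f c p) z = p z)"
    and gL: "\<forall>h c p. acts h True c \<and> (\<forall>E\<in>set (L @ R). bok h p E) \<longrightarrow> lok \<theta> h (g c p) B \<and>
       lval False \<theta> h (g c p) B + (c + flip \<delta> (lval True \<theta> h (g c p) B)) = bsum h p L + (c + bsum h p R) \<and>
       (\<forall>z\<in>set (llift B). f c (g c p) z = p z)"
    by (elim exE conjE)
  have fo: "c (f d p) = c p" "\<alpha> (f d p) = \<alpha> p" "\<beta> (f d p) = \<beta> p" "\<Phi> (f d p) = \<Phi> p" "f d p hn = p hn" for d p
  proof -
    have z: "f d p z = p z" if "z \<notin> set (llift B)" for z using out that by blast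
    note i = indep[of "f d p" p, OF z]
    show "c (f d p) = c p" "\<alpha> (f d p) = \<alpha> p" "\<beta> (f d p) = \<beta> p" "\<Phi> (f d p) = \<Phi> p"
      by (simp_all add: i)
    show "f d p hn = p hn" by (rule z[OF X(2)])
  qed
  have go: "c (g d p) = c p" "\<alpha> (g d p) = \<alpha> p" "\<beta> (g d p) = \<beta> p" "\<Phi> (g d p) = \<Phi> p" "g d p hn = p hn" for d p
  proof -
    have z: "g d p z = p z" if "z \<notin> set (llift B)" for z using out that by blast
    note i = indep[of "g d p" p, OF z]
    show "c (g d p) = c p" "\<alpha> (g d p) = \<alpha> p" "\<beta> (g d p) = \<beta> p" "\<Phi> (g d p) = \<Phi> p"
      by (simp_all add: i)
    show "g d p hn = p hn" by (rule z[OF X(2)])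
  qed
  show ?thesis
  proof (rule eqvI[where f = "\<lambda>p. f (c p) p" and g = "\<lambda>p. g (c p) p"])
    fix z assume z: "z \<in> X"
    show "wordfun X (\<lambda>p. f (c p) p z)" "wordfun X (\<lambda>p. g (c p) p z)"
    proof -
      have "wordfun X (\<lambda>p. f (c p) p z) \<and> wordfun X (\<lambda>p. g (c p) p z)"
      proof (cases "z \<in> set (llift B)")
        case True
        show ?thesis by (rule w[rule_format, OF conjI[OF c X(1)] True])
      next
        case False
        show ?thesis unfolding out[rule_format, OF False, THEN conjunct1] out[rule_format, OF False, THEN conjunct2]
          using wordfun_gen[OF z] by blast
      qed
      then show "wordfun X (\<lambda>p. f (c p) p z)" "wordfun X (\<lambda>p. g (c p) p z)" by blast+
    qed
  next
    fix p assume *: "\<Phi> p \<and> lok \<theta> (p hn) p B \<and>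
        \<alpha> p + ((lval False \<theta> (p hn) p B + (c p + flip \<delta> (lval True \<theta> (p hn) p B))) + \<beta> p) = 0"
    then have "acts (p hn) True (c p) \<and> lok \<theta> (p hn) p B" using acts by blast
    note r = fL[rule_format, OF this]
    from * r show "\<Phi> (f (c p) p) \<and> (\<forall>E\<in>set (L @ R). bok (f (c p) p hn) (f (c p) p) E) \<and>
        \<alpha> (f (c p) p) + ((bsum (f (c p) p hn) (f (c p) p) L + (c (f (c p) p) + bsum (f (c p) p hn) (f (c p) p) R)) + \<beta> (f (c p) p)) = 0"
      unfolding fo by (elim conjE) (intro conjI, assumption+, simp only:)
    show "g (c (f (c p) p)) (f (c p) p) z = p z" if "z \<in> X" for z
      using r out unfolding fo by metis
  next
    fix p assume *: "\<Phi> p \<and> (\<forall>E\<in>set (L @ R). bok (p hn) p E) \<and>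
        \<alpha> p + ((bsum (p hn) p L + (c p + bsum (p hn) p R)) + \<beta> p) = 0"
    then have "acts (p hn) True (c p) \<and> (\<forall>E\<in>set (L @ R). bok (p hn) p E)" using acts by blast
    note r = gL[rule_format, OF this]
    from * r show "\<Phi> (g (c p) p) \<and> lok \<theta> (g (c p) p hn) (g (c p) p) B \<and>
        \<alpha> (g (c p) p) + ((lval False \<theta> (g (c p) p hn) (g (c p) p) B + (c (g (c p) p) + flip \<delta> (lval True \<theta> (g (c p) p hn) (g (c p) p) B))) + \<beta> (g (c p) p)) = 0"
      unfolding go by (elim conjE) (intro conjI, assumption+, simp only:)
    show "f (c (g (c p) p)) (g (c p) p) z = p z" if "z \<in> X" for z
      using r out unfolding go by metis
  qed
qed

lemma has_shape_trans: "eqv X S Y T \<Longrightarrow> has_shape hn Y T U \<Longrightarrow> has_shape hn X S U"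
  unfolding has_shape_def by (blast intro: eqv_trans)

text \<open>
  One polygon obtained from two sheets read in the same direction; \<open>D\<close> consists of
  the blocks that still occur with separated lifts.
\<close>

definition parallel_system :: "bool \<Rightarrow> 'a \<times> bool \<Rightarrow> 'a lblock list \<Rightarrow> ('a \<times> bool) block list \<Rightarrow> ('a \<times> bool) block list \<Rightarrow>
    ('a \<times> bool \<Rightarrow> 'p::group_add) \<Rightarrow> bool" where
  "parallel_system \<theta> hn D Q R p \<longleftrightarrow> (\<forall>B\<in>set D. lok \<theta> (p hn) p B) \<and> (\<forall>B\<in>set (Q @ R). bok (p hn) p B) \<and>
     lsum False \<theta> (p hn) p D + (bsum (p hn) p Q + (lsum True \<theta> (p hn) p D + bsum (p hn) p R)) = 0"

definition opposite_system :: "bool \<Rightarrow> 'a \<times> bool \<Rightarrow> 'a lblock list \<Rightarrow> ('a \<times> bool) block list \<Rightarrow>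
    ('a \<times> bool \<Rightarrow> 'p::group_add) \<Rightarrow> bool" where
  "opposite_system \<theta> hn D Q p \<longleftrightarrow> (\<forall>B\<in>set D. lok \<theta> (p hn) p B) \<and> (\<forall>B\<in>set Q. bok (p hn) p B) \<and>
     lsum False \<theta> (p hn) p D + (bsum (p hn) p Q + - lsum True \<theta> (p hn) p D) = 0"

definition parallel_shape :: "bool \<Rightarrow> 'a lblock list \<Rightarrow> shape multiset" where
  "parallel_shape \<theta> D = image_mset shape_of (mset (concat (map (\<lambda>B. fst (parallel_lifts \<theta> B) @ snd (parallel_lifts \<theta> B)) D)))"

definition opposite_shape :: "bool \<Rightarrow> 'a lblock list \<Rightarrow> shape multiset" where
  "opposite_shape \<theta> D = image_mset shape_of (mset (concat (map (\<lambda>B. fst (opposite_lifts \<theta> B) @ snd (opposite_lifts \<theta> B)) D)))"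


text \<open>
  The last block of \<open>D\<close> is absorbed first: its lifts enclose \<open>Q\<close> and
  the lift to sheet 1 of the blocks before it, which together commute with \<open>h\<close>.
\<close>

lemma has_shape_parallel:
  assumes "distinct (hn # names Q @ names R @ lnames D)" "X = set (hn # names Q @ names R @ lnames D)"
  shows "has_shape hn X (parallel_system \<theta> hn D Q R :: ('a \<times> bool \<Rightarrow> 'p::group_add) \<Rightarrow> bool)
    (parallel_shape \<theta> D + image_mset shape_of (mset (Q @ R)))"
  using assms
proof (induction D arbitrary: Q R rule: rev_induct)
  case Nil
  have "parallel_system \<theta> hn [] Q R = (block_system hn (Q @ R) :: ('a \<times> bool \<Rightarrow> 'p) \<Rightarrow> bool)"
    by (rule ext) (simp add: parallel_system_def block_system_def)
  moreover have "X = gens hn (Q @ R)" using Nil(2) by auto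
  ultimately show ?case
    using Nil(1) unfolding has_shape_def parallel_shape_def by (intro exI[of _ "Q @ R"]) (simp add: eqv_refl)
next
  case (snoc B D)
  define L' R' where LR: "L' = fst (parallel_lifts \<theta> B)" "R' = snd (parallel_lifts \<theta> B)"
  have ab: "absorbs TYPE('p) True \<theta> B L' R'"
    unfolding LR by (rule absorbs_parallel) (use snoc.prems in simp)
  have ms: "mset (names (L' @ R')) = mset (llift B)" by (rule ab[unfolded absorbs_def, THEN conjunct1])
  have ms': "mset (hn # names (L' @ Q) @ names (R' @ R) @ lnames D) = mset (hn # names Q @ names R @ lnames (D @ [B]))"
    using ms by simp
  let ?c = "\<lambda>p. bsum (p hn) p Q + lsum True \<theta> (p hn) p D"
  let ?\<Phi> = "\<lambda>p. (\<forall>B\<in>set D. lok \<theta> (p hn) p B) \<and> (\<forall>B\<in>set (Q @ R). bok (p hn) p B)"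
  have "eqv X (\<lambda>p :: 'a \<times> bool \<Rightarrow> 'p. ?\<Phi> p \<and> lok \<theta> (p hn) p B \<and>
        lsum False \<theta> (p hn) p D + ((lval False \<theta> (p hn) p B + (?c p + flip True (lval True \<theta> (p hn) p B))) + bsum (p hn) p R) = 0)
    X (\<lambda>p. ?\<Phi> p \<and> (\<forall>E\<in>set (L' @ R'). bok (p hn) p E) \<and>
        lsum False \<theta> (p hn) p D + ((bsum (p hn) p L' + (?c p + bsum (p hn) p R')) + bsum (p hn) p R) = 0)"
  proof (rule eqv_absorb[OF ab])
    show "set (llift B) \<subseteq> X" "hn \<notin> set (llift B)" using snoc.prems by auto
    show "wordfun X ?c"
      by (intro wordfun_add wordfun_bsum wordfun_lsum) (use snoc.prems(2) in auto)
    show "acts (p hn) True (?c p)" if "?\<Phi> p" for p :: "'a \<times> bool \<Rightarrow> 'p"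
      using acts_add[OF boks_acts loks_acts, of Q "p hn" p D \<theta> p True] that by auto
    fix p q :: "'a \<times> bool \<Rightarrow> 'p" assume pq: "\<And>z. z \<notin> set (llift B) \<Longrightarrow> p z = q z"
    have d: "z \<notin> set (llift B)" if "z \<in> set (names Q) \<or> z \<in> set (names R) \<or> z \<in> set (lnames D) \<or> z = hn" for z
      using that snoc.prems(1) by auto
    have "p hn = q hn" "\<And>h. bsum h p Q = bsum h q Q" "\<And>h. bsum h p R = bsum h q R" "\<And>i h. lsum i \<theta> h p D = lsum i \<theta> h q D"
      "\<And>h. (\<forall>B\<in>set D. lok \<theta> h p B) = (\<forall>B\<in>set D. lok \<theta> h q B)"
      "\<And>h. (\<forall>B\<in>set (Q @ R). bok h p B) = (\<forall>B\<in>set (Q @ R). bok h q B)"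
      by (intro pq bsum_cong lsum_cong loks_cong boks_cong d; auto)+
    then show "?c p = ?c q \<and> lsum False \<theta> (p hn) p D = lsum False \<theta> (q hn) q D \<and> bsum (p hn) p R = bsum (q hn) q R \<and> ?\<Phi> p = ?\<Phi> q"
      by simp
  qed
  moreover have "parallel_system \<theta> hn (D @ [B]) Q R = (\<lambda>p :: 'a \<times> bool \<Rightarrow> 'p. ?\<Phi> p \<and> lok \<theta> (p hn) p B \<and>
        lsum False \<theta> (p hn) p D + ((lval False \<theta> (p hn) p B + (?c p + flip True (lval True \<theta> (p hn) p B))) + bsum (p hn) p R) = 0)"
    by (rule ext) (auto simp: parallel_system_def add.assoc)
  moreover have "parallel_system \<theta> hn D (L' @ Q) (R' @ R) = (\<lambda>p :: 'a \<times> bool \<Rightarrow> 'p. ?\<Phi> p \<and> (\<forall>E\<in>set (L' @ R'). bok (p hn) p E) \<and>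
        lsum False \<theta> (p hn) p D + ((bsum (p hn) p L' + (?c p + bsum (p hn) p R')) + bsum (p hn) p R) = 0)"
    by (rule ext) (auto simp: parallel_system_def add.assoc)
  ultimately have e: "eqv X (parallel_system \<theta> hn (D @ [B]) Q R :: ('a \<times> bool \<Rightarrow> 'p) \<Rightarrow> bool) X (parallel_system \<theta> hn D (L' @ Q) (R' @ R))" by simp
  have "has_shape hn X (parallel_system \<theta> hn D (L' @ Q) (R' @ R) :: ('a \<times> bool \<Rightarrow> 'p) \<Rightarrow> bool)
    (parallel_shape \<theta> D + image_mset shape_of (mset ((L' @ Q) @ (R' @ R))))"
  proof (rule snoc.IH)
    show "distinct (hn # names (L' @ Q) @ names (R' @ R) @ lnames D)"
      using mset_eq_imp_distinct_iff[OF ms'] snoc.prems(1) by blast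
    show "X = set (hn # names (L' @ Q) @ names (R' @ R) @ lnames D)"
      using mset_eq_setD[OF ms'] snoc.prems(2) by simp
  qed
  from has_shape_trans[OF e this] show ?case
    by (simp add: parallel_shape_def LR ac_simps)
qed

text \<open>
  Here the lifts of the last block of \<open>D\<close> enclose only \<open>Q\<close>.
\<close>

lemma has_shape_opposite:
  assumes "distinct (hn # names Q @ lnames D)" "X = set (hn # names Q @ lnames D)" "\<forall>B\<in>set D. only_crosses B"
  shows "has_shape hn X (opposite_system \<theta> hn D Q :: ('a \<times> bool \<Rightarrow> 'p::group_add) \<Rightarrow> bool)
    (opposite_shape \<theta> D + image_mset shape_of (mset Q))"
  using assms
proof (induction D arbitrary: Q rule: rev_induct)
  case Nil
  have "opposite_system \<theta> hn [] Q = (block_system hn Q :: ('a \<times> bool \<Rightarrow> 'p) \<Rightarrow> bool)"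
    by (rule ext) (simp add: opposite_system_def block_system_def)
  moreover have "X = gens hn Q" using Nil(2) by auto
  ultimately show ?case
    using Nil(1) unfolding has_shape_def opposite_shape_def by (intro exI[of _ Q]) (simp add: eqv_refl)
next
  case (snoc B D)
  define L' R' where LR: "L' = fst (opposite_lifts \<theta> B)" "R' = snd (opposite_lifts \<theta> B)"
  have ab: "absorbs TYPE('p) False \<theta> B L' R'"
    unfolding LR by (rule absorbs_opposite) (use snoc.prems in simp)
  have ms: "mset (names (L' @ R')) = mset (llift B)" by (rule ab[unfolded absorbs_def, THEN conjunct1])
  have ms': "mset (hn # names (L' @ Q @ R') @ lnames D) = mset (hn # names Q @ lnames (D @ [B]))"
    using ms by simp
  let ?c = "\<lambda>p. bsum (p hn) p Q"
  let ?\<Phi> = "\<lambda>p. (\<forall>B\<in>set D. lok \<theta> (p hn) p B) \<and> (\<forall>B\<in>set Q. bok (p hn) p B)"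
  have "eqv X (\<lambda>p :: 'a \<times> bool \<Rightarrow> 'p. ?\<Phi> p \<and> lok \<theta> (p hn) p B \<and>
        lsum False \<theta> (p hn) p D + ((lval False \<theta> (p hn) p B + (?c p + flip False (lval True \<theta> (p hn) p B))) + - lsum True \<theta> (p hn) p D) = 0)
    X (\<lambda>p. ?\<Phi> p \<and> (\<forall>E\<in>set (L' @ R'). bok (p hn) p E) \<and>
        lsum False \<theta> (p hn) p D + ((bsum (p hn) p L' + (?c p + bsum (p hn) p R')) + - lsum True \<theta> (p hn) p D) = 0)"
  proof (rule eqv_absorb[OF ab])
    show "set (llift B) \<subseteq> X" "hn \<notin> set (llift B)" using snoc.prems by auto
    show "wordfun X ?c"
      by (intro wordfun_bsum) (use snoc.prems(2) in auto)
    show "acts (p hn) True (?c p)" if "?\<Phi> p" for p :: "'a \<times> bool \<Rightarrow> 'p"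
      using boks_acts[of Q "p hn" p] that by auto
    fix p q :: "'a \<times> bool \<Rightarrow> 'p" assume pq: "\<And>z. z \<notin> set (llift B) \<Longrightarrow> p z = q z"
    have d: "z \<notin> set (llift B)" if "z \<in> set (names Q) \<or> z \<in> set (lnames D) \<or> z = hn" for z
      using that snoc.prems(1) by auto
    have "p hn = q hn" "\<And>h. bsum h p Q = bsum h q Q" "\<And>i h. lsum i \<theta> h p D = lsum i \<theta> h q D"
      "\<And>h. (\<forall>B\<in>set D. lok \<theta> h p B) = (\<forall>B\<in>set D. lok \<theta> h q B)"
      "\<And>h. (\<forall>B\<in>set Q. bok h p B) = (\<forall>B\<in>set Q. bok h q B)"
      by (intro pq bsum_cong lsum_cong loks_cong boks_cong d; auto)+
    then show "?c p = ?c q \<and> lsum False \<theta> (p hn) p D = lsum False \<theta> (q hn) q D \<and>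
        - lsum True \<theta> (p hn) p D = - lsum True \<theta> (q hn) q D \<and> ?\<Phi> p = ?\<Phi> q"
      by simp
  qed
  moreover have "opposite_system \<theta> hn (D @ [B]) Q = (\<lambda>p :: 'a \<times> bool \<Rightarrow> 'p. ?\<Phi> p \<and> lok \<theta> (p hn) p B \<and>
        lsum False \<theta> (p hn) p D + ((lval False \<theta> (p hn) p B + (?c p + flip False (lval True \<theta> (p hn) p B))) + - lsum True \<theta> (p hn) p D) = 0)"
    by (rule ext) (auto simp: opposite_system_def group_norm simp del: add_uminus_conv_diff)
  moreover have "opposite_system \<theta> hn D (L' @ Q @ R') = (\<lambda>p :: 'a \<times> bool \<Rightarrow> 'p. ?\<Phi> p \<and> (\<forall>E\<in>set (L' @ R'). bok (p hn) p E) \<and>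
        lsum False \<theta> (p hn) p D + ((bsum (p hn) p L' + (?c p + bsum (p hn) p R')) + - lsum True \<theta> (p hn) p D) = 0)"
    by (rule ext) (auto simp: opposite_system_def group_norm simp del: add_uminus_conv_diff)
  ultimately have e: "eqv X (opposite_system \<theta> hn (D @ [B]) Q :: ('a \<times> bool \<Rightarrow> 'p) \<Rightarrow> bool) X (opposite_system \<theta> hn D (L' @ Q @ R'))" by simp
  have "has_shape hn X (opposite_system \<theta> hn D (L' @ Q @ R') :: ('a \<times> bool \<Rightarrow> 'p) \<Rightarrow> bool)
    (opposite_shape \<theta> D + image_mset shape_of (mset (L' @ Q @ R')))"
  proof (rule snoc.IH)
    show "distinct (hn # names (L' @ Q @ R') @ lnames D)"
      using mset_eq_imp_distinct_iff[OF ms'] snoc.prems(1) by blast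
    show "X = set (hn # names (L' @ Q @ R') @ lnames D)"
      using mset_eq_setD[OF ms'] snoc.prems(2) by simp
  qed (use snoc.prems in simp)
  from has_shape_trans[OF e this] show ?case
    by (simp add: opposite_shape_def LR ac_simps)
qed

subsection \<open>Eliminating the generator that joins the sheets\<close>

text \<open>
  The lifted relators: one long relator on each sheet, with the lift \<open>(t, False)\<close>
  trivial. The value \<open>\<theta>\<close> is the sign of \<open>t\<close>.
\<close>

definition sheet_system :: "bool \<Rightarrow> 'a \<Rightarrow> 'a \<Rightarrow> 'a lblock list \<Rightarrow> ('a \<times> bool \<Rightarrow> 'p::group_add) \<Rightarrow> bool" where
  "sheet_system \<theta> h t D p \<longleftrightarrow> p (t, False) = 0 \<and> p (h, True) = flip \<theta> (p (h, False)) \<and>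
     (\<forall>B\<in>set D. lok \<theta> (p (h, False)) p B) \<and>
     lsum False \<theta> (p (h, False)) p D = 0 \<and> lsum True \<theta> (p (h, False)) p D = 0"

lemma add_eq_0_swap: "a + b = 0 \<longleftrightarrow> b + a = (0 :: 'p::group_add)"
  by (metis add_eq_0_iff minus_minus)

lemma conj_eq_0:
  assumes "x + (z + b) = 0"
  shows "a + (b + (x + (z + - a))) = (0 :: 'p::group_add)"
proof -
  have "b + (x + z) = 0" using assms unfolding add_eq_0_swap[of b] by (simp add: add.assoc)
  moreover have "a + (b + (x + (z + - a))) = a + ((b + (x + z)) + - a)" by (simp only: add.assoc)
  ultimately show ?thesis by simp
qed

text \<open>
  If \<open>t\<close> is an exceptional generator \<open>s\<close>, the long relator of sheet 0
  determines the lift of \<open>s'\<close> to sheet 1. Substituted into the other one it joins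
  the sheets to a single word, with \<open>(s', False)\<close> reused as the name of the loop
  around the exceptional fibre over \<open>s'\<close>.
\<close>

lemma start_pair:
  fixes h s s' :: 'a
  assumes D: "D = LPair s a b s' a' b' # D2" and dist: "distinct ((h, False) # (h, True) # lnames D)"
  shows "eqv (set ((h, False) # (h, True) # lnames D)) (sheet_system True h s D :: ('a \<times> bool \<Rightarrow> 'p::group_add) \<Rightarrow> bool)
    (set ((h, False) # [] @ [(s, True), (s', False)] @ lnames D2))
    (parallel_system True (h, False) D2 [] [Cone (s, True) (a div 2) b, Cone (s', False) (a' div 2) b'])"
proof -
  let ?h = "(h, False)"
  let ?f = "\<lambda>p :: 'a \<times> bool \<Rightarrow> 'p. p((s', False) := p (s', False) + p (s', True))"
  let ?g = "\<lambda>q :: 'a \<times> bool \<Rightarrow> 'p. q((s, False) := 0, (h, True) := q ?h, (s', True) := - lsum False True (q ?h) q D2,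
     (s', False) := q (s', False) + lsum False True (q ?h) q D2)"
  have ne: "h \<noteq> s" "h \<noteq> s'" "s \<noteq> s'" using dist D by auto
  have z: "z \<noteq> (s, i) \<and> z \<noteq> (s', i) \<and> z \<noteq> (h, i)" if "z \<in> set (lnames D2)" for z i
    using that dist D by (cases i) auto
  have f: "?f p z = p z" and g: "?g q z = q z" if "z \<in> set (lnames D2)" for p q z
    using z[OF that] by auto
  have fc: "lsum i \<theta> k (?f p) D2 = lsum i \<theta> k p D2" "(\<forall>B\<in>set D2. lok \<theta> k (?f p) B) \<longleftrightarrow> (\<forall>B\<in>set D2. lok \<theta> k p B)" for i \<theta> k p
    by (rule lsum_cong, rule f, assumption) (rule loks_cong, rule f, assumption)
  have gc: "lsum i \<theta> k (?g p) D2 = lsum i \<theta> k p D2" "(\<forall>B\<in>set D2. lok \<theta> k (?g p) B) \<longleftrightarrow> (\<forall>B\<in>set D2. lok \<theta> k p B)" for i \<theta> k p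
    by (rule lsum_cong, rule g, assumption) (rule loks_cong, rule g, assumption)
  have fh: "?f p ?h = p ?h" and gh: "?g p ?h = p ?h" for p using ne by auto
  show ?thesis
  proof (rule eqvI[where f = ?f and g = ?g])
    fix x assume "x \<in> set ((h, False) # [] @ [(s, True), (s', False)] @ lnames D2)"
    then show "wordfun (set (?h # (h, True) # lnames D)) (\<lambda>p. ?f p x)"
      unfolding fun_upd_apply by (intro wordfun_intros) (auto simp: D)
  next
    fix x assume "x \<in> set (?h # (h, True) # lnames D)"
    then show "wordfun (set ((h, False) # [] @ [(s, True), (s', False)] @ lnames D2)) (\<lambda>p. ?g p x)"
      unfolding fun_upd_apply
      by (cases "x = (s', False)"; cases "x = (s', True)"; cases "x = (h, True)"; cases "x = (s, False)")
        (auto simp: D intro!: wordfun_intros wordfun_lsum simp del: fun_upd_apply add_uminus_conv_diff)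
  next
    fix p :: "'a \<times> bool \<Rightarrow> 'p" assume S: "sheet_system True h s D p"
    then have *: "p (s, False) = 0" "p (h, True) = p ?h" "lok True (p ?h) p (LPair s a b s' a' b')" "\<forall>B\<in>set D2. lok True (p ?h) p B"
      "p (s', True) + lsum False True (p ?h) p D2 = 0" "p (s, True) + (p (s', False) + lsum True True (p ?h) p D2) = 0"
      unfolding sheet_system_def D by (auto simp: add.assoc)
    have s': "p (s', True) = - lsum False True (p ?h) p D2" using *(5) by (simp add: eq_neg_iff_add_eq_0)
    have "lsum False True (p ?h) p D2 + (lsum True True (p ?h) p D2 + (p (s, True) + (p (s', False) + p (s', True)))) = 0"
      unfolding s' by (rule conj_eq_0[OF *(6)])
    then show "parallel_system True ?h D2 [] [Cone (s, True) (a div 2) b, Cone (s', False) (a' div 2) b'] (?f p)"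
      unfolding parallel_system_def fh fc using * ne by (auto simp: acts_add_iff)
    show "?g (?f p) x = p x" if "x \<in> set (?h # (h, True) # lnames D)" for x
      unfolding fh fc using * s' ne by (auto simp: add.assoc)
  next
    fix q :: "'a \<times> bool \<Rightarrow> 'p" assume S: "parallel_system True ?h D2 [] [Cone (s, True) (a div 2) b, Cone (s', False) (a' div 2) b'] q"
    then have *: "\<forall>B\<in>set D2. lok True (q ?h) q B" "acts (q ?h) True (q (s, True))" "acts (q ?h) True (q (s', False))"
       "zmul (a div 2) (q (s, True)) + zmul b (q ?h) = 0" "zmul (a' div 2) (q (s', False)) + zmul b' (q ?h) = 0"
      "lsum False True (q ?h) q D2 + (lsum True True (q ?h) q D2 + (q (s, True) + q (s', False))) = 0"
      unfolding parallel_system_def by auto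
    have ac: "acts (q ?h) True (lsum i True (q ?h) q D2)" for i using loks_acts[OF *(1)] .
    have "q (s, True) + (q (s', False) + (lsum False True (q ?h) q D2 + lsum True True (q ?h) q D2)) = 0"
      using *(6) add_eq_0_swap[of "lsum False True (q ?h) q D2 + lsum True True (q ?h) q D2" "q (s, True) + q (s', False)"]
      by (simp add: add.assoc)
    then show "sheet_system True h s D (?g q)"
      unfolding sheet_system_def gh D list.map sum_list.Cons gc set_simps ball_simps
      using * ne ac by (auto simp: add.assoc acts_add_iff)
    show "?f (?g q) x = q x" if "x \<in> set ((h, False) # [] @ [(s, True), (s', False)] @ lnames D2)" for x
      using that ne z[of x] by (auto simp: group_norm simp del: add_uminus_conv_diff)
  qed
qed

lemma commutator_swap:
  assumes "x + (y + (- x + (- y + (a + b)))) = 0"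
  shows "a + (b + (x + (y + (- x + - y)))) = (0 :: 'p::group_add)"
proof -
  have "(x + (y + (- x + - y))) + (a + b) = 0" using assms by (simp only: add.assoc)
  then have "(a + b) + (x + (y + (- x + - y))) = 0" by (subst add_eq_0_swap)
  then show ?thesis by (simp only: add.assoc)
qed

lemma commutator_swap':
  assumes "a + (b + (x + (y + (- x + - y)))) = 0"
  shows "x + (y + (- x + (- y + (a + b)))) = (0 :: 'p::group_add)"
proof -
  have "(a + b) + (x + (y + (- x + - y))) = 0" using assms by (simp only: add.assoc)
  then have "(x + (y + (- x + - y))) + (a + b) = 0" by (subst add_eq_0_swap)
  then show ?thesis by (simp only: add.assoc)
qed

lemma solve_right: "a + (- b + c) = 0 \<Longrightarrow> b = c + (a :: 'p::group_add)"
proof -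
  assume "a + (- b + c) = 0"
  then have "(- b + c) + a = 0" by (subst add_eq_0_swap)
  then have "- b + (c + a) = 0" by (simp only: add.assoc)
  then have "- b = - (c + a)" by (rule eq_neg_iff_add_eq_0[THEN iffD2])
  then show ?thesis by simp
qed

text \<open>
  If \<open>t\<close> lies in a handle, the long relator of sheet 0 determines a lift of the
  other handle generator, and one handle remains.
\<close>

lemma start_handle_first:
  fixes h x y :: 'a
  assumes D: "D = LHandle x \<sigma> True y \<tau> \<gamma> # D2" and dist: "distinct ((h, False) # (h, True) # lnames D)"
  shows "eqv (set ((h, False) # (h, True) # lnames D)) (sheet_system \<sigma> h x D :: ('a \<times> bool \<Rightarrow> 'p::group_add) \<Rightarrow> bool)
    (set ((h, False) # [(x, True), (y, False)] @ lnames D2)) (parallel_system \<sigma> (h, False) D2 [] [Handle (x, True) True (y, False) (eff \<sigma> \<gamma> \<tau>)])"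
proof -
  let ?h = "(h, False)"
  let ?g = "\<lambda>q :: 'a \<times> bool \<Rightarrow> 'p. q((x, False) := 0, (h, True) := flip \<sigma> (q ?h), (y, True) := - lsum False \<sigma> (q ?h) q D2 + (q (y, False) + (if \<gamma> then q (x, True) else 0)))"
  have ne: "h \<noteq> x" "h \<noteq> y" "x \<noteq> y" using dist D by auto
  have z: "z \<noteq> (x, i) \<and> z \<noteq> (y, i) \<and> z \<noteq> (h, i)" if "z \<in> set (lnames D2)" for z i
    using that dist D by (cases i) auto
  have g: "?g q z = q z" if "z \<in> set (lnames D2)" for q z
    using z[OF that] by auto
  have gc: "lsum i \<theta> k (?g p) D2 = lsum i \<theta> k p D2" "(\<forall>B\<in>set D2. lok \<theta> k (?g p) B) \<longleftrightarrow> (\<forall>B\<in>set D2. lok \<theta> k p B)" for i \<theta> k p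
    by (rule lsum_cong, rule g, assumption) (rule loks_cong, rule g, assumption)
  have gh: "?g p ?h = p ?h" for p using ne by auto
  show ?thesis
  proof (rule eqvI[where f = "\<lambda>p. p" and g = ?g])
    fix z assume "z \<in> set ((h, False) # [(x, True), (y, False)] @ lnames D2)"
    then show "wordfun (set (?h # (h, True) # lnames D)) (\<lambda>p :: 'a \<times> bool \<Rightarrow> 'p. p z)"
      by (intro wordfun_gen) (auto simp: D)
  next
    fix z assume "z \<in> set (?h # (h, True) # lnames D)"
    then show "wordfun (set ((h, False) # [(x, True), (y, False)] @ lnames D2)) (\<lambda>p :: 'a \<times> bool \<Rightarrow> 'p. ?g p z)"
      unfolding fun_upd_apply flip_def
      by (cases "z = (x, False)"; cases "z = (h, True)"; cases "z = (y, True)") (auto simp: D intro!: wordfun_intros wordfun_lsum simp del: fun_upd_apply add_uminus_conv_diff)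
  next
    fix p :: "'a \<times> bool \<Rightarrow> 'p" assume S: "sheet_system \<sigma> h x D p"
    then have *: "p (x, False) = 0" "p (h, True) = flip \<sigma> (p ?h)" "lok \<sigma> (p ?h) p (LHandle x \<sigma> True y \<tau> \<gamma>)" "\<forall>B\<in>set D2. lok \<sigma> (p ?h) p B"
      "lval False \<sigma> (p ?h) p (LHandle x \<sigma> True y \<tau> \<gamma>) + lsum False \<sigma> (p ?h) p D2 = 0" "lval True \<sigma> (p ?h) p (LHandle x \<sigma> True y \<tau> \<gamma>) + lsum True \<sigma> (p ?h) p D2 = 0"
      unfolding sheet_system_def D by auto
    have y: "p (y, True) = - lsum False \<sigma> (p ?h) p D2 + (p (y, False) + (if \<gamma> then p (x, True) else 0))"
    proof -
      have "p (y, True) + (- (p (y, False) + (if \<gamma> then p (x, True) else 0)) + lsum False \<sigma> (p ?h) p D2) = 0"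
        using *(5) *(1) by (cases \<gamma>) (simp_all add: group_norm del: add_uminus_conv_diff)
      from solve_right[OF this] show ?thesis by (simp add: add.assoc[symmetric])
    qed
    have "p (x, True) + (p (y, False) + (- p (x, True) + (- p (y, False) + (lsum False \<sigma> (p ?h) p D2 + lsum True \<sigma> (p ?h) p D2)))) = 0"
      using *(6) *(1) unfolding lval.simps y by (cases \<gamma>) (simp_all add: group_norm del: add_uminus_conv_diff)
    from commutator_swap[OF this]
    show "parallel_system \<sigma> ?h D2 [] [Handle (x, True) True (y, False) (eff \<sigma> \<gamma> \<tau>)] p"
      unfolding parallel_system_def using * by (simp add: eff_def group_norm del: add_uminus_conv_diff)
    show "?g p z' = p z'" if "z' \<in> set (?h # (h, True) # lnames D)" for z'
      using * y by auto
  next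
    fix q :: "'a \<times> bool \<Rightarrow> 'p" assume S: "parallel_system \<sigma> (h, False) D2 [] [Handle (x, True) True (y, False) (eff \<sigma> \<gamma> \<tau>)] q"
    then have *: "\<forall>B\<in>set D2. lok \<sigma> (q ?h) q B" "acts (q ?h) True (q (x, True))" "acts (q ?h) (eff \<sigma> \<gamma> \<tau>) (q (y, False))"
      "lsum False \<sigma> (q ?h) q D2 + (lsum True \<sigma> (q ?h) q D2 + (q (x, True) + (q (y, False) + (- q (x, True) + - q (y, False))))) = 0"
      unfolding parallel_system_def by (auto simp: group_norm simp del: add_uminus_conv_diff)
    have ac: "acts (q ?h) True (lsum i \<sigma> (q ?h) q D2)" for i using loks_acts[OF *(1)] .
    have "acts (q ?h) (eff \<sigma> \<gamma> \<tau>) (- lsum False \<sigma> (q ?h) q D2 + (q (y, False) + (if \<gamma> then q (x, True) else 0)))"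
      using acts_add[of "q ?h" True "- lsum False \<sigma> (q ?h) q D2" "eff \<sigma> \<gamma> \<tau>" "q (y, False) + (if \<gamma> then q (x, True) else 0)"]
        acts_add[of "q ?h" "eff \<sigma> \<gamma> \<tau>" "q (y, False)" True "if \<gamma> then q (x, True) else 0"] ac[of False] *(2,3) by simp
    then show "sheet_system \<sigma> h x D (?g q)"
      unfolding sheet_system_def gh D list.map sum_list.Cons gc set_simps ball_simps
      using * ne ac commutator_swap'[OF *(4)]
      by (cases \<gamma>) (simp_all add: group_norm eff_def del: add_uminus_conv_diff)
    show "?g q z' = q z'" if "z' \<in> set ((h, False) # [(x, True), (y, False)] @ lnames D2)" for z'
      using that ne z[of z'] by auto
  qed
qed

lemma start_handle_second:
  fixes h x y :: 'a
  assumes D: "D = LHandle x \<sigma> False y \<tau> True # D2" and dist: "distinct ((h, False) # (h, True) # lnames D)"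
  shows "eqv (set ((h, False) # (h, True) # lnames D)) (sheet_system \<tau> h y D :: ('a \<times> bool \<Rightarrow> 'p::group_add) \<Rightarrow> bool)
    (set ((h, False) # [(x, False), (y, True)] @ lnames D2)) (parallel_system \<tau> (h, False) D2 [Handle (x, False) \<sigma> (y, True) True] [])"
proof -
  let ?h = "(h, False)"
  let ?g = "\<lambda>q :: 'a \<times> bool \<Rightarrow> 'p. q((y, False) := 0, (h, True) := flip \<tau> (q ?h), (x, True) := lsum False \<tau> (q ?h) q D2 + q (x, False))"
  have ne: "h \<noteq> x" "h \<noteq> y" "x \<noteq> y" using dist D by auto
  have z: "z \<noteq> (x, i) \<and> z \<noteq> (y, i) \<and> z \<noteq> (h, i)" if "z \<in> set (lnames D2)" for z i
    using that dist D by (cases i) auto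
  have g: "?g q z = q z" if "z \<in> set (lnames D2)" for q z
    using z[OF that] by auto
  have gc: "lsum i \<theta> k (?g p) D2 = lsum i \<theta> k p D2" "(\<forall>B\<in>set D2. lok \<theta> k (?g p) B) \<longleftrightarrow> (\<forall>B\<in>set D2. lok \<theta> k p B)" for i \<theta> k p
    by (rule lsum_cong, rule g, assumption) (rule loks_cong, rule g, assumption)
  have gh: "?g p ?h = p ?h" for p using ne by auto
  show ?thesis
  proof (rule eqvI[where f = "\<lambda>p. p" and g = ?g])
    fix z assume "z \<in> set ((h, False) # [(x, False), (y, True)] @ lnames D2)"
    then show "wordfun (set (?h # (h, True) # lnames D)) (\<lambda>p :: 'a \<times> bool \<Rightarrow> 'p. p z)"
      by (intro wordfun_gen) (auto simp: D)
  next
    fix z assume "z \<in> set (?h # (h, True) # lnames D)"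
    then show "wordfun (set ((h, False) # [(x, False), (y, True)] @ lnames D2)) (\<lambda>p :: 'a \<times> bool \<Rightarrow> 'p. ?g p z)"
      unfolding fun_upd_apply flip_def
      by (cases "z = (y, False)"; cases "z = (h, True)"; cases "z = (x, True)") (auto simp: D intro!: wordfun_intros wordfun_lsum simp del: fun_upd_apply add_uminus_conv_diff)
  next
    fix p :: "'a \<times> bool \<Rightarrow> 'p" assume S: "sheet_system \<tau> h y D p"
    then have *: "p (y, False) = 0" "p (h, True) = flip \<tau> (p ?h)" "lok \<tau> (p ?h) p (LHandle x \<sigma> False y \<tau> True)" "\<forall>B\<in>set D2. lok \<tau> (p ?h) p B"
      "lval False \<tau> (p ?h) p (LHandle x \<sigma> False y \<tau> True) + lsum False \<tau> (p ?h) p D2 = 0" "lval True \<tau> (p ?h) p (LHandle x \<sigma> False y \<tau> True) + lsum True \<tau> (p ?h) p D2 = 0"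
      unfolding sheet_system_def D by auto
    have y: "p (x, True) = lsum False \<tau> (p ?h) p D2 + p (x, False)"
      by (rule solve_right) (use *(5) *(1) in \<open>simp add: group_norm del: add_uminus_conv_diff\<close>)
    show "parallel_system \<tau> ?h D2 [Handle (x, False) \<sigma> (y, True) True] [] p"
      unfolding parallel_system_def using * by (simp add: y eff_def group_norm del: add_uminus_conv_diff)
    show "?g p z' = p z'" if "z' \<in> set (?h # (h, True) # lnames D)" for z'
      using * y by auto
  next
    fix q :: "'a \<times> bool \<Rightarrow> 'p" assume S: "parallel_system \<tau> (h, False) D2 [Handle (x, False) \<sigma> (y, True) True] [] q"
    then have *: "\<forall>B\<in>set D2. lok \<tau> (q ?h) q B" "acts (q ?h) \<sigma> (q (x, False))" "acts (q ?h) True (q (y, True))"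
      "lsum False \<tau> (q ?h) q D2 + (q (x, False) + (q (y, True) + (- q (x, False) + (- q (y, True) + lsum True \<tau> (q ?h) q D2)))) = 0"
      unfolding parallel_system_def by (auto simp: group_norm simp del: add_uminus_conv_diff)
    have "acts (q ?h) True (lsum False \<tau> (q ?h) q D2)" using loks_acts[OF *(1)] .
    then have "acts (q ?h) \<sigma> (lsum False \<tau> (q ?h) q D2 + q (x, False))"
      using acts_add[of "q ?h" True "lsum False \<tau> (q ?h) q D2" \<sigma> "q (x, False)"] *(2) by simp
    then show "sheet_system \<tau> h y D (?g q)"
      unfolding sheet_system_def gh D list.map sum_list.Cons gc set_simps ball_simps
      using * ne by (simp add: group_norm eff_def del: add_uminus_conv_diff)
    show "?g q z' = q z'" if "z' \<in> set ((h, False) # [(x, False), (y, True)] @ lnames D2)" for z'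
      using that ne z[of z'] by auto
  qed
qed

text \<open>
  If \<open>t\<close> is a crosscap generator, its nontrivial lift occurs once in each long
  relator with the same sign. Eliminating it joins the sheets in opposite directions.
\<close>

lemma start_cross:
  fixes h v :: 'a
  assumes D: "D = LCross v \<sigma> True # D2" and dist: "distinct ((h, False) # (h, True) # lnames D)"
  shows "eqv (set ((h, False) # (h, True) # lnames D)) (sheet_system \<sigma> h v D :: ('a \<times> bool \<Rightarrow> 'p::group_add) \<Rightarrow> bool)
    (set ((h, False) # [] @ lnames D2)) (opposite_system \<sigma> (h, False) D2 [])"
proof -
  let ?h = "(h, False)"
  let ?g = "\<lambda>q :: 'a \<times> bool \<Rightarrow> 'p. q((v, False) := 0, (h, True) := flip \<sigma> (q ?h), (v, True) := - lsum False \<sigma> (q ?h) q D2)"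
  have ne: "h \<noteq> v" using dist D by auto
  have z: "z \<noteq> (v, i) \<and> z \<noteq> (h, i)" if "z \<in> set (lnames D2)" for z i
    using that dist D by (cases i) auto
  have g: "?g q z = q z" if "z \<in> set (lnames D2)" for q z
    using z[OF that] by auto
  have gc: "lsum i \<theta> k (?g p) D2 = lsum i \<theta> k p D2" "(\<forall>B\<in>set D2. lok \<theta> k (?g p) B) \<longleftrightarrow> (\<forall>B\<in>set D2. lok \<theta> k p B)" for i \<theta> k p
    by (rule lsum_cong, rule g, assumption) (rule loks_cong, rule g, assumption)
  have gh: "?g p ?h = p ?h" for p using ne by auto
  show ?thesis
  proof (rule eqvI[where f = "\<lambda>p. p" and g = ?g])
    fix z assume "z \<in> set ((h, False) # [] @ lnames D2)"
    then show "wordfun (set (?h # (h, True) # lnames D)) (\<lambda>p :: 'a \<times> bool \<Rightarrow> 'p. p z)"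
      by (intro wordfun_gen) (auto simp: D)
  next
    fix z assume "z \<in> set (?h # (h, True) # lnames D)"
    then show "wordfun (set ((h, False) # [] @ lnames D2)) (\<lambda>p :: 'a \<times> bool \<Rightarrow> 'p. ?g p z)"
      unfolding fun_upd_apply flip_def
      by (cases "z = (v, False)"; cases "z = (h, True)"; cases "z = (v, True)") (auto simp: D intro!: wordfun_intros wordfun_lsum simp del: fun_upd_apply add_uminus_conv_diff)
  next
    fix p :: "'a \<times> bool \<Rightarrow> 'p" assume S: "sheet_system \<sigma> h v D p"
    then have *: "p (v, False) = 0" "p (h, True) = flip \<sigma> (p ?h)" "lok \<sigma> (p ?h) p (LCross v \<sigma> True)" "\<forall>B\<in>set D2. lok \<sigma> (p ?h) p B"
      "p (v, True) + lsum False \<sigma> (p ?h) p D2 = 0" "p (v, True) + lsum True \<sigma> (p ?h) p D2 = 0"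
      unfolding sheet_system_def D by auto
    have y: "p (v, True) = - lsum False \<sigma> (p ?h) p D2" using *(5) by (rule eq_neg_iff_add_eq_0[THEN iffD2])
    have "lsum False \<sigma> (p ?h) p D2 + - lsum True \<sigma> (p ?h) p D2 = 0"
      using *(6) unfolding y by (simp add: neg_eq_iff_add_eq_0[symmetric] eq_neg_iff_add_eq_0[symmetric])
    then show "opposite_system \<sigma> ?h D2 [] p"
      unfolding opposite_system_def using * by (simp del: add_uminus_conv_diff)
    show "?g p z' = p z'" if "z' \<in> set (?h # (h, True) # lnames D)" for z'
      using * y by auto
  next
    fix q :: "'a \<times> bool \<Rightarrow> 'p" assume S: "opposite_system \<sigma> (h, False) D2 [] q"
    then have *: "\<forall>B\<in>set D2. lok \<sigma> (q ?h) q B" "lsum False \<sigma> (q ?h) q D2 = lsum True \<sigma> (q ?h) q D2"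
      unfolding opposite_system_def by auto
    have ac: "acts (q ?h) True (lsum i \<sigma> (q ?h) q D2)" for i using loks_acts[OF *(1)] .
    show "sheet_system \<sigma> h v D (?g q)"
      unfolding sheet_system_def gh D list.map sum_list.Cons gc set_simps ball_simps
      using * ne ac[of True] by (simp add: eff_def)
    show "?g q z' = q z'" if "z' \<in> set ((h, False) # [] @ lnames D2)" for z'
      using that ne z[of z'] by auto
  qed
qed

section \<open>The lifted presentation of a Seifert group\<close>

definition v_sign :: "seifert \<Rightarrow> nat \<Rightarrow> bool" where
  "v_sign N j \<longleftrightarrow> seifert_sign (stype N) j = 1"

definition pair_block :: "seifert \<Rightarrow> nat \<Rightarrow> seifert_gen lblock" where
  "pair_block N i = LPair (Gs (2 * i)) (fst (pairs N ! (2 * i))) (snd (pairs N ! (2 * i)))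
     (Gs (2 * i + 1)) (fst (pairs N ! (2 * i + 1))) (snd (pairs N ! (2 * i + 1)))"

definition cone_block :: "seifert \<Rightarrow> nat \<Rightarrow> seifert_gen lblock" where
  "cone_block N k = LCone (Gs k) (fst (pairs N ! k)) (snd (pairs N ! k))"

definition handle_block :: "seifert \<Rightarrow> (seifert_gen \<Rightarrow> bool) \<Rightarrow> nat \<Rightarrow> seifert_gen lblock" where
  "handle_block N f i = LHandle (Gv (2 * i)) (v_sign N (2 * i)) (f (Gv (2 * i)))
     (Gv (2 * i + 1)) (v_sign N (2 * i + 1)) (f (Gv (2 * i + 1)))"

definition cross_block :: "seifert \<Rightarrow> (seifert_gen \<Rightarrow> bool) \<Rightarrow> nat \<Rightarrow> seifert_gen lblock" where
  "cross_block N f j = LCross (Gv j) (v_sign N j) (f (Gv j))"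

definition surface_blocks :: "seifert \<Rightarrow> (seifert_gen \<Rightarrow> bool) \<Rightarrow> seifert_gen lblock list" where
  "surface_blocks N f = (if base_orientable (stype N) then map (handle_block N f) [0..<genus N]
     else map (cross_block N f) [0..<genus N])"

text \<open>
  The blocks of the presentation of a Seifert group. The first \<open>m\<close> exceptional
  generators change the sheet and are grouped in pairs.
\<close>

definition lblocks :: "seifert \<Rightarrow> (seifert_gen \<Rightarrow> bool) \<Rightarrow> nat \<Rightarrow> seifert_gen lblock list" where
  "lblocks N f m = LFib (euler N) # map (pair_block N) [0..<m div 2] @
     map (cone_block N) [m..<num_s N] @ surface_blocks N f"

lemma odd_word_replicate [simp]: "odd_word f (replicate n (x, b)) \<longleftrightarrow> f x \<and> odd n"
  by (induction n) auto

lemma odd_word_letter_power [simp]: "odd_word f (letter_power x k) \<longleftrightarrow> f x \<and> odd k"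
  by (simp add: letter_power_def even_nat_iff)

lemma odd_word_concat: "(\<And>w. w \<in> set ws \<Longrightarrow> \<not> odd_word f w) \<Longrightarrow> \<not> odd_word f (concat ws)"
  by (induction ws) auto

lemma wval_lift_concat:
  "(\<And>w. w \<in> set ws \<Longrightarrow> \<not> odd_word f w) \<Longrightarrow>
   wval p (lift_word f i (concat ws)) = sum_list (map (\<lambda>w. wval p (lift_word f i w)) ws)"
  by (induction ws) auto

lemma lift_word_replicate_even: "\<not> f x \<Longrightarrow> lift_word f i (replicate n (x, b)) = replicate n ((x, i), b)"
  by (induction n) auto

lemma lift_letter_power_even: "\<not> f x \<Longrightarrow> lift_word f i (letter_power x k) = letter_power (x, i) k"
  by (simp add: letter_power_def lift_word_replicate_even)

text \<open>
  A power of a generator that changes the sheet alternates between its two lifts.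
\<close>

lemma wval_lift_power_odd:
  fixes p :: "'a \<times> bool \<Rightarrow> 'p::group_add"
  assumes "f x" "even k"
  shows "wval p (lift_word f i (letter_power x k)) = zmul (k div 2) (p (x, i) + p (x, \<not> i))"
proof -
  have *: "wval p (lift_word f i (replicate (2 * n) (x, b))) =
     zmul (int n) (if b then p (x, i) + p (x, \<not> i) else - p (x, \<not> i) + - p (x, i))" for n b
  proof (induction n)
    case (Suc n)
    have e: "replicate (2 * Suc n) (x, b) = [(x, b), (x, b)] @ replicate (2 * n) (x, b)" by simp
    have z: "zmul (int (Suc n)) z = z + zmul (int n) z" for z :: 'p
      using zmul_succ[of "int n" z] by (simp add: add.commute)
    show ?case unfolding e z lift_word_append using assms Suc by (cases b; cases i) (simp_all add: add.assoc del: add_uminus_conv_diff)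
  qed simp
  obtain l where l: "k = 2 * l" using assms(2) by blast
  show ?thesis
  proof (cases "0 \<le> k")
    case True
    then have "nat \<bar>k\<bar> = 2 * nat l" using l by auto
    then show ?thesis unfolding letter_power_def using *[of "nat l" True] True l by simp
  next
    case False
    then have "nat \<bar>k\<bar> = 2 * nat (- l)" using l by auto
    then have "wval p (lift_word f i (letter_power x k)) = zmul (- l) (- p (x, \<not> i) + - p (x, i))"
      unfolding letter_power_def using *[of "nat (- l)" False] False l by simp
    also have "\<dots> = zmul l (p (x, i) + p (x, \<not> i))"
      by (simp only: minus_add[symmetric] zmul_minus zmul_uminus minus_minus)
    finally show ?thesis using l by simp
  qed
qed

lemma flip_flip: "flip \<alpha> (flip \<beta> h) = flip (\<alpha> = \<beta>) h"
  by (cases \<alpha>; cases \<beta>) auto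

lemma flip_conj_iff: "g + flip \<alpha> h - g = flip \<beta> h \<longleftrightarrow> acts h (\<alpha> = \<beta>) g"
  using acts_flip[of \<alpha> h "\<alpha> = \<beta>" g] unfolding acts_def flip_flip
  by (cases \<alpha>; cases \<beta>) auto

definition lifted_s :: "(seifert_gen \<Rightarrow> bool) \<Rightarrow> seifert \<Rightarrow> (seifert_gen \<times> bool \<Rightarrow> 'p::group_add) \<Rightarrow> nat \<Rightarrow> bool" where
  "lifted_s f N p k \<longleftrightarrow> (\<forall>i. wval p (lift_word f i (letter_commutator (Gs k) Gh)) = 0 \<and>
     wval p (lift_word f i (letter_power (Gs k) (fst (pairs N ! k)) @ letter_power Gh (snd (pairs N ! k)))) = 0)"

definition lifted_v :: "(seifert_gen \<Rightarrow> bool) \<Rightarrow> seifert \<Rightarrow> (seifert_gen \<times> bool \<Rightarrow> 'p::group_add) \<Rightarrow> nat \<Rightarrow> bool" where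
  "lifted_v f N p j \<longleftrightarrow> (\<forall>i. wval p (lift_word f i
     ([(Gv j, True), (Gh, True), (Gv j, False)] @ letter_power Gh (- seifert_sign (stype N) j))) = 0)"

definition lifted_long :: "(seifert_gen \<Rightarrow> bool) \<Rightarrow> seifert \<Rightarrow> (seifert_gen \<times> bool \<Rightarrow> 'p::group_add) \<Rightarrow> bool" where
  "lifted_long f N p \<longleftrightarrow> (\<forall>i. wval p (lift_word f i
     (letter_power Gh (- euler N) @ map (\<lambda>k. (Gs k, True)) [0..<num_s N] @ surface_word N)) = 0)"

lemma sat_lift_seifert:
  "sat (lift_rels f t (seifert_rels N)) p \<longleftrightarrow> p (t, False) = 0 \<and>
     (\<forall>k<num_s N. lifted_s f N p k) \<and> (\<forall>j<num_v N. lifted_v f N p j) \<and> lifted_long f N p"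
proof -
  have "sat (lift_rels f t (seifert_rels N)) p \<longleftrightarrow> p (t, False) = 0 \<and>
     (\<forall>r\<in>seifert_rels N. \<forall>i. wval p (lift_word f i r) = 0)"
    unfolding sat_def lift_rels_def by auto
  then show ?thesis
    unfolding seifert_rels_def lifted_s_def lifted_v_def lifted_long_def by blast
qed

lemma lifted_v_iff:
  assumes "\<not> f Gh" "p (Gh, True) = flip \<theta> (p (Gh, False))"
  shows "lifted_v f N p j \<longleftrightarrow> acts (p (Gh, False)) (eff \<theta> (f (Gv j)) (v_sign N j)) (p (Gv j, False)) \<and>
    acts (p (Gh, False)) (eff \<theta> (f (Gv j)) (v_sign N j)) (p (Gv j, True))"
proof -
  have s: "zmul (seifert_sign (stype N) j) h = flip (v_sign N j) h" for h :: 'a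
    using seifert_sign_cases[of "stype N" j] by (auto simp: v_sign_def)
  have w: "wval p (lift_word f i ([(Gv j, True), (Gh, True), (Gv j, False)] @ letter_power Gh (- seifert_sign (stype N) j))) = 0
     \<longleftrightarrow> p (Gv j, i) + p (Gh, i \<noteq> f (Gv j)) - p (Gv j, i) = flip (v_sign N j) (p (Gh, i))" for i
  proof -
    have "wval p (lift_word f i ([(Gv j, True), (Gh, True), (Gv j, False)] @ letter_power Gh (- seifert_sign (stype N) j)))
      = p (Gv j, i) + p (Gh, i \<noteq> f (Gv j)) - p (Gv j, i) - flip (v_sign N j) (p (Gh, i))"
      using assms(1) by (cases i; cases "f (Gv j)")
        (simp_all add: lift_letter_power_even s group_norm del: add_uminus_conv_diff)
    then show ?thesis by simp
  qed
  have "lifted_v f N p j \<longleftrightarrow> (\<forall>i. p (Gv j, i) + p (Gh, i \<noteq> f (Gv j)) - p (Gv j, i) = flip (v_sign N j) (p (Gh, i)))"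
    unfolding lifted_v_def w ..
  also have "\<dots> \<longleftrightarrow> (\<forall>i. acts (p (Gh, False)) (eff \<theta> (f (Gv j)) (v_sign N j)) (p (Gv j, i)))"
  proof (rule all_cong1)
    fix i
    have h: "p (Gh, k) = flip (k \<longrightarrow> \<theta>) (p (Gh, False))" for k
      using assms(2) by (cases k) auto
    have "((i \<noteq> f (Gv j) \<longrightarrow> \<theta>) = (v_sign N j = (i \<longrightarrow> \<theta>))) = eff \<theta> (f (Gv j)) (v_sign N j)"
      by (auto simp: eff_def)
    then show "p (Gv j, i) + p (Gh, i \<noteq> f (Gv j)) - p (Gv j, i) = flip (v_sign N j) (p (Gh, i)) \<longleftrightarrow>
        acts (p (Gh, False)) (eff \<theta> (f (Gv j)) (v_sign N j)) (p (Gv j, i))"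
      unfolding h[of i] h[of "i \<noteq> f (Gv j)"] flip_flip flip_conj_iff by simp
  qed
  finally show ?thesis by (auto simp: all_bool_eq)
qed

lemma lifted_s_even_iff:
  assumes "\<not> f Gh" "\<not> f (Gs k)" "p (Gh, True) = flip \<theta> (p (Gh, False))"
  shows "lifted_s f N p k \<longleftrightarrow> lok \<theta> (p (Gh, False)) p (cone_block N k)"
proof -
  have c: "wval p (lift_word f i (letter_commutator (Gs k) Gh)) = 0 \<longleftrightarrow> acts (p (Gh, i)) True (p (Gs k, i))" for i
    using assms(1,2) by (simp add: letter_commutator_def acts_iff)
  have w: "wval p (lift_word f i (letter_power (Gs k) a @ letter_power Gh b)) = zmul a (p (Gs k, i)) + zmul b (p (Gh, i))" for i a b
    using assms(1,2) by (simp add: lift_letter_power_even)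
  show ?thesis
    unfolding lifted_s_def c w cone_block_def by (auto simp: all_bool_eq assms(3) zmul_flip)
qed

lemma lifted_s_odd_iff:
  assumes "\<not> f Gh" "f (Gs k)" "p (Gh, True) = p (Gh, False)" "even (fst (pairs N ! k))"
  shows "lifted_s f N p k \<longleftrightarrow> acts (p (Gh, False)) True (p (Gs k, False)) \<and> acts (p (Gh, False)) True (p (Gs k, True)) \<and>
    zmul (fst (pairs N ! k) div 2) (p (Gs k, False) + p (Gs k, True)) + zmul (snd (pairs N ! k)) (p (Gh, False)) = 0"
proof -
  have c: "wval p (lift_word f i (letter_commutator (Gs k) Gh)) = 0 \<longleftrightarrow> acts (p (Gh, False)) True (p (Gs k, i))" for i
    using assms(1,2) by (cases i) (simp_all add: letter_commutator_def acts_iff assms(3))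
  have w: "wval p (lift_word f i (letter_power (Gs k) (fst (pairs N ! k)) @ letter_power Gh b)) =
     zmul (fst (pairs N ! k) div 2) (p (Gs k, i) + p (Gs k, \<not> i)) + zmul b (p (Gh, False))" for i b
    using assms by (cases i) (simp_all add: lift_letter_power_even wval_lift_power_odd)
  have sw: "zmul a (p (Gs k, True) + p (Gs k, False)) + zmul b (p (Gh, False)) = 0"
    if "acts (p (Gh, False)) True (p (Gs k, True))" "zmul a (p (Gs k, False) + p (Gs k, True)) + zmul b (p (Gh, False)) = 0" for a b
    using zmul_conj_same(1)[OF that] by (simp add: group_norm del: add_uminus_conv_diff)
  show ?thesis
    unfolding lifted_s_def c w by (auto simp: all_bool_eq sw)
qed

lemma wval_lift_long:
  assumes "\<not> f Gh" and s: "\<And>k. k < num_s N \<Longrightarrow> f (Gs k) \<longleftrightarrow> k < m" and m: "even m" "m \<le> num_s N"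
    and h: "p (Gh, True) = flip \<theta> (p (Gh, False))"
  shows "wval p (lift_word f i (letter_power Gh (- euler N) @ map (\<lambda>k. (Gs k, True)) [0..<num_s N] @ surface_word N))
    = lsum i \<theta> (p (Gh, False)) p (lblocks N f m)"
proof -
  let ?s = "\<lambda>k. (Gs k, True)"
  have "[0..<num_s N] = [0..<m] @ [m..<num_s N]" using m(2) upt_add_eq_append[of 0 m "num_s N - m"] by simp
  moreover have "map ?s [0..<2 * l] = concat (map (\<lambda>i. [?s (2 * i), ?s (2 * i + 1)]) [0..<l])" for l
    by (induction l) auto
  from this[of "m div 2"] have "map ?s [0..<m] = concat (map (\<lambda>i. [?s (2 * i), ?s (2 * i + 1)]) [0..<m div 2])"
    using m(1) by simp
  moreover have "map ?s xs = concat (map (\<lambda>k. [?s k]) xs)" for xs by (induction xs) auto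
  from this[of "[m..<num_s N]"] have "map ?s [m..<num_s N] = concat (map (\<lambda>k. [?s k]) [m..<num_s N])" .
  ultimately have sw: "map ?s [0..<num_s N] = concat (map (\<lambda>i. [?s (2 * i), ?s (2 * i + 1)]) [0..<m div 2]) @
      concat (map (\<lambda>k. [?s k]) [m..<num_s N])" by (simp only: map_append)
  have e1: "\<not> odd_word f w" if "w \<in> set (map (\<lambda>i. [?s (2 * i), ?s (2 * i + 1)]) [0..<m div 2])" for w
    using that s m by auto
  have e2: "\<not> odd_word f w" if "w \<in> set (map (\<lambda>k. [?s k]) [m..<num_s N])" for w
    using that s m by auto
  have p1: "wval p (lift_word f i [?s (2 * j), ?s (2 * j + 1)]) = lval i \<theta> (p (Gh, False)) p (pair_block N j)" if "j < m div 2" for j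
  proof -
    have "2 * j < m" using that m(1) by auto
    then have "f (Gs (2 * j))" using s[of "2 * j"] m(2) by simp
    then show ?thesis by (simp add: pair_block_def)
  qed
  have p2: "wval p (lift_word f i [?s k]) = lval i \<theta> (p (Gh, False)) p (cone_block N k)" for k
    by (simp add: cone_block_def)
  have h1: "wval p (lift_word f i (letter_power Gh (- euler N))) = lval i \<theta> (p (Gh, False)) p (LFib (euler N))"
    using assms(1) by (cases i) (simp_all add: lift_letter_power_even h zmul_flip)
  have v: "wval p (lift_word f i (surface_word N)) = lsum i \<theta> (p (Gh, False)) p (surface_blocks N f)"
  proof (cases "base_orientable (stype N)")
    case True
    have "wval p (lift_word f i (letter_commutator (Gv (2 * j)) (Gv (2 * j + 1)))) = lval i \<theta> (p (Gh, False)) p (handle_block N f j)" for j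
      by (cases i; cases "f (Gv (2 * j))"; cases "f (Gv (Suc (2 * j)))")
        (simp_all add: letter_commutator_def handle_block_def group_norm del: add_uminus_conv_diff)
    moreover have "wval p (lift_word f i (surface_word N)) = sum_list (map (\<lambda>w. wval p (lift_word f i w))
        (map (\<lambda>j. letter_commutator (Gv (2 * j)) (Gv (2 * j + 1))) [0..<genus N]))"
      unfolding surface_word_def if_P[OF True] by (rule wval_lift_concat) (auto simp: letter_commutator_def)
    ultimately show ?thesis using True by (simp add: surface_blocks_def o_def)
  next
    case False
    have "wval p (lift_word f i (letter_power (Gv j) 2)) = lval i \<theta> (p (Gh, False)) p (cross_block N f j)" for j
      by (cases i; cases "f (Gv j)")
        (simp_all add: cross_block_def wval_lift_power_odd lift_letter_power_even zmul_double[of 1, simplified])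
    moreover have "wval p (lift_word f i (surface_word N)) = sum_list (map (\<lambda>w. wval p (lift_word f i w))
        (map (\<lambda>j. letter_power (Gv j) 2) [0..<genus N]))"
      unfolding surface_word_def if_not_P[OF False] by (rule wval_lift_concat) auto
    ultimately show ?thesis using False by (simp add: surface_blocks_def o_def)
  qed
  let ?L1 = "map (\<lambda>i. [?s (2 * i), ?s (2 * i + 1)]) [0..<m div 2]" and ?L2 = "map (\<lambda>k. [?s k]) [m..<num_s N]"
  have o1: "\<not> odd_word f (concat ?L1)" by (rule odd_word_concat) (rule e1)
  have o2: "\<not> odd_word f (concat ?L2)" by (rule odd_word_concat) (rule e2)
  have w1: "wval p (lift_word f i (concat ?L1)) = lsum i \<theta> (p (Gh, False)) p (map (pair_block N) [0..<m div 2])"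
  proof -
    have "wval p (lift_word f i (concat ?L1)) = sum_list (map (\<lambda>w. wval p (lift_word f i w)) ?L1)"
      by (rule wval_lift_concat) (rule e1)
    also have "\<dots> = sum_list (map (\<lambda>j. lval i \<theta> (p (Gh, False)) p (pair_block N j)) [0..<m div 2])"
      unfolding map_map o_def by (rule arg_cong[where f = sum_list], rule map_cong[OF HOL.refl], rule p1) simp
    finally show ?thesis by (simp only: map_map o_def)
  qed
  have w2: "wval p (lift_word f i (concat ?L2)) = lsum i \<theta> (p (Gh, False)) p (map (cone_block N) [m..<num_s N])"
  proof -
    have "wval p (lift_word f i (concat ?L2)) = sum_list (map (\<lambda>w. wval p (lift_word f i w)) ?L2)"
      by (rule wval_lift_concat) (rule e2)
    then show ?thesis by (simp only: map_map o_def p2)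
  qed
  have sums: "wval p (lift_word f i (map ?s [0..<num_s N])) = lsum i \<theta> (p (Gh, False)) p (map (pair_block N) [0..<m div 2] @ map (cone_block N) [m..<num_s N])"
    unfolding sw lift_word_append wval_append using o1 w1 w2 by simp
  have e: "\<not> odd_word f (map ?s [0..<num_s N])" unfolding sw using o1 o2 by simp
  show ?thesis
    unfolding lift_word_append wval_append using h1 v sums e assms(1) by (simp add: lblocks_def add.assoc)
qed

text \<open>
  If \<open>t\<close> is an exceptional generator, its sign is 1; pairs of such generators occur
  only for \<open>m > 0\<close>, when \<open>t\<close> is chosen among them.
\<close>

lemma sat_lift_iff_sheet_system:
  assumes f: "\<not> f Gh" and s: "\<And>k. k < num_s N \<Longrightarrow> f (Gs k) \<longleftrightarrow> k < m" and m: "even m" "m \<le> num_s N"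
    and a: "\<And>k. k < m \<Longrightarrow> even (fst (pairs N ! k))"
    and t: "(\<exists>k<num_s N. t = Gs k \<and> \<theta>) \<or> m = 0 \<and> (\<exists>j<num_v N. t = Gv j \<and> \<theta> = v_sign N j)" "f t"
  shows "sat (lift_rels f t (seifert_rels N)) p \<longleftrightarrow> sheet_system \<theta> Gh t (lblocks N f m) p"
proof -
  have h: "p (Gh, True) = flip \<theta> (p (Gh, False))"
    if "p (t, False) = 0" "\<forall>k<num_s N. lifted_s f N p k" "\<forall>j<num_v N. lifted_v f N p j"
    using t(1)
  proof (elim disjE exE conjE)
    fix k assume k: "k < num_s N" "t = Gs k" "\<theta>"
    then have "wval p (lift_word f False (letter_commutator (Gs k) Gh)) = 0" using that(2) unfolding lifted_s_def by blast
    then show ?thesis using k that(1) t(2) f by (simp add: letter_commutator_def)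
  next
    fix j assume j: "j < num_v N" "t = Gv j" "\<theta> = v_sign N j"
    then have "wval p (lift_word f False ([(Gv j, True), (Gh, True), (Gv j, False)] @ letter_power Gh (- seifert_sign (stype N) j))) = 0"
      using that(3) unfolding lifted_v_def by blast
    moreover have "wval p (lift_word f False (letter_power Gh (- seifert_sign (stype N) j))) = - flip \<theta> (p (Gh, False))"
      using f j(3) seifert_sign_cases[of "stype N" j] by (elim disjE) (simp_all add: lift_letter_power_even v_sign_def)
    ultimately show ?thesis using j that(1) t(2) f by simp
  qed
  have main: "(\<forall>k<num_s N. lifted_s f N p k) \<and> (\<forall>j<num_v N. lifted_v f N p j) \<and> lifted_long f N p \<longleftrightarrow>
     (\<forall>B\<in>set (lblocks N f m). lok \<theta> (p (Gh, False)) p B) \<and>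
     lsum False \<theta> (p (Gh, False)) p (lblocks N f m) = 0 \<and> lsum True \<theta> (p (Gh, False)) p (lblocks N f m) = 0"
    if h: "p (Gh, True) = flip \<theta> (p (Gh, False))"
  proof -
    have "lifted_long f N p \<longleftrightarrow> lsum False \<theta> (p (Gh, False)) p (lblocks N f m) = 0 \<and> lsum True \<theta> (p (Gh, False)) p (lblocks N f m) = 0"
    proof -
      have w: "wval p (lift_word f i (letter_power Gh (- euler N) @ map (\<lambda>k. (Gs k, True)) [0..<num_s N] @ surface_word N)) =
         lsum i \<theta> (p (Gh, False)) p (lblocks N f m)" for i
        by (rule wval_lift_long) (use f s m h in auto)
      show ?thesis unfolding lifted_long_def w by (auto simp: all_bool_eq)
    qed
    moreover have "(\<forall>j<num_v N. lifted_v f N p j) \<longleftrightarrow> (\<forall>B\<in>set (surface_blocks N f). lok \<theta> (p (Gh, False)) p B)"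
    proof (cases "base_orientable (stype N)")
      case True
      note e = all_less_double
      have "(\<forall>j<num_v N. lifted_v f N p j) \<longleftrightarrow> (\<forall>i<genus N. lifted_v f N p (2 * i) \<and> lifted_v f N p (2 * i + 1))"
        using True e by (simp add: num_v_def)
      then show ?thesis using True
        by (auto simp: lifted_v_iff[of f p \<theta>, OF f h] surface_blocks_def handle_block_def)
    next
      case False
      then show ?thesis
        by (auto simp: lifted_v_iff[of f p \<theta>, OF f h] surface_blocks_def cross_block_def num_v_def)
    qed
    moreover have "(\<forall>k<num_s N. lifted_s f N p k) \<longleftrightarrow>
      (\<forall>B\<in>set (map (pair_block N) [0..<m div 2] @ map (cone_block N) [m..<num_s N]). lok \<theta> (p (Gh, False)) p B)"
    proof -
      note e = all_less_double
      have "(\<forall>k<num_s N. lifted_s f N p k) \<longleftrightarrow> (\<forall>k<m. lifted_s f N p k) \<and> (\<forall>k\<in>{m..<num_s N}. lifted_s f N p k)"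
        using m(2) by (auto simp: not_less)
      also have "(\<forall>k\<in>{m..<num_s N}. lifted_s f N p k) \<longleftrightarrow> (\<forall>k\<in>{m..<num_s N}. lok \<theta> (p (Gh, False)) p (cone_block N k))"
        by (rule ball_cong[OF HOL.refl], rule lifted_s_even_iff) (use f s h in auto)
      also have "(\<forall>k<m. lifted_s f N p k) \<longleftrightarrow> (\<forall>i<m div 2. lifted_s f N p (2 * i) \<and> lifted_s f N p (2 * i + 1))"
        using e[of "m div 2"] m(1) by simp
      also have "\<dots> \<longleftrightarrow> (\<forall>i<m div 2. lok \<theta> (p (Gh, False)) p (pair_block N i))"
      proof (intro all_cong1 imp_cong HOL.refl)
        fix i assume "i < m div 2"
        then have i: "2 * i < m" "2 * i + 1 < m" using m(1) by auto
        then have "\<theta>" using t(1) by auto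
        then have h': "p (Gh, True) = p (Gh, False)" using h by simp
        show "lifted_s f N p (2 * i) \<and> lifted_s f N p (2 * i + 1) \<longleftrightarrow> lok \<theta> (p (Gh, False)) p (pair_block N i)"
          using lifted_s_odd_iff[of f "2 * i" p N, OF f _ h' a[OF i(1)]] lifted_s_odd_iff[of f "2 * i + 1" p N, OF f _ h' a[OF i(2)]]
            s[of "2 * i"] s[of "2 * i + 1"] i m(2) by (auto simp: pair_block_def)
      qed
      finally show ?thesis by (auto simp: ball_Un)
    qed
    ultimately show ?thesis by (auto simp: lblocks_def ball_Un)
  qed
  show ?thesis unfolding sat_lift_seifert sheet_system_def using h main by blast
qed

section \<open>Normal forms of block words\<close>

abbreviation XC :: "bool \<Rightarrow> shape" where "XC \<sigma> \<equiv> Cross () \<sigma>"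
abbreviation HD :: "bool \<Rightarrow> bool \<Rightarrow> shape" where "HD \<sigma> \<tau> \<equiv> Handle () \<sigma> () \<tau>"
abbreviation CN :: "int \<times> int \<Rightarrow> shape" where "CN q \<equiv> Cone () (fst q) (snd q)"

text \<open>
  Blocks that contain a generator along which the total space is not orientable.
\<close>

definition flips :: "shape \<Rightarrow> bool" where
  "flips B \<longleftrightarrow> B = XC True \<or> (\<exists>\<sigma> \<tau>. B = HD \<sigma> \<tau> \<and> \<not> (\<sigma> \<and> \<tau>))"


definition std_shape :: "int \<Rightarrow> seifert_type \<Rightarrow> nat \<Rightarrow> (int \<times> int) list \<Rightarrow> shape multiset" where
  "std_shape e T g qs = image_mset shape_of (mset (std_blocks (Seifert e T g qs)))"

lemma std_shape_eq:
  "std_shape e T g qs = {#Fib e#} + mset (map CN qs) +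
     (if base_orientable T then mset (map (\<lambda>i. HD (seifert_sign T (2 * i) = 1) (seifert_sign T (2 * i + 1) = 1)) [0..<g])
      else mset (map (\<lambda>j. XC (seifert_sign T j = 1)) [0..<g]))"
proof -
  have "map (\<lambda>k. Cone () (fst (qs ! k)) (snd (qs ! k))) [0..<length qs] = map CN qs"
    by (rule nth_equalityI) auto
  then have "image_mset (\<lambda>k. Cone () (fst (qs ! k)) (snd (qs ! k))) (mset [0..<length qs]) = mset (map CN qs)"
    by (metis mset_map)
  then show ?thesis
    by (simp add: std_shape_def std_blocks_def num_s_def multiset.map_comp o_def)
qed

lemma mset_map_const: "(\<And>x. x \<in> set xs \<Longrightarrow> h x = c) \<Longrightarrow> mset (map h xs) = replicate_mset (length xs) c"
  by (induction xs) auto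

lemma std_shape_simps:
  "std_shape e O1 g qs = {#Fib e#} + mset (map CN qs) + replicate_mset g (HD True True)"
  "std_shape e O2 g qs = {#Fib e#} + mset (map CN qs) + replicate_mset g (HD False False)"
  "std_shape e N1 g qs = {#Fib e#} + mset (map CN qs) + replicate_mset g (XC True)"
  "std_shape e N2 g qs = {#Fib e#} + mset (map CN qs) + replicate_mset g (XC False)"
  by (simp_all add: std_shape_eq base_orientable_def seifert_sign_def mset_map_const del: mset_map)

lemma std_shape_N4:
  assumes "2 \<le> g"
  shows "std_shape e N4 g qs = {#Fib e#} + mset (map CN qs) + replicate_mset 2 (XC True) + replicate_mset (g - 2) (XC False)"
proof -
  have "[0..<g] = [0..<2] @ [2..<g]" proof -
    obtain k where "g = 2 + k" using assms le_Suc_ex by blast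
    then show ?thesis using upt_add_eq_append[of 0 2 k] by (simp only: le0)
  qed
  moreover have "mset (map (\<lambda>j. XC (seifert_sign N4 j = 1)) [0..<2]) = replicate_mset (length [0..<2]) (XC True)"
    by (rule mset_map_const) (auto simp: seifert_sign_def)
  moreover have "mset (map (\<lambda>j. XC (seifert_sign N4 j = 1)) [2..<g]) = replicate_mset (length [2..<g]) (XC False)"
    by (rule mset_map_const) (auto simp: seifert_sign_def)
  ultimately show ?thesis
    unfolding std_shape_eq by (simp add: base_orientable_def del: mset_map)
qed

definition same_up_to_sign :: "int \<times> int \<Rightarrow> int \<times> int \<Rightarrow> bool" where
  "same_up_to_sign q q' \<longleftrightarrow> fst q' = fst q \<and> (snd q' = snd q \<or> snd q' = - snd q)"

abbreviation twice :: "bool list \<Rightarrow> shape list" where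
  "twice ss \<equiv> concat (map (\<lambda>\<sigma>. [XC \<sigma>, XC \<sigma>]) ss)"

lemma mset_twice: "mset (twice ss) = replicate_mset (2 * length (filter id ss)) (XC True) + replicate_mset (2 * length (filter Not ss)) (XC False)"
  by (induction ss) auto

lemma flips_HD_XC: "flips (HD False False)" "flips (XC True)"
  by (auto simp: flips_def)

context
  fixes hn :: 'n and X :: "'x set" and S :: "('x \<Rightarrow> 'p::group_add) \<Rightarrow> bool"
begin

abbreviation (input) shaped :: "shape multiset \<Rightarrow> bool" where "shaped U \<equiv> has_shape hn X S U"

lemma shaped_move: "block_move TYPE('n) TYPE('p) L0 L1 \<Longrightarrow> shaped (mset L0 + U) \<Longrightarrow> shaped (mset L1 + U)"
  by (rule has_shape_move)

lemma shaped_merge: "shaped ({#Fib e, Fib f#} + U) \<Longrightarrow> shaped ({#Fib (e + f)#} + U)"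
  using shaped_move[OF move_merge, of e f U] by simp

lemma shaped_swap: "shaped ({#HD \<sigma> \<tau>#} + U) \<Longrightarrow> shaped ({#HD \<tau> \<sigma>#} + U)"
  using shaped_move[OF move_handle_swap, of \<sigma> \<tau> U] by simp

lemma shaped_flip_cone: "flips B \<Longrightarrow> shaped ({#B, Cone () a b#} + U) \<Longrightarrow> shaped ({#B, Cone () a (- b)#} + U)"
proof -
  assume B: "flips B" and H: "shaped ({#B, Cone () a b#} + U)"
  have hf: "shaped ({#HD \<sigma> False, Cone () a (- b)#} + U)" if "shaped ({#HD \<sigma> False, Cone () a b#} + U)" for \<sigma>
    using shaped_move[OF move_cone_handle, of a b \<sigma> U] that by (simp add: add_mset_commute)
  consider "B = XC True" | \<sigma> where "B = HD \<sigma> False" | \<tau> where "B = HD False \<tau>"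
    using B unfolding flips_def by blast
  then show ?thesis
  proof cases
    case 1
    then show ?thesis using shaped_move[OF move_cone_cross, of a b U] H by (simp add: add_mset_commute)
  next
    case 2
    then show ?thesis using hf H by blast
  next
    case 3
    have "shaped ({#HD \<tau> False, Cone () a b#} + U)"
      using shaped_swap[of False \<tau> "{#Cone () a b#} + U"] H 3 by (simp add: add_mset_commute)
    then have "shaped ({#HD \<tau> False, Cone () a (- b)#} + U)" by (rule hf)
    then show ?thesis using shaped_swap[of \<tau> False "{#Cone () a (- b)#} + U"] 3 by (simp add: add_mset_commute)
  qed
qed

lemma shaped_flip_fib: "flips B \<Longrightarrow> shaped ({#B, Fib e#} + U) \<Longrightarrow> shaped ({#B, Fib (- e)#} + U)"
proof -
  assume B: "flips B" and H: "shaped ({#B, Fib e#} + U)"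
  have hf: "shaped ({#HD \<sigma> False, Fib (- e)#} + U)" if "shaped ({#HD \<sigma> False, Fib e#} + U)" for \<sigma>
    using shaped_move[OF move_fib_handle, of e \<sigma> U] that by (simp add: add_mset_commute)
  consider "B = XC True" | \<sigma> where "B = HD \<sigma> False" | \<tau> where "B = HD False \<tau>"
    using B unfolding flips_def by blast
  then show ?thesis
  proof cases
    case 1
    then show ?thesis using shaped_move[OF move_fib_cross, of e U] H by (simp add: add_mset_commute)
  next
    case 2
    then show ?thesis using hf H by blast
  next
    case 3
    have "shaped ({#HD \<tau> False, Fib e#} + U)"
      using shaped_swap[of False \<tau> "{#Fib e#} + U"] H 3 by (simp add: add_mset_commute)
    then have "shaped ({#HD \<tau> False, Fib (- e)#} + U)" by (rule hf)
    then show ?thesis using shaped_swap[of \<tau> False "{#Fib (- e)#} + U"] 3 by (simp add: add_mset_commute)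
  qed
qed

lemma shaped_flip_cones:
  assumes B: "flips B" and q: "list_all2 (\<lambda>q q'. fst q' = fst q \<and> (snd q' = snd q \<or> snd q' = - snd q)) qs qs'"
    and H: "shaped ({#B#} + mset (map CN qs) + U)"
  shows "shaped ({#B#} + mset (map CN qs') + U)"
  using q H
proof (induction arbitrary: U)
  case (Cons q qs q' qs')
  have "shaped ({#B, Cone () (fst q) (snd q)#} + (mset (map CN qs) + U))"
    using Cons.prems by (simp add: add_mset_commute)
  then have "shaped ({#B, CN q'#} + (mset (map CN qs) + U))"
    using shaped_flip_cone[OF B, of "fst q" "snd q" "mset (map CN qs) + U"] Cons.hyps(1) by auto
  then have "shaped ({#B#} + mset (map CN qs) + ({#CN q'#} + U))" by (simp add: add_mset_commute)
  from Cons.IH[OF this] show ?case by (simp add: add_mset_commute)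
qed simp

lemma shaped_fib_cancel:
  assumes B: "flips B" and f: "f = e \<or> f = - e" and H: "shaped ({#Fib e, Fib f#} + ({#B#} + U))"
  shows "shaped ({#Fib 0#} + ({#B#} + U))"
proof -
  have "shaped ({#Fib e, Fib (- e)#} + ({#B#} + U))"
  proof (cases "f = - e")
    case False
    then have "shaped ({#B, Fib e#} + ({#Fib e#} + U))" using f H by (simp add: add_mset_commute)
    from shaped_flip_fib[OF B this] show ?thesis by (simp add: add_mset_commute)
  qed (use H in simp)
  from shaped_merge[OF this] show ?thesis by simp
qed

text \<open>
  Any signs of a handle that are not both 1 are equivalent, by \<open>[x, y] = [x y, y]\<close>
  and by exchanging \<open>x\<close> and \<open>y\<close>.
\<close>

lemma shaped_handle_FF: "\<not> (\<sigma> \<and> \<tau>) \<Longrightarrow> shaped ({#HD \<sigma> \<tau>#} + U) \<Longrightarrow> shaped ({#HD False False#} + U)"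
proof -
  assume n: "\<not> (\<sigma> \<and> \<tau>)" and H: "shaped ({#HD \<sigma> \<tau>#} + U)"
  have TF: "shaped ({#HD True False#} + U) \<Longrightarrow> ?thesis"
    using shaped_move[OF move_handle_add, of True False U] by simp
  show ?thesis using n H TF shaped_swap[of False True U] by (cases \<sigma>; cases \<tau>) auto
qed

lemma shaped_handles_FF:
  assumes "shaped ({#HD False False#} + mset (map (\<lambda>(\<sigma>, \<tau>). HD \<sigma> \<tau>) hs) + U)"
  shows "shaped (replicate_mset (Suc (length hs)) (HD False False) + U)"
  using assms
proof (induction hs arbitrary: U)
  case (Cons h hs)
  obtain \<sigma> \<tau> where h: "h = (\<sigma>, \<tau>)" by (cases h)
  let ?M = "mset (map (\<lambda>(\<sigma>, \<tau>). HD \<sigma> \<tau>) hs)"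
  have 1: "shaped ({#HD False False, HD \<sigma> \<tau>#} + (?M + U))" using Cons.prems h by (simp add: add_mset_commute)
  have "shaped ({#HD False False, HD False False#} + (?M + U))"
  proof (cases "\<sigma> \<and> \<tau>")
    case True
    then have "shaped ({#HD False False, HD False True#} + (?M + U))"
      using 1 shaped_move[OF move_handle_slide, of False False True True "?M + U"] by simp
    then have "shaped ({#HD False True#} + ({#HD False False#} + (?M + U)))" by (simp add: add_mset_commute)
    then show ?thesis using shaped_handle_FF[of False True "{#HD False False#} + (?M + U)"] by (simp add: add_mset_commute)
  next
    case False
    have "shaped ({#HD \<sigma> \<tau>#} + ({#HD False False#} + (?M + U)))" using 1 by (simp add: add_mset_commute)
    then show ?thesis using shaped_handle_FF[OF False, of "{#HD False False#} + (?M + U)"] by (simp add: add_mset_commute)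
  qed
  then have "shaped ({#HD False False#} + ?M + ({#HD False False#} + U))" by (simp add: add_mset_commute)
  from Cons.IH[OF this] show ?case by simp
qed simp

lemma shaped_nontrivial_handles:
  assumes H: "shaped (mset (map (\<lambda>(\<sigma>, \<tau>). HD \<sigma> \<tau>) hs) + U)" and n: "(\<sigma>, \<tau>) \<in> set hs" "\<not> (\<sigma> \<and> \<tau>)"
  shows "shaped (replicate_mset (length hs) (HD False False) + U)"
proof -
  obtain xs ys where hs: "hs = xs @ (\<sigma>, \<tau>) # ys" using n(1) by (meson split_list)
  let ?M = "mset (map (\<lambda>(\<sigma>, \<tau>). HD \<sigma> \<tau>) (xs @ ys))"
  have "shaped ({#HD \<sigma> \<tau>#} + (?M + U))" using H hs by simp
  from shaped_handle_FF[OF n(2) this] have "shaped ({#HD False False#} + ?M + U)" by simp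
  from shaped_handles_FF[OF this] show ?thesis using hs by simp
qed

text \<open>
  A handle whose two signs agree turns into two crosscaps of equal sign, and the sign of the
  crosscap that helps is kept. So one fixed crosscap dissolves all handles.
\<close>

lemma shaped_handles_cross:
  assumes "shaped (mset (map (\<lambda>\<delta>. HD \<delta> \<delta>) ds) + ({#XC \<zeta>#} + U))"
  shows "shaped (mset (concat (map (\<lambda>\<delta>. [XC (\<zeta> = \<delta>), XC (\<zeta> = \<delta>)]) ds)) + ({#XC \<zeta>#} + U))"
  using assms
proof (induction ds arbitrary: U)
  case (Cons \<delta> ds)
  let ?M = "mset (map (\<lambda>\<delta>. HD \<delta> \<delta>) ds)"
  have z: "((\<zeta> = \<delta>) = \<delta>) = \<zeta>" by auto
  have "shaped (mset [HD \<delta> \<delta>, XC \<zeta>] + (?M + U))" using Cons.prems by (simp add: add_mset_commute)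
  from shaped_move[OF move_handle_cross this] z
  have "shaped (?M + ({#XC \<zeta>#} + ({#XC (\<zeta> = \<delta>), XC (\<zeta> = \<delta>)#} + U)))" by (simp add: add_mset_commute)
  from Cons.IH[OF this] show ?case by (simp add: add_mset_commute)
qed simp

text \<open>
  Three crosscaps of signs 1, -1, 1 are a handle of signs -1, -1 with a crosscap of sign -1.
  Dissolving this handle with a crosscap of sign 1 instead changes the number of signs 1 by two.
\<close>

lemma shaped_quad:
  assumes "shaped ({#XC True, XC True, XC True, XC False#} + U)"
  shows "shaped ({#XC True, XC False, XC False, XC False#} + U)"
proof -
  have "shaped (mset [XC True, XC False, XC True] + ({#XC True#} + U))" using assms by (simp add: add_mset_commute)
  then have "shaped (mset [HD False False, XC False] + ({#XC True#} + U))"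
    using shaped_move[OF move_cross_handle, of False False False "{#XC True#} + U"] by simp
  then have "shaped (mset [HD False False, XC True] + ({#XC False#} + U))" by (simp add: add_mset_commute)
  from shaped_move[OF move_handle_cross this] show ?thesis by (simp add: add_mset_commute)
qed

lemma shaped_mixed_cross:
  assumes "shaped (replicate_mset (2 * Suc A) (XC True) + replicate_mset (Suc B) (XC False) + U)"
  shows "shaped (replicate_mset 2 (XC True) + replicate_mset (2 * A + Suc B) (XC False) + U)"
  using assms
proof (induction A arbitrary: B)
  case 0
  then show ?case by simp
next
  case (Suc A)
  have "shaped ({#XC True, XC True, XC True, XC False#} + (replicate_mset (Suc (2 * A)) (XC True) + replicate_mset B (XC False) + U))"
    using Suc.prems by (simp add: add_mset_commute)
  from shaped_quad[OF this] have "shaped (replicate_mset (2 * Suc A) (XC True) + replicate_mset (Suc (B + 2)) (XC False) + U)"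
    by (simp add: add_mset_commute)
  from Suc.IH[OF this] show ?case by (simp add: eval_nat_numeral)
qed

text \<open>
  In the presence of an orientation-reversing block the signs of the \<open>b\<close> can be
  chosen freely, and two fibre powers \<open>e\<close> and \<open>\<plusminus>e\<close> cancel.
\<close>

lemma has_shape_fib_cones:
  assumes B: "flips B" and e: "f = e \<or> f = - e" and q: "list_all2 same_up_to_sign qs qs'"
    and H: "shaped ({#Fib e, Fib f#} + mset (map CN qs) + ({#B#} + U))"
  shows "shaped ({#Fib 0#} + mset (map CN qs') + ({#B#} + U))"
proof -
  have "shaped ({#Fib e, Fib f#} + ({#B#} + (mset (map CN qs) + U)))" using H by (simp add: add_mset_commute)
  from shaped_fib_cancel[OF B e this] have "shaped ({#B#} + mset (map CN qs) + ({#Fib 0#} + U))" by (simp add: add_mset_commute)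
  from shaped_flip_cones[OF B q[unfolded same_up_to_sign_def] this] show ?thesis by (simp add: add_mset_commute)
qed

lemma has_shape_O1:
  assumes "shaped ({#Fib e, Fib f#} + mset (map CN qs) + replicate_mset g (HD True True))"
  shows "shaped (std_shape (e + f) O1 g qs)"
  using shaped_merge[of e f "mset (map CN qs) + replicate_mset g (HD True True)"] assms
  by (simp add: std_shape_simps add.assoc)

lemma has_shape_O2:
  assumes H: "shaped ({#Fib e, Fib f#} + mset (map CN qs) + mset (map (\<lambda>(\<sigma>, \<tau>). HD \<sigma> \<tau>) hs))"
    and h: "\<exists>h\<in>set hs. h \<noteq> (True, True)" and e: "f = e \<or> f = - e" and q: "list_all2 same_up_to_sign qs qs'"
  shows "shaped (std_shape 0 O2 (length hs) qs')"
proof -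
  from h obtain \<sigma> \<tau> where st: "(\<sigma>, \<tau>) \<in> set hs" "\<not> (\<sigma> \<and> \<tau>)" by auto
  have "shaped (mset (map (\<lambda>(\<sigma>, \<tau>). HD \<sigma> \<tau>) hs) + ({#Fib e, Fib f#} + mset (map CN qs)))"
    using H by (simp add: add_ac)
  from shaped_nontrivial_handles[OF this st]
  have H': "shaped (replicate_mset (length hs) (HD False False) + ({#Fib e, Fib f#} + mset (map CN qs)))" .
  obtain n where n: "length hs = Suc n" using st(1) by (cases hs) auto
  have "shaped ({#Fib e, Fib f#} + mset (map CN qs) + ({#HD False False#} + replicate_mset n (HD False False)))"
    using H' n by (simp add: add_ac)
  from has_shape_fib_cones[OF flips_HD_XC(1) e q this] show ?thesis
    by (simp add: std_shape_simps n add_ac)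
qed

lemma has_shape_crosses:
  assumes H: "shaped ({#Fib e, Fib f#} + mset (map CN qs) + (mset (map (\<lambda>\<delta>. HD \<delta> \<delta>) ds) + mset (twice ss)))"
    and z: "\<zeta> \<in> set ss"
  shows "shaped ({#Fib e, Fib f#} + mset (map CN qs) + mset (twice (ss @ map (\<lambda>\<delta>. \<zeta> = \<delta>) ds)))"
proof -
  obtain xs ys where ss: "ss = xs @ \<zeta> # ys" using z by (meson split_list)
  let ?U = "{#XC \<zeta>#} + (mset (twice (xs @ ys)) + ({#Fib e, Fib f#} + mset (map CN qs)))"
  have "shaped (mset (map (\<lambda>\<delta>. HD \<delta> \<delta>) ds) + ({#XC \<zeta>#} + ?U))"
    using H ss by (simp add: add_ac add_mset_commute)
  from shaped_handles_cross[OF this] show ?thesis using ss by (simp add: add_ac o_def add_mset_commute)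
qed

lemma twice_replicate: "\<forall>\<sigma>\<in>set es. \<sigma> = \<rho> \<Longrightarrow> mset (twice es) = replicate_mset (2 * length es) (XC \<rho>)"
  by (induction es) auto

lemma has_shape_N1:
  assumes H: "shaped ({#Fib e, Fib f#} + mset (map CN qs) + mset (twice es))" and es: "\<forall>\<sigma>\<in>set es. \<sigma>" "es \<noteq> []"
    and e: "f = e \<or> f = - e" and q: "list_all2 same_up_to_sign qs qs'"
  shows "shaped (std_shape 0 N1 (2 * length es) qs')"
proof -
  have m: "mset (twice es) = replicate_mset (2 * length es) (XC True)" by (rule twice_replicate) (use es in simp)
  obtain n where n: "2 * length es = Suc n" using es(2) by (cases es) auto
  have "shaped ({#Fib e, Fib f#} + mset (map CN qs) + ({#XC True#} + replicate_mset n (XC True)))"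
    using H unfolding m n by simp
  from has_shape_fib_cones[OF flips_HD_XC(2) e q this] show ?thesis
    unfolding n by (simp add: std_shape_simps add_ac)
qed

lemma has_shape_N2:
  assumes H: "shaped ({#Fib e, Fib f#} + mset (map CN qs) + mset (twice es))" and es: "\<forall>\<sigma>\<in>set es. \<not> \<sigma>"
  shows "shaped (std_shape (e + f) N2 (2 * length es) qs)"
proof -
  have m: "mset (twice es) = replicate_mset (2 * length es) (XC False)" by (rule twice_replicate) (use es in simp)
  show ?thesis
    using shaped_merge[of e f "mset (map CN qs) + mset (twice es)"] H
    by (simp add: m std_shape_simps add.assoc)
qed

text \<open>
  Each sign occurs an even number of times, as each crosscap occurs twice. Signs 1 can be
  removed in pairs until two are left, which is type \<open>N4\<close> and never
  \<open>N3\<close>.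
\<close>

lemma has_shape_N4:
  assumes H: "shaped ({#Fib e, Fib f#} + mset (map CN qs) + mset (twice es))" and es: "True \<in> set es" "False \<in> set es"
    and e: "f = e \<or> f = - e" and q: "list_all2 same_up_to_sign qs qs'"
  shows "shaped (std_shape 0 N4 (2 * length es) qs')"
proof -
  have "filter id es \<noteq> []" "filter Not es \<noteq> []" using es by (auto simp: filter_empty_conv)
  then obtain A B where A: "length (filter id es) = Suc A" and B: "length (filter Not es) = Suc B"
    by (metis length_0_conv not0_implies_Suc)
  have l: "length es = Suc A + Suc B"
    using sum_length_filter_compl[of id es] A B by (simp add: id_def)
  let ?F = "{#Fib e, Fib f#} + mset (map CN qs)"
  have B2: "2 * Suc B = Suc (2 * B + 1)" by simp
  have m: "mset (twice es) = replicate_mset (2 * Suc A) (XC True) + replicate_mset (Suc (2 * B + 1)) (XC False)"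
    unfolding mset_twice A B B2 ..
  have "shaped (replicate_mset (2 * Suc A) (XC True) + replicate_mset (Suc (2 * B + 1)) (XC False) + ?F)"
    using H unfolding m by (simp only: add_ac)
  from shaped_mixed_cross[OF this]
  have "shaped (?F + ({#XC True#} + ({#XC True#} + replicate_mset (2 * A + Suc (2 * B + 1)) (XC False))))"
    by (simp add: eval_nat_numeral add_ac)
  from has_shape_fib_cones[OF flips_HD_XC(2) e q this] have
    "shaped ({#Fib 0#} + mset (map CN qs') + ({#XC True#} + ({#XC True#} + replicate_mset (2 * A + Suc (2 * B + 1)) (XC False))))"
    .
  moreover have "2 * length es - 2 = 2 * A + Suc (2 * B + 1)" using l by simp
  ultimately show ?thesis using l
    by (subst std_shape_N4) (simp_all add: eval_nat_numeral add_ac add_mset_commute)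
qed

end

subsection \<open>The shape of the cover\<close>

lemma parallel_shape_simps [simp]:
  "parallel_shape \<theta> [] = {#}"
  "parallel_shape \<theta> (B # D) = image_mset shape_of (mset (fst (parallel_lifts \<theta> B) @ snd (parallel_lifts \<theta> B))) + parallel_shape \<theta> D"
  "parallel_shape \<theta> (D @ D') = parallel_shape \<theta> D + parallel_shape \<theta> D'"
  by (simp_all add: parallel_shape_def)

lemma opposite_shape_simps [simp]:
  "opposite_shape \<theta> [] = {#}"
  "opposite_shape \<theta> (B # D) = image_mset shape_of (mset (fst (opposite_lifts \<theta> B) @ snd (opposite_lifts \<theta> B))) + opposite_shape \<theta> D"
  "opposite_shape \<theta> (D @ D') = opposite_shape \<theta> D + opposite_shape \<theta> D'"
  by (simp_all add: opposite_shape_def)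

lemma sheet_system_rotate: "sheet_system \<theta> h t (A @ B) p \<longleftrightarrow> sheet_system \<theta> h t (B @ A) p"
  unfolding sheet_system_def by (auto simp: ball_Un add_eq_0_swap)

lemma sheets_shape_pair:
  fixes h s s' :: 'a
  assumes "distinct ((h, False) # (h, True) # lnames (A @ LPair s a b s' a' b' # B))"
  shows "has_shape (h, False) (set ((h, False) # (h, True) # lnames (A @ LPair s a b s' a' b' # B)))
    (sheet_system True h s (A @ LPair s a b s' a' b' # B) :: ('a \<times> bool \<Rightarrow> 'p::group_add) \<Rightarrow> bool)
    (parallel_shape True (B @ A) + {#CN (a div 2, b), CN (a' div 2, b')#})"
proof -
  let ?D = "LPair s a b s' a' b' # (B @ A)"
  let ?R = "[Cone (s, True) (a div 2) b, Cone (s', False) (a' div 2) b']"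
  have L: "sheet_system True h s (A @ LPair s a b s' a' b' # B) = (sheet_system True h s ?D :: ('a \<times> bool \<Rightarrow> 'p) \<Rightarrow> bool)"
    using sheet_system_rotate[of True h s A "LPair s a b s' a' b' # B"] by (intro ext) simp
  have d: "distinct ((h, False) # (h, True) # lnames ?D)" using assms by auto
  have Y: "set ((h, False) # [] @ [(s, True), (s', False)] @ lnames (B @ A)) = set ((h, False) # names [] @ names ?R @ lnames (B @ A))"
    by simp
  have X: "set ((h, False) # (h, True) # lnames (A @ LPair s a b s' a' b' # B)) = set ((h, False) # (h, True) # lnames ?D)" by auto
  have "has_shape (h, False) (set ((h, False) # (h, True) # lnames ?D)) (sheet_system True h s ?D :: ('a \<times> bool \<Rightarrow> 'p) \<Rightarrow> bool)
    (parallel_shape True (B @ A) + image_mset shape_of (mset ([] @ ?R)))"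
    by (rule has_shape_trans[OF start_pair[OF HOL.refl d]], rule has_shape_parallel) (use d in auto)
  then show ?thesis unfolding L X by simp
qed

lemma sheets_shape_handle_first:
  fixes h x y :: 'a
  assumes "distinct ((h, False) # (h, True) # lnames (A @ LHandle x \<sigma> True y \<tau> \<gamma> # B))"
  shows "has_shape (h, False) (set ((h, False) # (h, True) # lnames (A @ LHandle x \<sigma> True y \<tau> \<gamma> # B)))
    (sheet_system \<sigma> h x (A @ LHandle x \<sigma> True y \<tau> \<gamma> # B) :: ('a \<times> bool \<Rightarrow> 'p::group_add) \<Rightarrow> bool)
    (parallel_shape \<sigma> (B @ A) + {#HD True (eff \<sigma> \<gamma> \<tau>)#})"
proof -
  let ?D = "LHandle x \<sigma> True y \<tau> \<gamma> # (B @ A)"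
  let ?R = "[Handle (x, True) True (y, False) (eff \<sigma> \<gamma> \<tau>)]"
  have L: "sheet_system \<sigma> h x (A @ LHandle x \<sigma> True y \<tau> \<gamma> # B) = (sheet_system \<sigma> h x ?D :: ('a \<times> bool \<Rightarrow> 'p) \<Rightarrow> bool)"
    using sheet_system_rotate[of \<sigma> h x A "LHandle x \<sigma> True y \<tau> \<gamma> # B"] by (intro ext) simp
  have d: "distinct ((h, False) # (h, True) # lnames ?D)" using assms by auto
  have X: "set ((h, False) # (h, True) # lnames (A @ LHandle x \<sigma> True y \<tau> \<gamma> # B)) = set ((h, False) # (h, True) # lnames ?D)" by auto
  have "has_shape (h, False) (set ((h, False) # (h, True) # lnames ?D)) (sheet_system \<sigma> h x ?D :: ('a \<times> bool \<Rightarrow> 'p) \<Rightarrow> bool)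
    (parallel_shape \<sigma> (B @ A) + image_mset shape_of (mset ([] @ ?R)))"
    by (rule has_shape_trans[OF start_handle_first[OF HOL.refl d]], rule has_shape_parallel) (use d in auto)
  then show ?thesis unfolding L X by simp
qed

lemma sheets_shape_handle_second:
  fixes h x y :: 'a
  assumes "distinct ((h, False) # (h, True) # lnames (A @ LHandle x \<sigma> False y \<tau> True # B))"
  shows "has_shape (h, False) (set ((h, False) # (h, True) # lnames (A @ LHandle x \<sigma> False y \<tau> True # B)))
    (sheet_system \<tau> h y (A @ LHandle x \<sigma> False y \<tau> True # B) :: ('a \<times> bool \<Rightarrow> 'p::group_add) \<Rightarrow> bool)
    (parallel_shape \<tau> (B @ A) + {#HD \<sigma> True#})"
proof -
  let ?D = "LHandle x \<sigma> False y \<tau> True # (B @ A)"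
  let ?Q = "[Handle (x, False) \<sigma> (y, True) True]"
  have L: "sheet_system \<tau> h y (A @ LHandle x \<sigma> False y \<tau> True # B) = (sheet_system \<tau> h y ?D :: ('a \<times> bool \<Rightarrow> 'p) \<Rightarrow> bool)"
    using sheet_system_rotate[of \<tau> h y A "LHandle x \<sigma> False y \<tau> True # B"] by (intro ext) simp
  have d: "distinct ((h, False) # (h, True) # lnames ?D)" using assms by auto
  have X: "set ((h, False) # (h, True) # lnames (A @ LHandle x \<sigma> False y \<tau> True # B)) = set ((h, False) # (h, True) # lnames ?D)" by auto
  have "has_shape (h, False) (set ((h, False) # (h, True) # lnames ?D)) (sheet_system \<tau> h y ?D :: ('a \<times> bool \<Rightarrow> 'p) \<Rightarrow> bool)
    (parallel_shape \<tau> (B @ A) + image_mset shape_of (mset (?Q @ [])))"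
    by (rule has_shape_trans[OF start_handle_second[OF HOL.refl d]], rule has_shape_parallel) (use d in auto)
  then show ?thesis unfolding L X by simp
qed

lemma sheets_shape_cross:
  fixes h v :: 'a
  assumes "distinct ((h, False) # (h, True) # lnames (A @ LCross v \<sigma> True # B))" "\<forall>E\<in>set (A @ B). only_crosses E"
  shows "has_shape (h, False) (set ((h, False) # (h, True) # lnames (A @ LCross v \<sigma> True # B)))
    (sheet_system \<sigma> h v (A @ LCross v \<sigma> True # B) :: ('a \<times> bool \<Rightarrow> 'p::group_add) \<Rightarrow> bool) (opposite_shape \<sigma> (B @ A))"
proof -
  let ?D = "LCross v \<sigma> True # (B @ A)"
  have L: "sheet_system \<sigma> h v (A @ LCross v \<sigma> True # B) = (sheet_system \<sigma> h v ?D :: ('a \<times> bool \<Rightarrow> 'p) \<Rightarrow> bool)"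
    using sheet_system_rotate[of \<sigma> h v A "LCross v \<sigma> True # B"] by (intro ext) simp
  have d: "distinct ((h, False) # (h, True) # lnames ?D)" using assms by auto
  have X: "set ((h, False) # (h, True) # lnames (A @ LCross v \<sigma> True # B)) = set ((h, False) # (h, True) # lnames ?D)" by auto
  have "has_shape (h, False) (set ((h, False) # (h, True) # lnames ?D)) (sheet_system \<sigma> h v ?D :: ('a \<times> bool \<Rightarrow> 'p) \<Rightarrow> bool)
    (opposite_shape \<sigma> (B @ A) + image_mset shape_of (mset ([] :: ('a \<times> bool) block list)))"
    by (rule has_shape_trans[OF start_cross[OF HOL.refl d]], rule has_shape_opposite) (use d assms(2) in auto)
  then show ?thesis unfolding L X by simp
qed


abbreviation both :: "'a list \<Rightarrow> ('a \<times> bool) list" where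
  "both xs \<equiv> concat (map (\<lambda>x. [(x, False), (x, True)]) xs)"

lemma set_both: "set (both xs) = set xs \<times> UNIV"
  by (induction xs) (auto simp: UNIV_bool)

lemma distinct_both: "distinct xs \<Longrightarrow> distinct (both xs)"
  by (induction xs) (auto simp: set_both)

lemma lnames_lblocks:
  assumes "even m" "m \<le> num_s N"
  shows "lnames (lblocks N f m) = both (map Gs [0..<num_s N] @ map Gv [0..<num_v N])"
proof -
  have "lnames (map (pair_block N) [0..<l]) = both (map Gs [0..<2 * l])" for l
    by (induction l) (auto simp: pair_block_def)
  from this[of "m div 2"] have p: "lnames (map (pair_block N) [0..<m div 2]) = both (map Gs [0..<m])"
    using assms(1) by simp
  have c: "lnames (map (cone_block N) ks) = both (map Gs ks)" for ks
    by (induction ks) (auto simp: cone_block_def)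
  have "lnames (map (handle_block N f) [0..<g]) = both (map Gv [0..<2 * g])" for g
    by (induction g) (auto simp: handle_block_def)
  moreover have "lnames (map (cross_block N f) [0..<g]) = both (map Gv [0..<g])" for g
    by (induction g) (auto simp: cross_block_def)
  ultimately have "lnames (surface_blocks N f) = both (map Gv [0..<num_v N])"
    by (simp add: surface_blocks_def num_v_def)
  moreover have "[0..<num_s N] = [0..<m] @ [m..<num_s N]" using assms(2) upt_add_eq_append[of 0 m "num_s N - m"] by simp
  ultimately show ?thesis
    using p c[of "[m..<num_s N]"] by (simp add: lblocks_def)
qed

lemma lblocks_gens:
  assumes "even m" "m \<le> num_s N"
  shows "distinct ((Gh, False) # (Gh, True) # lnames (lblocks N f m))"
    "set ((Gh, False) # (Gh, True) # lnames (lblocks N f m)) = seifert_gens N \<times> UNIV"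
proof -
  have "distinct (both (map Gs [0..<num_s N] @ map Gv [0..<num_v N]))"
    by (rule distinct_both) (auto simp: distinct_map inj_on_def)
  then show "distinct ((Gh, False) # (Gh, True) # lnames (lblocks N f m))"
    unfolding lnames_lblocks[OF assms] by (auto simp: set_both)
  have "set (lnames (lblocks N f m)) = (Gs ` {..<num_s N} \<union> Gv ` {..<num_v N}) \<times> UNIV"
    unfolding lnames_lblocks[OF assms] set_both by (auto simp: image_iff)
  then show "set ((Gh, False) # (Gh, True) # lnames (lblocks N f m)) = seifert_gens N \<times> UNIV"
    by (auto simp: seifert_gens_def)
qed

definition double_pairs :: "bool \<Rightarrow> (int \<times> int) list \<Rightarrow> (int \<times> int) list" where
  "double_pairs \<alpha> ps = concat (map (\<lambda>(a, b). [(a, b), (a, sgn_mul \<alpha> b)]) ps)"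

lemma double_pairs_F: "double_pairs True ps = F_ord 0 ps" "double_pairs False ps = F_OC ps"
  by (induction ps) (auto simp: double_pairs_def F_ord_def F_OC_def)

lemma double_pairs_same_up_to_sign: "list_all2 same_up_to_sign (double_pairs \<alpha> ps) (F_ord 0 ps)"
  by (induction ps) (auto simp: double_pairs_def F_ord_def same_up_to_sign_def)

lemma same_up_to_sign_refl: "list_all2 same_up_to_sign qs qs"
  by (auto simp: list_all2_conv_all_nth same_up_to_sign_def)

lemma parallel_shape_cones:
  "parallel_shape \<theta> (map (cone_block N) ks) = mset (map CN (double_pairs \<theta> (map (\<lambda>k. pairs N ! k) ks)))"
  by (induction ks) (auto simp: double_pairs_def cone_block_def split: prod.split)

lemma opposite_shape_cones:
  "opposite_shape \<theta> (map (cone_block N) ks) = mset (map CN (double_pairs (\<not> \<theta>) (map (\<lambda>k. pairs N ! k) ks)))"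
  by (induction ks) (auto simp: double_pairs_def cone_block_def split: prod.split)

abbreviation halve :: "int \<times> int \<Rightarrow> int \<times> int" where
  "halve \<equiv> \<lambda>(a, b). (a div 2, b)"

lemma parallel_shape_pairs:
  "parallel_shape \<theta> (map (pair_block N) ks) = replicate_mset (length ks) (HD True True) +
     mset (map CN (map halve (concat (map (\<lambda>i. [pairs N ! (2 * i), pairs N ! (2 * i + 1)]) ks))))"
  by (induction ks) (auto simp: pair_block_def add_ac split: prod.split)

lemma pairs_map: "map (\<lambda>k. pairs N ! k) [m..<num_s N] = drop m (pairs N)"
  by (rule nth_equalityI) (auto simp: num_s_def)

lemma take_pairs: "2 * l \<le> num_s N \<Longrightarrow>
   take (2 * l) (pairs N) = concat (map (\<lambda>i. [pairs N ! (2 * i), pairs N ! (2 * i + 1)]) [0..<l])"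
  by (induction l) (auto simp: num_s_def take_Suc_conv_app_nth)

text \<open>
  The odd generator is the first exceptional one, so the sheets are joined in the same direction
  and \<open>h\<close> is the same on both.
\<close>

lemma shape_m_pos:
  assumes "0 < m" "even m" "m \<le> num_s N"
  shows "has_shape (Gh, False) (seifert_gens N \<times> UNIV) (sheet_system True Gh (Gs 0) (lblocks N f m) :: (seifert_gen \<times> bool \<Rightarrow> 'p::group_add) \<Rightarrow> bool)
    ({#Fib (euler N), Fib (euler N)#} + mset (map CN (F_ord m (pairs N))) +
     (replicate_mset (m div 2 - 1) (HD True True) + parallel_shape True (surface_blocks N f)))"
proof -
  obtain l where l: "m = 2 * Suc l"
    using assms(1,2) by (metis dvd_def gr0_implies_Suc nat_0_less_mult_iff)
  define B where "B = map (pair_block N) [1..<Suc l] @ map (cone_block N) [m..<num_s N] @ surface_blocks N f"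
  have u: "[0..<Suc l] = 0 # [1..<Suc l]" using upt_conv_Cons[of 0 "Suc l"] by simp
  let ?P = "LPair (Gs 0) (fst (pairs N ! 0)) (snd (pairs N ! 0)) (Gs 1) (fst (pairs N ! 1)) (snd (pairs N ! 1))"
  have D: "lblocks N f m = [LFib (euler N)] @ ?P # B"
  proof -
    have "pair_block N 0 = ?P" by (simp add: pair_block_def)
    moreover have "m div 2 = Suc l" using l by simp
    ultimately have "map (pair_block N) [0..<m div 2] = ?P # map (pair_block N) [1..<Suc l]" by (simp only: u list.map)
    then show ?thesis unfolding lblocks_def B_def by (simp del: upt_Suc)
  qed
  have take: "take m (pairs N) = pairs N ! 0 # pairs N ! 1 # concat (map (\<lambda>i. [pairs N ! (2 * i), pairs N ! (2 * i + 1)]) [1..<Suc l])"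
    using take_pairs[of "Suc l" N] assms(3) l unfolding u by (simp del: upt_Suc)
  have F: "F_ord m (pairs N) = map halve (take m (pairs N)) @ double_pairs True (drop m (pairs N))"
    unfolding F_ord_def double_pairs_F by (simp add: F_ord_def)
  have eq: "parallel_shape True (B @ [LFib (euler N)]) + {#CN (fst (pairs N ! 0) div 2, snd (pairs N ! 0)), CN (fst (pairs N ! 1) div 2, snd (pairs N ! 1))#} =
    {#Fib (euler N), Fib (euler N)#} + mset (map CN (F_ord m (pairs N))) +
     (replicate_mset (m div 2 - 1) (HD True True) + parallel_shape True (surface_blocks N f))"
    unfolding B_def F take using l
    by (simp add: parallel_shape_pairs parallel_shape_cones pairs_map case_prod_unfold add_ac del: upt_Suc)
  note g = lblocks_gens[OF assms(2,3), of f, unfolded D]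
  have "has_shape (Gh, False) (seifert_gens N \<times> UNIV) (sheet_system True Gh (Gs 0) ([LFib (euler N)] @ ?P # B) :: (seifert_gen \<times> bool \<Rightarrow> 'p) \<Rightarrow> bool)
    (parallel_shape True (B @ [LFib (euler N)]) + {#CN (fst (pairs N ! 0) div 2, snd (pairs N ! 0)), CN (fst (pairs N ! 1) div 2, snd (pairs N ! 1))#})"
    using sheets_shape_pair[OF g(1)] unfolding g(2) .
  then show ?thesis unfolding D eq .
qed

definition handle_signs :: "bool \<Rightarrow> bool \<Rightarrow> (seifert_gen \<Rightarrow> bool) \<Rightarrow> nat \<Rightarrow> (bool \<times> bool) list" where
  "handle_signs \<theta> \<rho> f i = (let \<sigma> = eff \<theta> (f (Gv (2 * i))) \<rho>; \<tau> = eff \<theta> (f (Gv (2 * i + 1))) \<rho>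
     in [(if f (Gv (2 * i)) = f (Gv (2 * i + 1)) then (\<sigma>, \<tau>) else (\<tau>, \<sigma>)), (\<sigma>, \<tau>)])"

abbreviation HDs :: "(bool \<times> bool) list \<Rightarrow> shape multiset" where
  "HDs hs \<equiv> mset (map (\<lambda>(\<sigma>, \<tau>). HD \<sigma> \<tau>) hs)"

lemma parallel_shape_handles:
  assumes "\<And>j. v_sign N j = \<rho>"
  shows "parallel_shape \<theta> (map (handle_block N f) ks) = HDs (concat (map (handle_signs \<theta> \<rho> f) ks))"
proof (induction ks)
  case (Cons i ks)
  then show ?case
    by (cases "f (Gv (2 * i))"; cases "f (Gv (Suc (2 * i)))") (simp_all add: handle_block_def handle_signs_def Let_def assms eff_def)
qed simp

lemma parallel_shape_crosses:
  "parallel_shape True (map (cross_block N f) js) = mset (twice (map (v_sign N) js))"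
  by (induction js) (auto simp: cross_block_def eff_def)

lemma opposite_shape_crosses:
  "opposite_shape \<theta> (map (cross_block N f) js) =
    mset (map (\<lambda>\<delta>. HD \<delta> \<delta>) (map (\<lambda>j. v_sign N j = \<theta>) (filter (\<lambda>j. f (Gv j)) js))) +
    mset (twice (map (v_sign N) (filter (\<lambda>j. \<not> f (Gv j)) js)))"
  by (induction js) (auto simp: cross_block_def eff_def add_ac)

lemma v_sign_simps:
  "stype N = O1 \<Longrightarrow> v_sign N j" "stype N = O2 \<Longrightarrow> \<not> v_sign N j"
  "stype N = N1 \<Longrightarrow> v_sign N j" "stype N = N2 \<Longrightarrow> \<not> v_sign N j"
  "stype N = N3 \<Longrightarrow> v_sign N j \<longleftrightarrow> j < 1" "stype N = N4 \<Longrightarrow> v_sign N j \<longleftrightarrow> j < 2"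
  by (auto simp: v_sign_def seifert_sign_def)

lemma length_handle_signs: "length (concat (map (handle_signs \<theta> \<rho> f) ks)) = 2 * length ks"
  by (induction ks) (auto simp: handle_signs_def Let_def)

text \<open>
  For a handle outside the one that contains \<open>t\<close>, the signs of the covering handles
  are all 1 if \<open>\<rho>\<close> holds or both of its generators are odd. The condition on
  \<open>hs\<close> thus says when the cover is the orientation cover.
\<close>

lemma shape_orientable:
  assumes N: "base_orientable (stype N)" and \<rho>: "\<And>j. v_sign N j = \<rho>"
    and t: "i < genus N" "f (Gv (2 * i)) \<or> f (Gv (2 * i + 1))"
  obtains t j hs where "j < num_v N" "t = Gv j" "f t" "length hs = 2 * genus N - 1"
    "(\<forall>h\<in>set hs. h = (True, True)) \<longleftrightarrow> \<rho> \<or> (\<forall>j<num_v N. f (Gv j))"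
    "has_shape (Gh, False) (seifert_gens N \<times> UNIV) (sheet_system \<rho> Gh t (lblocks N f 0) :: (seifert_gen \<times> bool \<Rightarrow> 'p::group_add) \<Rightarrow> bool)
      ({#Fib (euler N), Fib (sgn_mul \<rho> (euler N))#} + mset (map CN (double_pairs \<rho> (pairs N))) + HDs hs)"
proof -
  let ?x = "Gv (2 * i)" and ?y = "Gv (2 * i + 1)"
  define A where "A = LFib (euler N) # map (cone_block N) [0..<num_s N] @ map (handle_block N f) [0..<i]"
  define B where "B = map (handle_block N f) [Suc i..<genus N]"
  have up: "[0..<genus N] = [0..<i] @ i # [Suc i..<genus N]"
  proof -
    obtain k where "genus N = i + Suc k" using t(1) less_imp_Suc_add by auto
    then show ?thesis using upt_add_eq_append[of 0 i "Suc k"] upt_conv_Cons[of i "genus N"] by simp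
  qed
  have D: "lblocks N f 0 = A @ handle_block N f i # B"
    unfolding lblocks_def surface_blocks_def A_def B_def using N by (simp add: up del: upt_Suc)
  note g = lblocks_gens[of 0 N f, OF dvd_0_right le0, unfolded D]
  define hs where "hs = concat (map (handle_signs \<rho> \<rho> f) ([0..<i] @ [Suc i..<genus N]))"
  have BA: "parallel_shape \<rho> (B @ A) = {#Fib (euler N), Fib (sgn_mul \<rho> (euler N))#} +
      mset (map CN (double_pairs \<rho> (pairs N))) + HDs hs"
    unfolding A_def B_def hs_def using pairs_map[of N 0]
    by (simp add: parallel_shape_cones parallel_shape_handles[OF \<rho>] add_ac del: upt_Suc)
  have e: "eff \<rho> b \<rho> \<longleftrightarrow> b \<or> \<rho>" for b by (auto simp: eff_def)
  have nv: "num_v N = 2 * genus N" using N by (simp add: num_v_def)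
  have trivial: "(\<forall>h\<in>set hs. h = (True, True)) \<longleftrightarrow> \<rho> \<or> (\<forall>k<genus N. k \<noteq> i \<longrightarrow> f (Gv (2 * k)) \<and> f (Gv (2 * k + 1)))"
  proof -
    have "set ([0..<i] @ [Suc i..<genus N]) = {k. k < genus N \<and> k \<noteq> i}" using t(1) by auto
    then have "(\<forall>h\<in>set hs. h = (True, True)) \<longleftrightarrow> (\<forall>k. k < genus N \<and> k \<noteq> i \<longrightarrow> (\<forall>h\<in>set (handle_signs \<rho> \<rho> f k). h = (True, True)))"
      unfolding hs_def set_concat set_map by auto
    moreover have "(\<forall>h\<in>set (handle_signs \<rho> \<rho> f k). h = (True, True)) \<longleftrightarrow> \<rho> \<or> f (Gv (2 * k)) \<and> f (Gv (2 * k + 1))" for k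
      by (auto simp: handle_signs_def Let_def e)
    ultimately show ?thesis by auto
  qed
  have all: "(\<forall>j<num_v N. f (Gv j)) \<longleftrightarrow> (\<forall>k<genus N. k \<noteq> i \<longrightarrow> f (Gv (2 * k)) \<and> f (Gv (2 * k + 1))) \<and> f ?x \<and> f ?y"
    unfolding nv all_less_double using t(1) by auto
  have len: "length hs = 2 * (genus N - 1)"
    unfolding hs_def length_handle_signs using t(1) by simp
  show thesis
  proof (cases "f ?x")
    case True
    have b: "handle_block N f i = LHandle ?x \<rho> True ?y \<rho> (f ?y)" using True by (simp add: handle_block_def \<rho>)
    have h: "has_shape (Gh, False) (seifert_gens N \<times> UNIV) (sheet_system \<rho> Gh ?x (lblocks N f 0) :: (seifert_gen \<times> bool \<Rightarrow> 'p) \<Rightarrow> bool)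
      (parallel_shape \<rho> (B @ A) + {#HD True (eff \<rho> (f ?y) \<rho>)#})"
      using sheets_shape_handle_first[OF g(1)[unfolded b]] unfolding g(2)[unfolded b] D b .
    show thesis
    proof (rule that[of "2 * i" ?x "hs @ [(True, eff \<rho> (f ?y) \<rho>)]"])
      show "(\<forall>h\<in>set (hs @ [(True, eff \<rho> (f ?y) \<rho>)]). h = (True, True)) \<longleftrightarrow> \<rho> \<or> (\<forall>j<num_v N. f (Gv j))"
        using trivial True unfolding all e set_append ball_Un by auto
          show "has_shape (Gh, False) (seifert_gens N \<times> UNIV) (sheet_system \<rho> Gh ?x (lblocks N f 0) :: (seifert_gen \<times> bool \<Rightarrow> 'p) \<Rightarrow> bool)
        ({#Fib (euler N), Fib (sgn_mul \<rho> (euler N))#} + mset (map CN (double_pairs \<rho> (pairs N))) + HDs (hs @ [(True, eff \<rho> (f ?y) \<rho>)]))"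
        using h unfolding BA by (simp add: add_ac add_mset_commute split del: if_split)
    qed (use True t len in \<open>auto simp: nv\<close>)
  next
    case False
    then have y: "f ?y" using t(2) by simp
    have b: "handle_block N f i = LHandle ?x \<rho> False ?y \<rho> True" using False y by (simp add: handle_block_def \<rho>)
    have h: "has_shape (Gh, False) (seifert_gens N \<times> UNIV) (sheet_system \<rho> Gh ?y (lblocks N f 0) :: (seifert_gen \<times> bool \<Rightarrow> 'p) \<Rightarrow> bool)
      (parallel_shape \<rho> (B @ A) + {#HD \<rho> True#})"
      using sheets_shape_handle_second[OF g(1)[unfolded b]] unfolding g(2)[unfolded b] D b .
    show thesis
    proof (rule that[of "2 * i + 1" ?y "hs @ [(\<rho>, True)]"])
      show "(\<forall>h\<in>set (hs @ [(\<rho>, True)]). h = (True, True)) \<longleftrightarrow> \<rho> \<or> (\<forall>j<num_v N. f (Gv j))"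
        using trivial False unfolding all set_append ball_Un by auto
          show "has_shape (Gh, False) (seifert_gens N \<times> UNIV) (sheet_system \<rho> Gh ?y (lblocks N f 0) :: (seifert_gen \<times> bool \<Rightarrow> 'p) \<Rightarrow> bool)
        ({#Fib (euler N), Fib (sgn_mul \<rho> (euler N))#} + mset (map CN (double_pairs \<rho> (pairs N))) + HDs (hs @ [(\<rho>, True)]))"
        using h unfolding BA by (simp add: add_ac add_mset_commute split del: if_split)
    qed (use y t len in \<open>auto simp: nv\<close>)
  qed
qed

text \<open>
  The sheets are joined in opposite directions: crosscaps that change the sheet give handles,
  the others give two crosscaps. Exceptional fibres occur with both signs of \<open>b\<close> if
  \<open>t\<close> preserves \<open>h\<close>.
\<close>

lemma shape_nonorientable:
  assumes N: "\<not> base_orientable (stype N)" and t: "i < genus N" "f (Gv i)"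
  defines "js \<equiv> [0..<i] @ [Suc i..<genus N]" and "\<theta> \<equiv> v_sign N i"
  shows "has_shape (Gh, False) (seifert_gens N \<times> UNIV) (sheet_system \<theta> Gh (Gv i) (lblocks N f 0) :: (seifert_gen \<times> bool \<Rightarrow> 'p::group_add) \<Rightarrow> bool)
      ({#Fib (euler N), Fib (sgn_mul (\<not> \<theta>) (euler N))#} + mset (map CN (double_pairs (\<not> \<theta>) (pairs N))) +
       (mset (map (\<lambda>\<delta>. HD \<delta> \<delta>) (map (\<lambda>j. v_sign N j = \<theta>) (filter (\<lambda>j. f (Gv j)) js))) +
        mset (twice (map (v_sign N) (filter (\<lambda>j. \<not> f (Gv j)) js)))))"
proof -
  define A where "A = LFib (euler N) # map (cone_block N) [0..<num_s N] @ map (cross_block N f) [0..<i]"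
  define B where "B = map (cross_block N f) [Suc i..<genus N]"
  have up: "[0..<genus N] = [0..<i] @ i # [Suc i..<genus N]"
  proof -
    obtain k where "genus N = i + Suc k" using t(1) less_imp_Suc_add by auto
    then show ?thesis using upt_add_eq_append[of 0 i "Suc k"] upt_conv_Cons[of i "genus N"] by simp
  qed
  have b: "cross_block N f i = LCross (Gv i) \<theta> True" using t(2) by (simp add: cross_block_def \<theta>_def)
  have D: "lblocks N f 0 = A @ LCross (Gv i) \<theta> True # B"
    unfolding lblocks_def surface_blocks_def A_def B_def using N b by (simp add: up del: upt_Suc)
  note g = lblocks_gens[of 0 N f, OF dvd_0_right le0, unfolded D]
  have oc: "\<forall>E\<in>set (A @ B). only_crosses E"
    by (auto simp: A_def B_def only_crosses_def cone_block_def cross_block_def)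
  have eq: "opposite_shape \<theta> (B @ A) = {#Fib (euler N), Fib (sgn_mul (\<not> \<theta>) (euler N))#} +
      mset (map CN (double_pairs (\<not> \<theta>) (pairs N))) +
       (mset (map (\<lambda>\<delta>. HD \<delta> \<delta>) (map (\<lambda>j. v_sign N j = \<theta>) (filter (\<lambda>j. f (Gv j)) js))) +
        mset (twice (map (v_sign N) (filter (\<lambda>j. \<not> f (Gv j)) js))))"
    unfolding A_def B_def js_def using pairs_map[of N 0]
    by (simp add: opposite_shape_cones opposite_shape_crosses add_ac del: upt_Suc)
  show ?thesis using sheets_shape_cross[OF g(1) oc] unfolding g(2) D eq .
qed

subsection \<open>Comparison with the prescribed invariants\<close>

abbreviation covers :: "seifert \<Rightarrow> (seifert_gen \<Rightarrow> bool) \<Rightarrow> nat \<Rightarrow> bool \<Rightarrow> seifert_gen \<Rightarrow> 'p::group_add itself \<Rightarrow> shape multiset \<Rightarrow> bool" where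
  "covers N f m \<theta> t (T :: 'p::group_add itself) U \<equiv> has_shape (Gh, False) (seifert_gens N \<times> UNIV)
     (sheet_system \<theta> Gh t (lblocks N f m) :: (seifert_gen \<times> bool \<Rightarrow> 'p) \<Rightarrow> bool) U"

lemma HDs_trivial: "\<forall>h\<in>set hs. h = (True, True) \<Longrightarrow> HDs hs = replicate_mset (length hs) (HD True True)"
  by (induction hs) auto

lemma HDs_diagonal: "mset (map (\<lambda>\<delta>. HD \<delta> \<delta>) ds) = HDs (map (\<lambda>\<delta>. (\<delta>, \<delta>)) ds)"
  by (simp add: multiset.map_comp o_def)

lemma eff_True: "eff True b \<rho> = \<rho>"
  by (auto simp: eff_def)

text \<open>
  For \<open>m > 0\<close> the base of the cover is orientable only if the original base is, and
  the new handles have signs 1.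
\<close>

lemma cover_m_pos:
  assumes "min_genus (stype N) \<le> genus N" "0 < m" "even m" "m \<le> num_s N"
  shows "covers N f m True (Gs 0) TYPE('p::group_add) (image_mset shape_of (mset (std_blocks (double_cover N m x))))"
proof -
  let ?e = "euler N" and ?q = "F_ord m (pairs N)" and ?g = "genus N"
  let ?C = "covers N f m True (Gs 0) TYPE('p)"
  note sh = shape_m_pos[OF assms(2-4), of f, where 'p = 'p]
  obtain l where l: "m = 2 * Suc l"
    using assms(2,3) by (metis dvd_def gr0_implies_Suc nat_0_less_mult_iff)
  have hd: "replicate_mset (m div 2 - 1) (HD True True) = HDs (replicate l (True, True))"
    using l by simp
  have hd': "replicate_mset (m div 2 - 1) (HD True True) = mset (map (\<lambda>\<delta>. HD \<delta> \<delta>) (replicate l True))"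
    using l by simp
  have hs: "handle_signs True \<rho> f i = [(\<rho>, \<rho>), (\<rho>, \<rho>)]" for \<rho> i
    by (simp add: handle_signs_def eff_True)
  have or: "?C ({#Fib ?e, Fib ?e#} + mset (map CN ?q) + HDs (replicate l (True, True) @ concat (map (\<lambda>_. [(\<rho>, \<rho>), (\<rho>, \<rho>)]) [0..<?g])))"
    if "base_orientable (stype N)" "\<And>j. v_sign N j = \<rho>" for \<rho>
    using sh unfolding hd surface_blocks_def if_P[OF that(1)] parallel_shape_handles[OF that(2)] hs by simp
  have len: "length (replicate l (True, True) @ concat (map (\<lambda>_. [(\<rho>, \<rho>), (\<rho>, \<rho>)]) [0..<?g])) = m div 2 + 2 * ?g - 1" for \<rho>
    using l by (simp add: length_concat o_def sum_list_triv)
  have non: "?C ({#Fib ?e, Fib ?e#} + mset (map CN ?q) + mset (twice (map (v_sign N) [0..<?g] @ map (\<lambda>\<delta>. \<zeta> = \<delta>) (replicate l True))))"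
    if "\<not> base_orientable (stype N)" "j < ?g" "v_sign N j = \<zeta>" for j \<zeta>
  proof (rule has_shape_crosses)
    show "?C ({#Fib ?e, Fib ?e#} + mset (map CN ?q) + (mset (map (\<lambda>\<delta>. HD \<delta> \<delta>) (replicate l True)) + mset (twice (map (v_sign N) [0..<?g]))))"
      using sh unfolding hd' surface_blocks_def if_not_P[OF that(1)] parallel_shape_crosses .
    show "\<zeta> \<in> set (map (v_sign N) [0..<?g])" using that(2,3) by auto
  qed
  have len': "2 * length (map (v_sign N) [0..<?g] @ map (\<lambda>\<delta>. \<zeta> = \<delta>) (replicate l True)) = m + 2 * ?g - 2" for \<zeta>
    using l by simp
  have m0: "m \<noteq> 0" using assms(2) by simp
  show ?thesis
  proof (cases "stype N")
    case O1
    have "?C (std_shape (?e + ?e) O1 (m div 2 + 2 * ?g - 1) ?q)"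
    proof (rule has_shape_O1)
      have "\<forall>h\<in>set (replicate l (True, True) @ concat (map (\<lambda>_. [(True, True), (True, True)]) [0..<?g])). h = (True, True)" by auto
      from HDs_trivial[OF this] show "?C ({#Fib ?e, Fib ?e#} + mset (map CN ?q) + replicate_mset (m div 2 + 2 * ?g - 1) (HD True True))"
        using or[of True] O1 unfolding len by (simp add: base_orientable_def v_sign_simps)
    qed
    then show ?thesis using O1 m0 by (simp add: double_cover_def cover_type_def std_shape_def base_orientable_def)
  next
    case O2
    have "?C (std_shape 0 O2 (length (replicate l (True, True) @ concat (map (\<lambda>_. [(False, False), (False, False)]) [0..<?g]))) ?q)"
    proof (rule has_shape_O2)
      show "?C ({#Fib ?e, Fib ?e#} + mset (map CN ?q) + HDs (replicate l (True, True) @ concat (map (\<lambda>_. [(False, False), (False, False)]) [0..<?g])))"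
        by (rule or) (use O2 in \<open>auto simp: base_orientable_def v_sign_simps\<close>)
      have "0 < ?g" using assms(1) O2 by (simp add: min_genus_def)
      then show "\<exists>h\<in>set (replicate l (True, True) @ concat (map (\<lambda>_. [(False, False), (False, False)]) [0..<?g])). h \<noteq> (True, True)" by auto
    qed (use same_up_to_sign_refl in auto)
    then show ?thesis unfolding len using O2 m0 by (simp add: double_cover_def cover_type_def std_shape_def base_orientable_def)
  next
    case N1
    let ?es = "map (v_sign N) [0..<?g] @ map (\<lambda>\<delta>. True = \<delta>) (replicate l True)"
    have g: "0 < ?g" using assms(1) N1 by (simp add: min_genus_def)
    have "?C (std_shape 0 N1 (2 * length ?es) ?q)"
    proof (rule has_shape_N1)
      show "?C ({#Fib ?e, Fib ?e#} + mset (map CN ?q) + mset (twice ?es))"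
        by (rule non[of 0]) (use N1 g in \<open>auto simp: base_orientable_def v_sign_simps\<close>)
    qed (use same_up_to_sign_refl g N1 in \<open>auto simp: v_sign_simps\<close>)
    then show ?thesis unfolding len' using N1 m0 by (simp add: double_cover_def cover_type_def std_shape_def base_orientable_def)
  next
    case N2
    let ?es = "map (v_sign N) [0..<?g] @ map (\<lambda>\<delta>. False = \<delta>) (replicate l True)"
    have g: "0 < ?g" using assms(1) N2 by (simp add: min_genus_def)
    have "?C (std_shape (?e + ?e) N2 (2 * length ?es) ?q)"
    proof (rule has_shape_N2)
      show "?C ({#Fib ?e, Fib ?e#} + mset (map CN ?q) + mset (twice ?es))"
        by (rule non[of 0]) (use N2 g in \<open>auto simp: base_orientable_def v_sign_simps\<close>)
    qed (use N2 in \<open>auto simp: v_sign_simps\<close>)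
    then show ?thesis unfolding len' using N2 m0 by (simp add: double_cover_def cover_type_def std_shape_def base_orientable_def)
  next
    case N3
    let ?es = "map (v_sign N) [0..<?g] @ map (\<lambda>\<delta>. False = \<delta>) (replicate l True)"
    have g: "1 < ?g" using assms(1) N3 by (simp add: min_genus_def)
    have "v_sign N 0" "\<not> v_sign N 1" using N3 by (auto simp: v_sign_simps)
    then have "True \<in> v_sign N ` {0..<?g}" "False \<in> v_sign N ` {0..<?g}"
      using g image_eqI[of True "v_sign N" 0] image_eqI[of False "v_sign N" 1] by auto
    then have es: "True \<in> set ?es" "False \<in> set ?es" by simp_all
    have "?C (std_shape 0 N4 (2 * length ?es) ?q)"
    proof (rule has_shape_N4)
      show "?C ({#Fib ?e, Fib ?e#} + mset (map CN ?q) + mset (twice ?es))"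
        by (rule non[of 1]) (use N3 g in \<open>auto simp: base_orientable_def v_sign_simps\<close>)
    qed (use same_up_to_sign_refl es in auto)
    then show ?thesis unfolding len' using N3 m0 by (simp add: double_cover_def cover_type_def std_shape_def base_orientable_def)
  next
    case N4
    let ?es = "map (v_sign N) [0..<?g] @ map (\<lambda>\<delta>. False = \<delta>) (replicate l True)"
    have g: "2 < ?g" using assms(1) N4 by (simp add: min_genus_def)
    have "v_sign N 0" "\<not> v_sign N 2" using N4 by (auto simp: v_sign_simps)
    then have "True \<in> v_sign N ` {0..<?g}" "False \<in> v_sign N ` {0..<?g}"
      using g image_eqI[of True "v_sign N" 0] image_eqI[of False "v_sign N" 2] by auto
    then have es: "True \<in> set ?es" "False \<in> set ?es" by simp_all
    have "?C (std_shape 0 N4 (2 * length ?es) ?q)"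
    proof (rule has_shape_N4)
      show "?C ({#Fib ?e, Fib ?e#} + mset (map CN ?q) + mset (twice ?es))"
        by (rule non[of 2]) (use N4 g in \<open>auto simp: base_orientable_def v_sign_simps\<close>)
    qed (use same_up_to_sign_refl es in auto)
    then show ?thesis unfolding len' using N4 m0 by (simp add: double_cover_def cover_type_def std_shape_def base_orientable_def)
  qed
qed

lemma cover_orientable:
  assumes N: "base_orientable (stype N)" and x: "\<And>j. j < num_v N \<Longrightarrow> x j = 1 \<longleftrightarrow> f (Gv j)"
    and t: "\<exists>j<num_v N. f (Gv j)"
  shows "\<exists>t \<theta>. f t \<and> (\<exists>j<num_v N. t = Gv j \<and> \<theta> = v_sign N j) \<and>
    covers N f 0 \<theta> t TYPE('p::group_add) (image_mset shape_of (mset (std_blocks (double_cover N 0 x))))"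
proof -
  let ?e = "euler N" and ?g = "genus N"
  have T: "stype N = O1 \<or> stype N = O2" using N by (simp add: base_orientable_def)
  define \<rho> where "\<rho> \<longleftrightarrow> stype N = O1"
  have \<rho>: "v_sign N j = \<rho>" for j using T by (auto simp: \<rho>_def v_sign_simps)
  obtain j where j: "j < num_v N" "f (Gv j)" using t by blast
  define i where "i = j div 2"
  have i: "i < ?g" "f (Gv (2 * i)) \<or> f (Gv (2 * i + 1))"
    using j N by (auto simp: i_def num_v_def dvd_mult_div_cancel odd_two_times_div_two_succ intro: ccontr split: if_splits)
      (metis dvd_mult_div_cancel odd_two_times_div_two_succ Suc_eq_plus1)
  obtain t k hs where k: "k < num_v N" "t = Gv k" "f t" and len: "length hs = 2 * ?g - 1"
    and tr: "(\<forall>h\<in>set hs. h = (True, True)) \<longleftrightarrow> \<rho> \<or> (\<forall>j<num_v N. f (Gv j))"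
    and sh: "covers N f 0 \<rho> t TYPE('p) ({#Fib ?e, Fib (sgn_mul \<rho> ?e)#} + mset (map CN (double_pairs \<rho> (pairs N))) + HDs hs)"
    by (rule shape_orientable[OF N \<rho> i])
  have all: "(\<forall>j<num_v N. x j = 1) \<longleftrightarrow> (\<forall>j<num_v N. f (Gv j))" using x by auto
  have "covers N f 0 \<rho> t TYPE('p) (image_mset shape_of (mset (std_blocks (double_cover N 0 x))))"
  proof (cases "\<forall>h\<in>set hs. h = (True, True)")
    case True
    have "covers N f 0 \<rho> t TYPE('p) ({#Fib ?e, Fib (sgn_mul \<rho> ?e)#} + mset (map CN (double_pairs \<rho> (pairs N))) + replicate_mset (2 * ?g - 1) (HD True True))"
      using sh unfolding HDs_trivial[OF True] len .
    note H = has_shape_O1[OF this]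
    have "double_cover N 0 x = Seifert (?e + sgn_mul \<rho> ?e) O1 (2 * ?g - 1) (double_pairs \<rho> (pairs N))"
    proof (cases "\<rho>")
      case True
      then show ?thesis
        unfolding double_cover_def Let_def by (simp add: \<rho>_def double_pairs_F cover_type_def base_orientable_def)
    next
      case False
      then have "\<forall>j<num_v N. x j = 1" "stype N = O2" using True tr all T by (auto simp: \<rho>_def)
      then show ?thesis
        unfolding double_cover_def Let_def using False by (simp add: double_pairs_F)
    qed
    then show ?thesis using H by (simp only: std_shape_def)
  next
    case False
    then have nt: "\<exists>h\<in>set hs. h \<noteq> (True, True)" by auto
    have "\<not> \<rho>" "\<not> (\<forall>j<num_v N. f (Gv j))" using False tr by auto
    moreover from has_shape_O2[OF sh nt _ double_pairs_same_up_to_sign]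
    have "covers N f 0 \<rho> t TYPE('p) (std_shape 0 O2 (2 * ?g - 1) (F_ord 0 (pairs N)))" unfolding len by auto
    moreover have "double_cover N 0 x = Seifert 0 O2 (2 * ?g - 1) (F_ord 0 (pairs N))"
      if "\<not> (\<forall>j<num_v N. x j = 1)" "stype N = O2"
      unfolding double_cover_def Let_def using that by (simp add: cover_type_def base_orientable_def)
    ultimately show ?thesis
      using T all by (simp add: \<rho>_def std_shape_def)
  qed
  then show ?thesis using k \<rho> by blast
qed

text \<open>
  The base of the cover is orientable exactly when all crosscap generators are odd. Otherwise
  one even crosscap of sign \<open>\<zeta>\<close> dissolves the handles, and \<open>es\<close>
  lists the signs of the resulting crosscaps, each of which occurs twice. All of them are 1 or
  all -1 only if the odd generators of a base of type \<open>N3\<close> or \<open>N4\<close> are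
  those of sign -1 or those of sign 1, respectively.
\<close>

lemma cover_nonorientable:
  assumes N: "\<not> base_orientable (stype N)" and g: "min_genus (stype N) \<le> genus N"
    and x: "\<And>j. j < num_v N \<Longrightarrow> x j = 1 \<longleftrightarrow> f (Gv j)" and t: "\<exists>j<num_v N. f (Gv j)"
  shows "\<exists>t \<theta>. f t \<and> (\<exists>j<num_v N. t = Gv j \<and> \<theta> = v_sign N j) \<and>
    covers N f 0 \<theta> t TYPE('p::group_add) (image_mset shape_of (mset (std_blocks (double_cover N 0 x))))"
proof -
  let ?e = "euler N" and ?g = "genus N" and ?N' = "double_cover N 0 x"
  have nv: "num_v N = ?g" using N by (simp add: num_v_def)
  obtain i where i: "i < ?g" "f (Gv i)" using t nv by auto
  define js where "js = [0..<i] @ [Suc i..<?g]"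
  define \<theta> where "\<theta> = v_sign N i"
  define ds where "ds = map (\<lambda>j. v_sign N j = \<theta>) (filter (\<lambda>j. f (Gv j)) js)"
  define ss where "ss = map (v_sign N) (filter (\<lambda>j. \<not> f (Gv j)) js)"
  let ?C = "covers N f 0 \<theta> (Gv i) TYPE('p)" and ?f = "sgn_mul (\<not> \<theta>) ?e" and ?q = "double_pairs (\<not> \<theta>) (pairs N)"
  have sh: "?C ({#Fib ?e, Fib ?f#} + mset (map CN ?q) + (mset (map (\<lambda>\<delta>. HD \<delta> \<delta>) ds) + mset (twice ss)))"
    unfolding ds_def ss_def js_def \<theta>_def by (rule shape_nonorientable[of N i f, OF N i])
  have js: "set js = {j. j < ?g \<and> j \<noteq> i}" using i(1) by (auto simp: js_def)
  have len: "length ds + length ss = ?g - 1"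
    using sum_length_filter_compl[of "\<lambda>j. f (Gv j)" js] i(1) by (simp add: ds_def ss_def js_def)
  have ds: "set ds = {v_sign N j = \<theta> | j. j < ?g \<and> j \<noteq> i \<and> f (Gv j)}" using js by (auto simp: ds_def)
  have ss: "set ss = {v_sign N j | j. j < ?g \<and> \<not> f (Gv j)}" using js i by (auto simp: ss_def)
  have dsT: "(\<forall>\<delta>\<in>set ds. \<delta>) \<longleftrightarrow> (\<forall>j<?g. f (Gv j) \<longrightarrow> v_sign N j = \<theta>)"
    unfolding ds by (auto simp: \<theta>_def)
  have ssT: "(\<forall>\<sigma>\<in>set ss. \<sigma> = \<zeta>) \<longleftrightarrow> (\<forall>j<?g. \<not> f (Gv j) \<longrightarrow> v_sign N j = \<zeta>)" for \<zeta>
    unfolding ss by auto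
  have all: "(\<forall>j<num_v N. x j = 1) \<longleftrightarrow> (\<forall>j<?g. f (Gv j))" using x nv by auto
  have only: "(\<forall>j<num_v N. x j = 1 \<longleftrightarrow> j \<in> J) \<longleftrightarrow> (\<forall>j<?g. f (Gv j) \<longleftrightarrow> j \<in> J)" for J using x nv by auto
  have neg: "(\<forall>j<num_v N. x j = 1 \<longleftrightarrow> seifert_sign (stype N) j = -1) \<longleftrightarrow> (\<forall>j<?g. f (Gv j) \<longleftrightarrow> \<not> v_sign N j)"
  proof -
    have "seifert_sign (stype N) j = - 1 \<longleftrightarrow> \<not> v_sign N j" for j
      using seifert_sign_cases[of "stype N" j] by (auto simp: v_sign_def)
    then show ?thesis using x nv by simp
  qed
  have fe: "?f = ?e \<or> ?f = - ?e" by auto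
  note qs = double_pairs_same_up_to_sign[of "\<not> \<theta>" "pairs N"]
  have T: "stype N = N1 \<or> stype N = N2 \<or> stype N = N3 \<or> stype N = N4"
    using N by (cases "stype N") (auto simp: base_orientable_def)
  define onlyJ where "onlyJ \<longleftrightarrow> (stype N = N3 \<or> stype N = N4) \<and> (\<forall>j<?g. f (Gv j) \<longleftrightarrow> v_sign N j)"
  have onlyJ: "stype N = N3 \<and> (\<forall>j<?g. f (Gv j) \<longleftrightarrow> j \<in> {0}) \<or> stype N = N4 \<and> (\<forall>j<?g. f (Gv j) \<longleftrightarrow> j \<in> {0, 1}) \<longleftrightarrow> onlyJ"
  proof -
    have "j \<in> {0} \<longleftrightarrow> v_sign N j" if "stype N = N3" for j using that by (simp add: v_sign_simps)
    moreover have "j \<in> {0, 1} \<longleftrightarrow> v_sign N j" if "stype N = N4" for j using that by (simp add: v_sign_simps less_2_cases_iff)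
    ultimately show ?thesis unfolding onlyJ_def by (cases "stype N"; simp only: seifert_type.distinct simp_thms)
  qed
  have mixed: "\<exists>j<?g. v_sign N j" "\<exists>j<?g. \<not> v_sign N j" if "stype N = N3 \<or> stype N = N4"
  proof -
    have "v_sign N 0" "\<not> v_sign N (if stype N = N3 then 1 else 2)" "0 < ?g" "(if stype N = N3 then 1 else 2) < ?g"
      using that g by (auto simp: v_sign_simps min_genus_def)
    then show "\<exists>j<?g. v_sign N j" "\<exists>j<?g. \<not> v_sign N j" by blast+
  qed
  have "?C (image_mset shape_of (mset (std_blocks ?N')))"
  proof (cases "\<forall>j<?g. f (Gv j)")
    case True
    then have "set ss = {}" unfolding ss by blast
    then have ss0: "ss = []" by simp
    have hs: "?C ({#Fib ?e, Fib ?f#} + mset (map CN ?q) + HDs (map (\<lambda>\<delta>. (\<delta>, \<delta>)) ds))"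
      using sh unfolding ss0 HDs_diagonal by (simp only: list.map concat.simps mset.simps add_0_right)
    have l: "length ds = ?g - 1" using len ss0 by simp
    have no: "\<not> onlyJ" using True mixed(2) unfolding onlyJ_def by blast
    show ?thesis
    proof (cases "stype N = N3 \<or> stype N = N4")
      case False
      then have v: "v_sign N j = \<theta>" for j using T unfolding \<theta>_def by (auto simp: v_sign_simps)
      then have "\<forall>h\<in>set (map (\<lambda>\<delta>. (\<delta>, \<delta>)) ds). h = (True, True)" using dsT by auto
      from has_shape_O1[OF hs[unfolded HDs_trivial[OF this]]]
      have "?C (std_shape (?e + ?f) O1 (?g - 1) ?q)" using l by simp
      moreover have "\<theta> \<longleftrightarrow> stype N = N1" using False T unfolding \<theta>_def by (auto simp: v_sign_simps)
      moreover have "?N' = Seifert (?e + ?f) O1 (?g - 1) ?q"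
      proof (cases "stype N = N1")
        case True
        then show ?thesis unfolding double_cover_def Let_def all using \<open>\<forall>j<?g. f (Gv j)\<close> calculation by (simp add: double_pairs_F)
      next
        case False
        then have "stype N = N2" using T \<open>\<not> (stype N = N3 \<or> stype N = N4)\<close> by blast
        then show ?thesis unfolding double_cover_def Let_def all using \<open>\<forall>j<?g. f (Gv j)\<close> calculation by (simp add: double_pairs_F)
      qed
      ultimately show ?thesis by (simp only: std_shape_def)
    next
      case N34: True
      obtain j where "j < ?g" "v_sign N j \<noteq> \<theta>" using mixed[OF N34] by (cases \<theta>) auto
      then have "\<exists>h\<in>set (map (\<lambda>\<delta>. (\<delta>, \<delta>)) ds). h \<noteq> (True, True)" using dsT True by auto
      from has_shape_O2[OF hs this fe qs] have "?C (std_shape 0 O2 (?g - 1) (F_ord 0 (pairs N)))" using l by simp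
      moreover have "?N' = Seifert 0 O2 (?g - 1) (F_ord 0 (pairs N))"
        unfolding double_cover_def Let_def only onlyJ all using N34 True no by auto
      ultimately show ?thesis by (simp only: std_shape_def)
    qed
  next
    case False
    then obtain \<zeta> where z: "\<zeta> \<in> set ss" unfolding ss by blast
    define es where "es = ss @ map (\<lambda>\<delta>. \<zeta> = \<delta>) ds"
    have es: "?C ({#Fib ?e, Fib ?f#} + mset (map CN ?q) + mset (twice es))"
      unfolding es_def by (rule has_shape_crosses[OF sh z])
    have l: "2 * length es = 2 * ?g - 2" using len by (simp add: es_def)
    have ne: "es \<noteq> []" using z by (auto simp: es_def)
    have esT: "(\<forall>\<sigma>\<in>set es. \<sigma> = \<zeta>) \<longleftrightarrow> (\<forall>j<?g. f (Gv j) \<longrightarrow> v_sign N j = \<theta>) \<and> (\<forall>j<?g. \<not> f (Gv j) \<longrightarrow> v_sign N j = \<zeta>)"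
      unfolding es_def dsT[symmetric] ssT[symmetric] by auto
    have z': "\<zeta> \<in> set es" using z by (simp add: es_def)
    consider "stype N = N1" | "stype N = N2" | "onlyJ" | "stype N = N3 \<or> stype N = N4" "\<not> onlyJ" using T by blast
    then show ?thesis
    proof cases
      case 1
      then have v: "v_sign N j" for j by (simp add: v_sign_simps)
      then have "\<zeta>" using z ss by auto
      then have "\<forall>\<sigma>\<in>set es. \<sigma>" using esT v \<theta>_def by simp
      note H = has_shape_N1[OF es this ne fe qs]
      have "?N' = Seifert 0 N1 (2 * ?g - 2) (F_ord 0 (pairs N))"
        unfolding double_cover_def Let_def all using 1 False by (simp add: cover_type_def base_orientable_def)
      then show ?thesis using H unfolding l by (simp only: std_shape_def)
    next
      case 2
      then have v: "\<not> v_sign N j" for j by (simp add: v_sign_simps)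
      then have "\<not> \<zeta>" "\<not> \<theta>" using z ss \<theta>_def by auto
      then have "\<forall>\<sigma>\<in>set es. \<not> \<sigma>" using esT v by simp
      note H = has_shape_N2[OF es this]
      have "?N' = Seifert (?e + ?f) N2 (2 * ?g - 2) ?q"
        unfolding double_cover_def Let_def all using 2 False \<open>\<not> \<theta>\<close>
        by (simp add: cover_type_def base_orientable_def double_pairs_F)
      then show ?thesis using H unfolding l by (simp only: std_shape_def)
    next
      case 3
      then have v: "f (Gv j) \<longleftrightarrow> v_sign N j" if "j < ?g" for j using that by (simp add: onlyJ_def)
      have th: "\<theta>" using v i \<theta>_def by auto
      have "\<not> \<zeta>" using z ss v by auto
      then have "\<forall>\<sigma>\<in>set es. \<not> \<sigma>" using esT v th by auto
      from has_shape_N2[OF es this] have "?C (std_shape 0 N2 (2 * ?g - 2) (F_OC (pairs N)))"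
        using th unfolding l by (simp add: double_pairs_F)
      moreover have "?N' = Seifert 0 N2 (2 * ?g - 2) (F_OC (pairs N))"
        using 3 onlyJ unfolding double_cover_def Let_def only onlyJ by (auto simp: onlyJ_def)
      ultimately show ?thesis by (simp add: std_shape_def)
    next
      case 4
      have N': "?N' = Seifert 0 (if \<forall>j<?g. f (Gv j) \<longleftrightarrow> \<not> v_sign N j then N1 else N4) (2 * ?g - 2) (F_ord 0 (pairs N))"
        using 4 False unfolding double_cover_def Let_def only onlyJ all cover_type_def neg
        by (auto simp: base_orientable_def)
      show ?thesis
      proof (cases "\<forall>j<?g. f (Gv j) \<longleftrightarrow> \<not> v_sign N j")
        case True
        then have th: "\<not> \<theta>" using i \<theta>_def by auto
        have "\<zeta>" using z ss True by auto
        then have "\<forall>\<sigma>\<in>set es. \<sigma>" using esT True th by auto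
        from has_shape_N1[OF es this ne fe qs] show ?thesis unfolding N' l if_P[OF True] by (simp only: std_shape_def)
      next
        case F: False
        have "\<not> (\<forall>\<sigma>\<in>set es. \<sigma> = \<zeta>)"
        proof
          assume "\<forall>\<sigma>\<in>set es. \<sigma> = \<zeta>"
          then have *: "\<forall>j<?g. f (Gv j) \<longrightarrow> v_sign N j = \<theta>" "\<forall>j<?g. \<not> f (Gv j) \<longrightarrow> v_sign N j = \<zeta>" using esT by auto
          then have "\<zeta> \<noteq> \<theta>" using mixed[OF 4(1)] by metis
          then show False using * 4 F onlyJ_def by (cases \<theta>) auto
        qed
        then have "True \<in> set es" "False \<in> set es" using z' by (cases \<zeta>; auto)+
        from has_shape_N4[OF es this fe qs] show ?thesis unfolding N' l if_not_P[OF F] by (simp only: std_shape_def)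
      qed
    qed
  qed
  moreover have "\<exists>j<num_v N. Gv i = Gv j \<and> \<theta> = v_sign N j" using i(1) nv \<theta>_def by auto
  ultimately show ?thesis using i(2) by (intro exI[of _ "Gv i"] exI[of _ \<theta>] conjI)
qed

definition valid_pair :: "int \<times> int \<Rightarrow> bool" where
  "valid_pair q \<longleftrightarrow> coprime (fst q) (snd q) \<and> fst q \<noteq> 0"

lemma seifert_invariants_iff:
  "seifert_invariants N \<longleftrightarrow> min_genus (stype N) \<le> genus N \<and> (\<forall>q\<in>set (pairs N). valid_pair q)"
  unfolding seifert_invariants_def valid_pair_def by auto

lemma valid_F_OC: "\<forall>q\<in>set ps. valid_pair q \<Longrightarrow> \<forall>q\<in>set (F_OC ps). valid_pair q"
proof
  fix q assume ps: "\<forall>q\<in>set ps. valid_pair q" and "q \<in> set (F_OC ps)"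
  then obtain p where p: "p \<in> set ps" "q = p \<or> q = (fst p, - snd p)" unfolding F_OC_def by auto
  have "valid_pair p" using ps p(1) by blast
  then show "valid_pair q" using p(2) unfolding valid_pair_def by (elim disjE) simp_all
qed

lemma valid_F_ord:
  assumes "\<forall>q\<in>set ps. valid_pair q" and even: "\<And>k. k < m \<Longrightarrow> k < length ps \<Longrightarrow> even (fst (ps ! k))"
  shows "\<forall>q\<in>set (F_ord m ps). valid_pair q"
proof -
  have "valid_pair (halve q)" if q: "q \<in> set (take m ps)" for q
  proof -
    have "even (fst q)" using q even by (auto simp: in_set_conv_nth)
    moreover have "valid_pair q" using q assms(1) in_set_takeD by fast
    ultimately show ?thesis
      by (cases q) (auto simp: valid_pair_def elim!: evenE)
  qed
  moreover have "valid_pair q" if "q \<in> set (drop m ps)" for q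
    using that assms(1) in_set_dropD by fast
  ultimately show ?thesis by (auto simp: F_ord_def)
qed

lemma double_cover_invariants:
  assumes "seifert_invariants N" "even m" and "\<And>k. k < m \<Longrightarrow> even (fst (pairs N ! k))"
    and x: "m = 0 \<Longrightarrow> \<exists>j<num_v N. x j = 1"
  shows "seifert_invariants (double_cover N m x)"
proof -
  have g: "min_genus (stype N) \<le> genus N" and ps: "\<forall>q\<in>set (pairs N). valid_pair q"
    using assms(1) by (auto simp: seifert_invariants_iff)
  have valid: "\<forall>q\<in>set (F_OC (pairs N)). valid_pair q" "\<forall>q\<in>set (F_ord 0 (pairs N)). valid_pair q" "\<forall>q\<in>set (F_ord m (pairs N)). valid_pair q"
    using valid_F_OC[OF ps] valid_F_ord[OF ps] assms(3) by auto
  have m: "m = 0 \<or> 2 \<le> m" using assms(2) by presburger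
  have one: "\<forall>j<num_v N. x j = 1" if "m = 0" "genus N = 1" "\<not> base_orientable (stype N)"
    using x that by (auto simp: num_v_def)
  have big: "1 \<le> m + 2 * genus N - 2"
    if "m \<noteq> 0 \<or> \<not> (\<forall>j<num_v N. x j = 1)" "\<not> base_orientable (stype N)" "1 \<le> genus N"
  proof -
    have "2 \<le> m \<or> genus N \<noteq> 1" using that m one by blast
    then show ?thesis using that(3) by linarith
  qed
  have two: "cover_type N m x = N1" if "stype N = N3" "genus N = 2" "m = 0"
    "\<not> (\<forall>j<num_v N. x j = 1)" "\<not> (\<forall>j<num_v N. x j = 1 \<longleftrightarrow> j \<in> {0})"
  proof -
    have nv: "num_v N = Suc (Suc 0)" using that by (simp add: num_v_def base_orientable_def)
    have "x 0 \<noteq> 1 \<and> x 1 = 1" using x[OF that(3)] that(4,5) unfolding nv by (auto simp: less_Suc_eq)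
    then show ?thesis using that nv by (auto simp: cover_type_def seifert_sign_def less_Suc_eq)
  qed
  have type: "cover_type N m x \<in> {N1, N4}" if "stype N = N3 \<or> stype N = N4" using that by (simp add: cover_type_def)
  have genus: "min_genus (stype (double_cover N m x)) \<le> genus (double_cover N m x)"
  proof (cases "stype N")
    case O1
    then show ?thesis by (simp add: double_cover_def Let_def cover_type_def min_genus_def base_orientable_def)
  next
    case O2
    then have "1 \<le> genus N" using g by (simp add: min_genus_def)
    then have "1 \<le> m div 2 + 2 * genus N - 1" by linarith
    then show ?thesis using O2 by (simp add: double_cover_def Let_def cover_type_def min_genus_def base_orientable_def)
  next
    case N1
    then have "m \<noteq> 0 \<or> \<not> (\<forall>j<num_v N. x j = 1) \<Longrightarrow> 1 \<le> m + 2 * genus N - 2"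
      using g big by (simp add: min_genus_def base_orientable_def)
    then show ?thesis using N1 by (auto simp: double_cover_def Let_def cover_type_def min_genus_def base_orientable_def)
  next
    case N2
    then have "m \<noteq> 0 \<or> \<not> (\<forall>j<num_v N. x j = 1) \<Longrightarrow> 1 \<le> m + 2 * genus N - 2"
      using g big by (simp add: min_genus_def base_orientable_def)
    then show ?thesis using N2 by (auto simp: double_cover_def Let_def cover_type_def min_genus_def base_orientable_def)
  next
    case N3
    define P Q where "P \<longleftrightarrow> (\<forall>j<num_v N. x j = 1)" and "Q \<longleftrightarrow> (\<forall>j<num_v N. x j = 1 \<longleftrightarrow> j \<in> {0})"
    have g2: "2 \<le> genus N" using g N3 by (simp add: min_genus_def)
    have "cover_type N m x = N1" if "genus N = 2" "m = 0" "\<not> P" "\<not> Q"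
      using two N3 that unfolding P_def Q_def by blast
    moreover have "3 \<le> m + 2 * genus N - 2" if "genus N \<noteq> 2 \<or> m \<noteq> 0"
      using that m g2 by linarith
    moreover have "cover_type N m x = N1 \<or> cover_type N m x = N4" using type N3 by auto
    ultimately show ?thesis
      using N3 g2 unfolding double_cover_def Let_def P_def[symmetric] Q_def[symmetric]
      by (cases "genus N \<noteq> 2 \<or> m \<noteq> 0") (auto simp: min_genus_def base_orientable_def)
  next
    case N4
    then show ?thesis using g type unfolding double_cover_def Let_def by (auto simp: min_genus_def base_orientable_def)
  qed
  have "\<forall>q\<in>set (pairs (double_cover N m x)). valid_pair q"
    using valid unfolding double_cover_def Let_def by (simp split: if_split)
  then show ?thesis using genus by (simp add: seifert_invariants_iff)
qed

text \<open>
  The long relator contains the first \<open>m\<close> exceptional generators once, and their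
  powers are relators up to powers of \<open>h\<close>.
\<close>

lemma even_relators:
  assumes even: "\<forall>r\<in>seifert_rels N. \<not> odd_word f r" and "\<not> f Gh"
    and s: "\<And>k. k < num_s N \<Longrightarrow> f (Gs k) \<longleftrightarrow> k < m" and m: "m \<le> num_s N"
  shows "even m" "k < m \<Longrightarrow> even (fst (pairs N ! k))"
proof -
  have "letter_power Gh (- euler N) @ map (\<lambda>k. (Gs k, True)) [0..<num_s N] @ surface_word N \<in> seifert_rels N"
    by (auto simp: seifert_rels_def)
  then have "\<not> odd_word f (letter_power Gh (- euler N) @ map (\<lambda>k. (Gs k, True)) [0..<num_s N] @ surface_word N)"
    using even by blast
  moreover have "\<not> odd_word f (surface_word N)"
    unfolding surface_word_def by (auto intro!: odd_word_concat simp: letter_commutator_def)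
  ultimately have "\<not> odd_word f (map (\<lambda>k. (Gs k, True)) [0..<num_s N])" using assms(2) by simp
  moreover have "j \<le> num_s N \<Longrightarrow> odd_word f (map (\<lambda>k. (Gs k, True)) [0..<j]) \<longleftrightarrow> odd (min j m)" for j
  proof (induction j)
    case (Suc j)
    then show ?case using s[of j] by (cases "j < m") (auto simp: min_def)
  qed simp
  ultimately show "even m" using m by (simp add: min_absorb2)
  assume k: "k < m"
  then have "letter_power (Gs k) (fst (pairs N ! k)) @ letter_power Gh (snd (pairs N ! k)) \<in> seifert_rels N"
    using m by (auto simp: seifert_rels_def)
  then have "\<not> odd_word f (letter_power (Gs k) (fst (pairs N ! k)) @ letter_power Gh (snd (pairs N ! k)))"
    using even by blast
  then show "even (fst (pairs N ! k))" using k s[of k] m assms(2) by simp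
qed

section \<open>Double covers of Seifert manifolds\<close>

theorem theorem3:
  fixes N :: seifert and \<phi> :: "seifert_gen word set \<Rightarrow> int" and m :: nat
  assumes "seifert_invariants N"
    and "\<phi> \<in> epi (seifert_group N) (integer_mod_group 2)"
    and "\<phi> (seifert_elem N Gh) = 0"
    and "m = card {k. k < num_s N \<and> \<phi> (seifert_elem N (Gs k)) = 1}"
    and "\<forall>k<num_s N. \<phi> (seifert_elem N (Gs k)) = 1 \<longleftrightarrow> k < m"
  defines "N' \<equiv> double_cover N m (\<lambda>j. \<phi> (seifert_elem N (Gv j)))"
  shows "even m \<and> (\<forall>k<m. even (fst (pairs N ! k))) \<and> seifert_invariants N' \<and>
    (seifert_group N)\<lparr>carrier := kernel (seifert_group N) (integer_mod_group 2) \<phi>\<rparr> \<cong> seifert_group N'"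
proof -
  let ?X = "seifert_gens N" and ?R = "seifert_rels N"
  define f where "f x \<longleftrightarrow> \<phi> (pres_class ?X ?R [(x, True)]) = 1" for x
  have f: "f x \<longleftrightarrow> \<phi> (seifert_elem N x) = 1" for x by (simp add: f_def seifert_elem_def)
  have hom: "\<phi> \<in> hom (presented_group ?X ?R) (integer_mod_group 2)"
    and onto: "\<phi> ` carrier (presented_group ?X ?R) = {0..<2}"
    using assms(2) by (auto simp: epi_def seifert_group_def carrier_integer_mod_group)
  have fh: "\<not> f Gh" using assms(3) by (simp add: f)
  have s: "f (Gs k) \<longleftrightarrow> k < m" if "k < num_s N" for k using assms(5) that by (simp add: f)
  have m: "m \<le> num_s N"
    unfolding assms(4) using card_mono[of "{..<num_s N}" "{k. k < num_s N \<and> \<phi> (seifert_elem N (Gs k)) = 1}"] by auto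
  have "\<exists>t\<in>?X. f t"
  proof (rule ccontr)
    assume "\<not> (\<exists>t\<in>?X. f t)"
    then have "\<not> odd_word f w" if "w \<in> words ?X" for w
      using that by (induction w) (auto simp: words_def)
    then have "\<phi> (pres_class ?X ?R w) = 0" if "w \<in> words ?X" for w
      using hom_odd_word[OF hom that] that unfolding f_def[symmetric] by simp
    then have "\<phi> ` carrier (presented_group ?X ?R) \<subseteq> {0}" by (auto simp: presented_group_def)
    then have "1 \<in> {0 :: int}" unfolding onto by (rule subsetD) simp
    then show False by simp
  qed
  then obtain t0 where t0: "t0 \<in> ?X" "f t0" by blast
  have t0': "\<phi> (pres_class ?X ?R [(t0, True)]) = 1" using t0(2) by (simp add: f_def)
  have even: "\<forall>r\<in>?R. \<not> odd_word f r"
    using kernel_iso[OF seifert_rels_words hom t0(1) t0'] unfolding f_def by blast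
  note ev = even_relators[OF even fh s m]
  have v: "\<exists>j<num_v N. f (Gv j)" if "m = 0"
    using t0 that s fh by (auto simp: seifert_gens_def)
  let ?x = "\<lambda>j. \<phi> (seifert_elem N (Gv j))"
  have x: "?x j = 1 \<longleftrightarrow> f (Gv j)" for j by (simp add: f)
  have g: "min_genus (stype N) \<le> genus N" using assms(1) by (simp add: seifert_invariants_def)
  have "\<exists>t \<theta>. f t \<and> ((\<exists>k<num_s N. t = Gs k \<and> \<theta>) \<or> m = 0 \<and> (\<exists>j<num_v N. t = Gv j \<and> \<theta> = v_sign N j)) \<and>
    covers N f m \<theta> t TYPE(((seifert_gen \<times> bool) word set + seifert_gen word set) symgroup) (image_mset shape_of (mset (std_blocks N')))"
  proof (cases "m = 0")
    case True
    show ?thesis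
    proof (cases "base_orientable (stype N)")
      case or: True
      show ?thesis using cover_orientable[of N ?x f, OF or x v[OF True]] unfolding N'_def True by blast
    next
      case False
      show ?thesis using cover_nonorientable[of N ?x f, OF False g x v[OF True]] unfolding N'_def True by blast
    qed
  next
    case False
    then have "f (Gs 0)" "0 < num_s N" using s[of 0] m by auto
    then show ?thesis using cover_m_pos[OF g _ ev(1) m, of f] False unfolding N'_def by blast
  qed
  then obtain t \<theta> where t: "f t" "(\<exists>k<num_s N. t = Gs k \<and> \<theta>) \<or> m = 0 \<and> (\<exists>j<num_v N. t = Gv j \<and> \<theta> = v_sign N j)"
    and sh: "covers N f m \<theta> t TYPE(((seifert_gen \<times> bool) word set + seifert_gen word set) symgroup) (image_mset shape_of (mset (std_blocks N')))"
    by blast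
  have tX: "t \<in> ?X" using t(2) by (auto simp: seifert_gens_def)
  have "sat (lift_rels f t ?R) = (sheet_system \<theta> Gh t (lblocks N f m) :: (seifert_gen \<times> bool \<Rightarrow> ((seifert_gen \<times> bool) word set + seifert_gen word set) symgroup) \<Rightarrow> bool)"
    by (rule ext) (rule sat_lift_iff_sheet_system[OF fh s ev(1) m ev(2) t(2,1)])
  then have "eqv (?X \<times> UNIV) (sat (lift_rels f t ?R) :: (seifert_gen \<times> bool \<Rightarrow> ((seifert_gen \<times> bool) word set + seifert_gen word set) symgroup) \<Rightarrow> bool)
    (seifert_gens N') (sat (seifert_rels N'))"
    using has_shape_std[OF sh] by simp
  moreover have "lift_rels f t ?R \<subseteq> words (?X \<times> UNIV)"
    using seifert_rels_words[of N] tX by (auto simp: lift_rels_def)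
  ultimately have "presented_group (?X \<times> UNIV) (lift_rels f t ?R) \<cong> seifert_group N'"
    unfolding seifert_group_def by (intro eqv_iso seifert_rels_words)
  moreover have "\<phi> (pres_class ?X ?R [(t, True)]) = 1" using t(1) by (simp add: f_def)
  from kernel_iso[OF seifert_rels_words hom tX this]
  have "(seifert_group N)\<lparr>carrier := kernel (seifert_group N) (integer_mod_group 2) \<phi>\<rparr> \<cong> presented_group (?X \<times> UNIV) (lift_rels f t ?R)"
    unfolding seifert_group_def f_def by blast
  ultimately have "(seifert_group N)\<lparr>carrier := kernel (seifert_group N) (integer_mod_group 2) \<phi>\<rparr> \<cong> seifert_group N'"
    using iso_trans by blast
  moreover have "seifert_invariants N'"
    unfolding N'_def by (rule double_cover_invariants) (use assms(1) ev v x in auto)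
  ultimately show ?thesis using ev by blast
qed

end
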